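(* Let $p$ be an odd prime and $m$ a positive integer. The line bundle $\mathcal L\to\mathfrak D^{(m)}[\Lambda]$ is invariant with respect to the dynamical and qKZ connections. More precisely, for every $\lambda\in\Lambda$: (i) if $s(\boldsymbol z)$ is a local section of $\mathcal L$ over $\mathfrak D^{(m)}_*(\lambda)\times\{\lambda\}$, then $\mathcal D_i(\lambda)s(\boldsymbol z)$, $i=1,2$, also are local sections of $\mathcal L$ over $\mathfrak D^{(m)}_*(\lambda)\times\{\lambda\}$; (ii) if $s(\boldsymbol z)$ is a local section of $\mathcal L$ over $\big(\mathfrak D^{(m)}_*(\lambda)\cap\mathfrak D^{(m)}_*(\lambda+2)\big)\times\{\lambda\}$, then $\tau s(\boldsymbol z)=K(\boldsymbol z;\lambda)s(\boldsymbol z)$ is a local section of $\mathcal L$ over $\big(\mathfrak D^{(m)}_*(\lambda)\cap\mathfrak D^{(m)}_*(\lambda+2)\big)\times\{\lambda+2\}$.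
   Context: **Fields.** $\mathbb Q_p^{(m)}$ is the unramified extension of $\mathbb Q_p$ of degree $m$ in a fixed algebraic closure, with the norm $|\cdot|_p$ extending that of $\mathbb Q_p$; $\mathbb Z_p^{(m)}=\{a:|a|_p\le1\}$. Put $\mathcal W=(\mathbb Q_p^{(m)})^2$. Let $\boldsymbol z=(z_1,z_2)$, and let $\Lambda=1+2\mathbb Z$ be the set of odd integers. **Polynomials.** For an odd integer $\lambda$ with $-p^s<\lambda<p^s$ put $\Phi_s(t;\boldsymbol z;\lambda)=t^{(p^s-\lambda)/2}(t-z_1)^{(p^s-1)/2}(t-z_2)^{(p^s-1)/2}$. Let $T_s(\boldsymbol z;\lambda)\in\mathbb Z[\boldsymbol z]$ be the coefficient of $t^{p^s-1}$ in $\Phi_s$, and let $I_s=(I_{s,1},I_{s,2})$ be the column vector in which $I_{s,j}(\boldsymbol z;\lambda)\in\mathbb Z[\boldsymbol z]$ is the coefficient of $t^{p^s-1}$ in $\Phi_s/(t-z_j)$. For $w\in\{0,\dots,p-1\}$ let $h(\boldsymbol z;w)$, $g_1(\boldsymbol z;w)$, $g_2(\boldsymbol z;w)$ be the coefficients of $t^{p-1}$ in $t^w(t-z_1)^{(p-1)/2}(t-z_2)^{(p-1)/2}$, $t^w(t-z_1)^{(p-1)/2-1}(t-z_2)^{(p-1)/2}$, $t^w(t-z_1)^{(p-1)/2}(t-z_2)^{(p-1)/2-1}$ respectively. For $\lambda\in\Lambda$ let $-\lambda/2=\sum_{i\ge0}w_i(\lambda)p^i$, $0\le w_i(\lambda)\le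 p-1$, be the $p$-adic expansion, and let $W(\lambda)=\{w_i(\lambda):i\ge0\}$ be the (finite) set of distinct digits. **Domains.** $\mathfrak D^{(m)}(\lambda)=\{\boldsymbol a\in(\mathbb Z_p^{(m)})^2: |H(\boldsymbol a;\lambda)|_p=1\}$ with $H(\boldsymbol z;\lambda)=\prod_{w\in W(\lambda)}h(\boldsymbol z;w)$. If $p\nmid\lambda$, let $G_j(\boldsymbol z;\lambda)=g_j(\boldsymbol z;w_0(\lambda))\prod_{w\in W(\lambda)}h(\boldsymbol z;w)$ for $j=1,2$ and $\mathfrak D_*^{(m)}(\lambda)=\{\boldsymbol a\in(\mathbb Z_p^{(m)})^2: |G_1(\boldsymbol a;\lambda)|_p=1\text{ or }|G_2(\boldsymbol a;\lambda)|_p=1\}$. If $p\mid\lambda$, let $\mathfrak D_*^{(m)}(\lambda)=\mathfrak D^{(m)}(\lambda)\cap\mathfrak D_*^{(m)}(\lambda+2)\cap\{\boldsymbol a\in(\mathbb Z_p^{(m)})^2: a_1a_2\ne0\}$. Always $\mathfrak D_*^{(m)}(\lambda)\subset\mathfrak D^{(m)}(\lambda)$. **Limit vector and line bundle.** $\mathcal I(\boldsymbol z;\lambda)=(\mathcal I_1,\mathcal I_2)$ is the uniform limit on $\mathfrak D^{(m)}(\lambda)$, as $s\to\infty$, of $I_s(\boldsymbol z;\lambda)/T_s(\boldsymbol z;\lambda)$; the limit exists, is analytic on $\mathfrak D^{(m)}(\lambda)$, and is nonzero at every point of $\mathfrak D_*^{(m)}(\lambda)$. Set $\mathfrak D^{(m)}[\Lambda]=\bigcup_{\lambda\in\Lambda}\mathfrak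 D_*^{(m)}(\lambda)\times\{\lambda\}\subset(\mathbb Z_p^{(m)})^2\times\Lambda$. The analytic line subbundle $\mathcal L$ of the trivial bundle $\mathcal W\times\mathfrak D^{(m)}[\Lambda]\to\mathfrak D^{(m)}[\Lambda]$ has as fiber over $(\boldsymbol a,\lambda)$ the line in $\mathcal W$ spanned by $\mathcal I(\boldsymbol a;\lambda)$. A local section of $\mathcal L$ is an analytic $\mathcal W$-valued function on an open subset taking values in the fibers of $\mathcal L$ (analytic: locally given by convergent power series over $\mathbb Q_p^{(m)}$). **Connections.** The dynamical connection is given by $\mathcal D_i(\lambda)=2z_i\frac{\partial}{\partial z_i}-H_i(\boldsymbol z;\lambda)$, $i=1,2$, with $$H_1=\begin{bmatrix}-\lambda-1&-1\\0&0\end{bmatrix}+\frac{z_1}{z_1-z_2}\begin{bmatrix}-1&1\\1&-1\end{bmatrix},\qquad H_2=\begin{bmatrix}0&0\\-1&-\lambda-1\end{bmatrix}+\frac{z_2}{z_2-z_1}\begin{bmatrix}-1&1\\1&-1\end{bmatrix}.$$ The qKZ discrete connection $\tau$ sends a local section $s(\boldsymbol z)$ over $(\mathbb Z_p^{(m)})^2\times\{\lambda\}$ to the local section $K(\boldsymbol z;\lambda)s(\boldsymbol z)$ over $(\mathbb Z_p^{(m)})^2\times\{\lambda+2\}$, where $$K(\boldsymbol z;\lambda)=\begin{bmatrix}\frac{\lambda+1}{z_1\lambda}&\frac{1}{z_1\lambda}\\ \frac{1}{z_2\lambda}&\frac{\lambda+1}{z_2\lambda}\end{bmatrix}.$$ Since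 $H_i$ has a pole along $z_1=z_2$ and $K$ along $z_1z_2=0$, $\mathcal D_i(\lambda)s$ and $\tau s$ are understood as defined off these loci and extended to them by analytic continuation (the assertion that they are local sections of $\mathcal L$ includes that this extension exists). *)

theory Defs
  imports "HOL-Analysis.Analysis" "HOL-Computational_Algebra.Polynomial"
    "HOL-Computational_Algebra.Primes"
begin

class nonarchimedean_field = field_char_0 + complete_space +
  fixes absv :: "'a \<Rightarrow> real"
  assumes dist_absv: "dist x y = absv (x - y)"
    and absv_mult: "absv (x * y) = absv x * absv y"
    and absv_add: "absv (x + y) \<le> max (absv x) (absv y)"

definition padic_abs :: "nat \<Rightarrow> rat \<Rightarrow> real" where
  "padic_abs p q = (if q = 0 then 0 else
     real p powi (int (multiplicity (int p) (snd (quotient_of q)))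
                - int (multiplicity (int p) (fst (quotient_of q)))))"

text \<open>\<open>'k\<close> is an unramified extension of degree \<open>m\<close> of the field of \<open>p\<close>-adic numbers,
  normed by the extension of the \<open>p\<close>-adic norm. Inside \<open>'k\<close> the field of \<open>p\<close>-adic numbers is the
  closure of \<open>\<rat>\<close>. The degree is expressed by a basis with \<open>m\<close> elements; unramified means that
  the value group does not grow (ramification index 1; the residue extension is automatically
  separable). Such a \<open>'k\<close> is unique up to isometric isomorphism.\<close>

definition unramified_padic_field :: "'k::nonarchimedean_field itself \<Rightarrow> nat \<Rightarrow> nat \<Rightarrow> bool" where
  "unramified_padic_field K p m \<longleftrightarrow>
     (\<forall>q::rat. absv (of_rat q :: 'k) = padic_abs p q) \<and>
     (\<exists>B::'k set. finite B \<and> card B = m \<and>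
        (\<forall>x. \<exists>!c. c \<in> B \<rightarrow>\<^sub>E closure \<rat> \<and> x = (\<Sum>b\<in>B. c b * b))) \<and>
     (\<forall>x::'k. x \<noteq> 0 \<longrightarrow> (\<exists>y::'k\<in>closure \<rat>. absv x = absv y))"

text \<open>The polynomials in \<open>z = (z\<^sub>1, z\<^sub>2)\<close> are represented by their values at points of
  \<open>'k^2\<close>; the variable \<open>t\<close> is that of \<open>'k poly\<close>.\<close>

definition Phi :: "nat \<Rightarrow> nat \<Rightarrow> int \<Rightarrow> 'k::field^2 \<Rightarrow> 'k poly" where
  "Phi p s l z = monom 1 (nat ((int p ^ s - l) div 2))
     * [:- (z$1), 1:] ^ ((p ^ s - 1) div 2) * [:- (z$2), 1:] ^ ((p ^ s - 1) div 2)"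

definition Tpol :: "nat \<Rightarrow> nat \<Rightarrow> int \<Rightarrow> 'k::field^2 \<Rightarrow> 'k" where
  "Tpol p s l z = coeff (Phi p s l z) (p ^ s - 1)"

definition Ivec :: "nat \<Rightarrow> nat \<Rightarrow> int \<Rightarrow> 'k::field^2 \<Rightarrow> 'k^2" where
  "Ivec p s l z = (\<chi> j. coeff (Phi p s l z div [:- (z$j), 1:]) (p ^ s - 1))"

definition hpol :: "nat \<Rightarrow> nat \<Rightarrow> 'k::field^2 \<Rightarrow> 'k" where
  "hpol p w z = coeff (monom 1 w
     * [:- (z$1), 1:] ^ ((p - 1) div 2) * [:- (z$2), 1:] ^ ((p - 1) div 2)) (p - 1)"

definition gpol :: "nat \<Rightarrow> 2 \<Rightarrow> nat \<Rightarrow> 'k::field^2 \<Rightarrow> 'k" where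
  "gpol p j w z = coeff (monom 1 w
     * [:- (z$1), 1:] ^ ((p - 1) div 2 - (if j = 1 then 1 else 0))
     * [:- (z$2), 1:] ^ ((p - 1) div 2 - (if j = 2 then 1 else 0))) (p - 1)"

text \<open>The digits \<open>w\<^sub>i(\<lambda>)\<close> of the \<open>p\<close>-adic expansion of \<open>-\<lambda>/2\<close>; the series is summed in the
  closure of \<open>\<rat>\<close> in \<open>'k\<close>.\<close>

definition digit :: "'k::nonarchimedean_field itself \<Rightarrow> nat \<Rightarrow> int \<Rightarrow> nat \<Rightarrow> nat" where
  "digit K p l = (THE w. (\<forall>i. w i \<le> p - 1) \<and>
     (\<lambda>i. of_nat (w i) * of_nat p ^ i :: 'k) sums (- of_int l / 2))"

definition Hpol :: "nat \<Rightarrow> int \<Rightarrow> 'k::nonarchimedean_field^2 \<Rightarrow> 'k" where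
  "Hpol p l z = (\<Prod>w\<in>range (digit TYPE('k) p l). hpol p w z)"

definition Gpol :: "nat \<Rightarrow> 2 \<Rightarrow> int \<Rightarrow> 'k::nonarchimedean_field^2 \<Rightarrow> 'k" where
  "Gpol p j l z = gpol p j (digit TYPE('k) p l 0) z
     * (\<Prod>w\<in>range (digit TYPE('k) p l). hpol p w z)"

definition integral_points :: "('k::nonarchimedean_field^2) set" where
  "integral_points = {a. \<forall>i. absv (a$i) \<le> 1}"

definition Dom :: "nat \<Rightarrow> int \<Rightarrow> ('k::nonarchimedean_field^2) set" where
  "Dom p l = {a \<in> integral_points. absv (Hpol p l a) = 1}"

definition Dom_star_coprime :: "nat \<Rightarrow> int \<Rightarrow> ('k::nonarchimedean_field^2) set" where
  "Dom_star_coprime p l =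
     {a \<in> integral_points. absv (Gpol p 1 l a) = 1 \<or> absv (Gpol p 2 l a) = 1}"

text \<open>For odd \<open>p\<close> dividing \<open>\<lambda>\<close>, \<open>p\<close> does not divide \<open>\<lambda> + 2\<close>.\<close>

definition Dom_star :: "nat \<Rightarrow> int \<Rightarrow> ('k::nonarchimedean_field^2) set" where
  "Dom_star p l =
     (if int p dvd l
      then Dom p l \<inter> Dom_star_coprime p (l + 2) \<inter> {a \<in> integral_points. a$1 * a$2 \<noteq> 0}
      else Dom_star_coprime p l)"

definition Dom_Lambda :: "nat \<Rightarrow> (('k::nonarchimedean_field^2) \<times> int) set" where
  "Dom_Lambda p = (\<Union>l\<in>{l. odd l}. Dom_star p l \<times> {l})"

text \<open>The terms with \<open>p^s \<le> \<bar>\<lambda>\<bar>\<close> are not meaningful, but do not affect the limit.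
  The value of \<open>calI p l\<close> is determined on \<open>Dom p l\<close> only.\<close>

definition calI :: "nat \<Rightarrow> int \<Rightarrow> 'k::nonarchimedean_field^2 \<Rightarrow> 'k^2" where
  "calI p l = (SOME f. uniform_limit (Dom p l)
     (\<lambda>s a. inverse (Tpol p s l a) *s Ivec p s l a) f sequentially)"

definition fiber :: "nat \<Rightarrow> ('k::nonarchimedean_field^2) \<times> int \<Rightarrow> ('k^2) set" where
  "fiber p x = vec.span {calI p (snd x) (fst x)}"

definition analytic_fun_on :: "('k::nonarchimedean_field^2 \<Rightarrow> 'k) \<Rightarrow> ('k^2) set \<Rightarrow> bool" where
  "analytic_fun_on f U \<longleftrightarrow>
     (\<forall>a\<in>U. \<exists>e>0. \<exists>c :: nat \<times> nat \<Rightarrow> 'k. \<forall>x\<in>U.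
        (\<forall>i. absv (x$i - a$i) < e) \<longrightarrow>
        ((\<lambda>n. c n * (x$1 - a$1) ^ fst n * (x$2 - a$2) ^ snd n) has_sum f x) UNIV)"

definition local_section ::
    "nat \<Rightarrow> int \<Rightarrow> ('k::nonarchimedean_field^2) set \<Rightarrow> ('k^2 \<Rightarrow> 'k^2) \<Rightarrow> bool" where
  "local_section p l U s \<longleftrightarrow>
     open U \<and> U \<times> {l} \<subseteq> Dom_Lambda p \<and>
     (\<forall>j. analytic_fun_on (\<lambda>a. s a $ j) U) \<and>
     (\<forall>a\<in>U. s a \<in> fiber p (a, l))"

text \<open>The limits exist for sections analytic near \<open>a\<close>. On the loci \<open>z\<^sub>1 = z\<^sub>2\<close> and
  \<open>z\<^sub>1 z\<^sub>2 = 0\<close> the values of \<open>dynamical\<close> and \<open>qKZ\<close> are artefacts of \<open>x / 0 = 0\<close>; there the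
  connections are to be taken as analytic extensions from the complement.\<close>

definition partial :: "2 \<Rightarrow> ('k::nonarchimedean_field^2 \<Rightarrow> 'k^2) \<Rightarrow> 'k^2 \<Rightarrow> 'k^2" where
  "partial i f a = (\<chi> j. Lim (at 0) (\<lambda>h. (f (a + axis i h) $ j - f a $ j) / h))"

definition Hmat :: "2 \<Rightarrow> 'k::field^2 \<Rightarrow> int \<Rightarrow> 'k^2^2" where
  "Hmat i z l =
     (if i = 1
      then vector [vector [- of_int l - 1, - 1], vector [0, 0]]
         + map_matrix (\<lambda>x. z$1 / (z$1 - z$2) * x) (vector [vector [- 1, 1], vector [1, - 1]])
      else vector [vector [0, 0], vector [- 1, - of_int l - 1]]
         + map_matrix (\<lambda>x. z$2 / (z$2 - z$1) * x) (vector [vector [- 1, 1], vector [1, - 1]]))"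

definition dynamical ::
    "2 \<Rightarrow> int \<Rightarrow> ('k::nonarchimedean_field^2 \<Rightarrow> 'k^2) \<Rightarrow> 'k^2 \<Rightarrow> 'k^2" where
  "dynamical i l s a = (2 * a$i) *s partial i s a - Hmat i a l *v s a"

definition Kmat :: "'k::field^2 \<Rightarrow> int \<Rightarrow> 'k^2^2" where
  "Kmat z l = vector
     [vector [(of_int l + 1) / (z$1 * of_int l), 1 / (z$1 * of_int l)],
      vector [1 / (z$2 * of_int l), (of_int l + 1) / (z$2 * of_int l)]]"

definition qKZ ::
    "int \<Rightarrow> ('k::nonarchimedean_field^2 \<Rightarrow> 'k^2) \<Rightarrow> 'k^2 \<Rightarrow> 'k^2" where
  "qKZ l s a = Kmat a l *v s a"

end

theory Submission
  imports Defs
begin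

text \<open>
  The argument is an approximation by polynomials. Write \<open>I\<^sub>s\<close> and \<open>T\<^sub>s\<close> for the
  polynomials in \<open>z\<close> cut out of \<open>\<Phi>\<^sub>s\<close> by the coefficient of \<open>t^(p^s - 1)\<close>. In the
  derivative of a polynomial in \<open>t\<close> this coefficient is divisible by \<open>p^s\<close>. Applied to suitable
  multiples of \<open>\<Phi>\<^sub>s\<close> this says that \<open>I\<^sub>s\<close> solves the dynamical equations modulo \<open>p^s\<close>
  (\<open>Ivec_dynamics\<close>), and that passing from \<open>\<lambda>\<close> to \<open>\<lambda> + 2\<close>, which divides \<open>\<Phi>\<^sub>s\<close>
  by \<open>t\<close>, acts on \<open>I\<^sub>s\<close> by the qKZ operator modulo \<open>p^s\<close> (\<open>Ivec_shift\<close>,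
  \<open>Tpol_shift\<close>).

  The quotient \<open>I\<^sub>s / T\<^sub>s\<close> converges because of a Dwork congruence. The digits of
  \<open>-\<lambda>/2\<close> factor \<open>\<Phi>\<^sub>s\<close> as a product of \<open>p^n\<close>-th powers of fixed polynomials
  \<open>\<Lambda>\<^sub>n(t)\<close>, and modulo \<open>p\<close> such a power is a polynomial in \<open>t^(p^n)\<close>. Correcting this
  statement to higher powers of \<open>p\<close> (\<open>ghost_expansion\<close>) shows that replacing \<open>s\<close> by
  \<open>s + 1\<close> multiplies \<open>I\<^sub>s\<close> and \<open>T\<^sub>s\<close> by the same unit modulo \<open>p^s\<close>
  (\<open>dwork_congruence\<close>). Hence the limit differs from \<open>I\<^sub>s / T\<^sub>s\<close> by a multiple of
  \<open>p^s\<close>, uniformly on the domain (\<open>calI_close\<close>), and it does not vanish on the smaller domain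
  (\<open>calI_nonzero\<close>). Consequently a vector lies in the fiber exactly when its wedge product with
  \<open>I\<^sub>s\<close> tends to \<open>0\<close> (\<open>wedge_Ivec_le\<close>, \<open>fiberI_wedge_Ivec\<close>).

  For a section \<open>\<sigma>\<close> the functions \<open>\<sigma> \<and> I\<^sub>s\<close> tend to \<open>0\<close> uniformly near each
  point. A uniformly small function need not have a small derivative, but the Taylor remainders of
  the integral polynomials \<open>I\<^sub>s\<close> are bounded independently of \<open>s\<close>, so a difference quotient
  with a fixed small step controls the derivative. By the product rule and the equations for
  \<open>I\<^sub>s\<close>, the wedge product of the dynamical operator applied to \<open>\<sigma>\<close> with \<open>I\<^sub>s\<close> tends
  to \<open>0\<close> (\<open>dynamics_pointwise\<close>). The qKZ operator is handled by algebra alone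
  (\<open>qKZ_pointwise\<close>).

  The poles are removable: the limit vector has equal components on \<open>z\<^sub>1 = z\<^sub>2\<close>, and on
  the axis \<open>z\<^sub>j = 0\<close> it is annihilated by the numerators in the \<open>j\<close>-th row of the qKZ
  matrix, so that sections inherit these relations and the quotients are analytic by division of power series
  (\<open>analytic_fun_on_divide_linear\<close>). The complement of the poles is dense and the limit vector
  is continuous, so the extended functions still take values in the fibers (\<open>fiber_closed\<close>).
\<close>

section \<open>Nonarchimedean fields\<close>

lemma dist_eq_absv: "dist x y = absv (x - y)" for x y :: "'a::nonarchimedean_field"
  by (rule dist_absv)

lemma absv_zero [simp]: "absv (0::'a::nonarchimedean_field) = 0"
  using dist_absv[of "0::'a" 0] by simp

lemma absv_nonneg [simp]: "0 \<le> absv (x::'a::nonarchimedean_field)"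
  using dist_absv[of x 0] zero_le_dist[of x 0] by simp

lemma absv_eq_0_iff [simp]: "absv x = 0 \<longleftrightarrow> x = (0::'a::nonarchimedean_field)"
  using dist_absv[of x 0] by (metis diff_zero dist_eq_0_iff)

lemma absv_pos [simp]: "0 < absv x \<longleftrightarrow> x \<noteq> (0::'a::nonarchimedean_field)"
  using absv_nonneg[of x] absv_eq_0_iff[of x] by linarith

lemma absv_one [simp]: "absv (1::'a::nonarchimedean_field) = 1"
  using absv_mult[of "1::'a" 1] absv_eq_0_iff[of "1::'a"] by simp

lemma absv_minus [simp]: "absv (- x) = absv (x::'a::nonarchimedean_field)"
  using dist_absv[of 0 x] dist_absv[of x 0] by (simp add: dist_commute)

lemma absv_minus_commute: "absv (x - y) = absv (y - x :: 'a::nonarchimedean_field)"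
  using absv_minus[of "x - y"] by simp

lemma absv_add_le: "absv x \<le> r \<Longrightarrow> absv y \<le> r \<Longrightarrow> absv (x + y :: 'a::nonarchimedean_field) \<le> r"
  using absv_add[of x y] by simp

lemma absv_diff_le: "absv x \<le> r \<Longrightarrow> absv y \<le> r \<Longrightarrow> absv (x - y :: 'a::nonarchimedean_field) \<le> r"
  using absv_add_le[of x r "- y"] by simp

lemma absv_add_less: "absv x < r \<Longrightarrow> absv y < r \<Longrightarrow> absv (x + y :: 'a::nonarchimedean_field) < r"
  using absv_add[of x y] by simp

lemma absv_diff_less: "absv x < r \<Longrightarrow> absv y < r \<Longrightarrow> absv (x - y :: 'a::nonarchimedean_field) < r"
  using absv_add_less[of x r "- y"] by simp

lemma absv_trans_le:
  "absv (x - y) \<le> r \<Longrightarrow> absv (y - z) \<le> r \<Longrightarrow> absv (x - z :: 'a::nonarchimedean_field) \<le> r"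
  using absv_add_le[of "x - y" r "y - z"] by simp

lemma absv_mult_le:
  "absv x \<le> r \<Longrightarrow> absv y \<le> r' \<Longrightarrow> absv (x * y :: 'a::nonarchimedean_field) \<le> r * r'"
  unfolding absv_mult by (rule mult_mono) (auto intro: order_trans[OF absv_nonneg])

lemma absv_mult_le1:
  "absv x \<le> r \<Longrightarrow> absv y \<le> 1 \<Longrightarrow> absv (x * y :: 'a::nonarchimedean_field) \<le> r"
  using absv_mult_le[of x r y 1] by simp

lemma absv_mult_le1':
  "absv x \<le> 1 \<Longrightarrow> absv y \<le> r \<Longrightarrow> absv (x * y :: 'a::nonarchimedean_field) \<le> r"
  using absv_mult_le[of x 1 y r] by simp

lemma absv_power: "absv (x ^ n) = absv (x::'a::nonarchimedean_field) ^ n"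
  by (induction n) (auto simp: absv_mult)

lemma absv_inverse: "absv (inverse x) = inverse (absv (x::'a::nonarchimedean_field))"
proof (cases "x = 0")
  case False
  then have "absv x * absv (inverse x) = 1"
    by (simp flip: absv_mult)
  with False show ?thesis by (simp add: field_simps)
qed simp

lemma absv_divide: "absv (x / y) = absv x / absv (y::'a::nonarchimedean_field)"
  by (simp add: field_class.field_divide_inverse absv_mult absv_inverse)

lemma absv_sum_le:
  assumes "0 \<le> r" "\<And>i. i \<in> A \<Longrightarrow> absv (f i) \<le> r"
  shows "absv (sum f A :: 'a::nonarchimedean_field) \<le> r"
  using assms by (induction A rule: infinite_finite_induct) (auto intro: absv_add_le)

lemma absv_prod: "absv (prod f A :: 'a::nonarchimedean_field) = (\<Prod>i\<in>A. absv (f i))"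
  by (induction A rule: infinite_finite_induct) (auto simp: absv_mult)

lemma absv_of_nat_le_1: "absv (of_nat n :: 'a::nonarchimedean_field) \<le> 1"
  by (induction n) (auto intro: absv_add_le)

lemma absv_two_le_1 [simp]: "absv (2 :: 'a::nonarchimedean_field) \<le> 1"
  using absv_of_nat_le_1[of 2, where 'a='a] by simp

lemma absv_of_int_le_1: "absv (of_int n :: 'a::nonarchimedean_field) \<le> 1"
  by (cases n rule: int_cases2) (auto intro: absv_of_nat_le_1)

lemma absv_of_int_dvd:
  assumes "d dvd n"
  shows "absv (of_int n :: 'a::nonarchimedean_field) \<le> absv (of_int d :: 'a)"
proof -
  from assms obtain k where "n = d * k" by blast
  then show ?thesis by (simp add: absv_mult_le1 absv_of_int_le_1)
qed

lemma absv_eq_of_close: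
  assumes "absv (x - y) < absv (y::'a::nonarchimedean_field)"
  shows "absv x = absv y"
proof (rule antisym)
  show "absv x \<le> absv y"
    using absv_add_le[of "x - y" "absv y" y] assms by simp
  show "absv y \<le> absv x"
    using absv_add[of "y - x" x] assms by (auto simp: absv_minus_commute max_def split: if_splits)
qed

text \<open>Addition and multiplication are continuous, on which the theory of sums of families rests.\<close>

instance nonarchimedean_field \<subseteq> topological_ab_group_add
proof
  fix a b :: 'a
  show "LIM x (nhds a \<times>\<^sub>F nhds b). fst x + snd x :> nhds (a + b)"
  proof (rule tendstoI)
    fix e :: real assume "e > 0"
    then have "\<forall>\<^sub>F x in nhds a. dist x a < e" "\<forall>\<^sub>F x in nhds b. dist x b < e"
      by (auto simp: eventually_nhds_metric)
    then have "\<forall>\<^sub>F x in nhds a \<times>\<^sub>F nhds b. dist (fst x) a < e \<and> dist (snd x) b < e"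
      unfolding eventually_prod_filter by fastforce
    then show "\<forall>\<^sub>F x in nhds a \<times>\<^sub>F nhds b. dist (fst x + snd x) (a + b) < e"
      by eventually_elim
        (auto simp: dist_eq_absv add_diff_add intro: absv_add_less)
  qed
  show "(uminus \<longlongrightarrow> - a) (nhds a)"
  proof (rule tendstoI)
    fix e :: real assume "e > 0"
    then have "\<forall>\<^sub>F x in nhds a. dist x a < e"
      by (auto simp: eventually_nhds_metric)
    then show "\<forall>\<^sub>F x in nhds a. dist (- x) (- a) < e"
      by eventually_elim (metis add.commute dist_absv absv_minus_commute diff_minus_eq_add
          uminus_add_conv_diff)
  qed
qed

instance nonarchimedean_field \<subseteq> topological_semigroup_mult
proof
  fix a b :: 'a
  show "LIM x (nhds a \<times>\<^sub>F nhds b). fst x * snd x :> nhds (a * b)"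
  proof (rule tendstoI)
    fix e :: real assume "e > 0"
    define M where "M = absv a + absv b + 1"
    define d where "d = min 1 (e / M)"
    have M: "M > 0" by (simp add: M_def add_nonneg_pos)
    have d: "d > 0" "d \<le> 1" "d * M \<le> e"
      using \<open>e > 0\<close> M by (auto simp: d_def min_def field_simps)
    then have "\<forall>\<^sub>F x in nhds a. dist x a < d" "\<forall>\<^sub>F x in nhds b. dist x b < d"
      by (auto simp: eventually_nhds_metric)
    then have "\<forall>\<^sub>F x in nhds a \<times>\<^sub>F nhds b. dist (fst x) a < d \<and> dist (snd x) b < d"
      unfolding eventually_prod_filter by fastforce
    then show "\<forall>\<^sub>F x in nhds a \<times>\<^sub>F nhds b. dist (fst x * snd x) (a * b) < e"
    proof eventually_elim
      case (elim x)
      define u v where "u = fst x - a" and "v = snd x - b"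
      have uv: "absv u < d" "absv v < d" using elim by (auto simp: u_def v_def dist_eq_absv)
      have "absv u * absv (b + v) \<le> absv u * M"
      proof (rule mult_left_mono)
        have "absv v \<le> 1" using uv d by linarith
        then show "absv (b + v) \<le> M"
          using absv_add[of b v] absv_nonneg[of a] absv_nonneg[of b] unfolding M_def by linarith
      qed simp
      also have "\<dots> < d * M" using uv M by simp
      finally have 1: "absv (u * (b + v)) < e" using d by (simp add: absv_mult)
      have "absv a * absv v \<le> M * absv v"
        using absv_nonneg[of b] by (intro mult_right_mono) (auto simp: M_def)
      also have "\<dots> < M * d" using uv M by simp
      finally have 2: "absv (a * v) < e" using d by (simp add: absv_mult mult.commute)
      have "fst x * snd x - a * b = u * (b + v) + a * v"
        by (simp add: u_def v_def algebra_simps)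
      then show ?case using absv_add_less[OF 1 2] by (simp add: dist_eq_absv)
    qed
  qed
qed

lemma tendsto_absv_iff:
  "(f \<longlongrightarrow> (l::'a::nonarchimedean_field)) F \<longleftrightarrow> (\<forall>e>0. \<forall>\<^sub>F x in F. absv (f x - l) < e)"
  by (simp add: tendsto_iff dist_eq_absv)

section \<open>Gauss bounds of polynomials\<close>

definition gauss_le :: "real \<Rightarrow> 'a::nonarchimedean_field poly \<Rightarrow> bool" where
  "gauss_le r f \<longleftrightarrow> (\<forall>n. absv (coeff f n) \<le> r)"

lemma gauss_leI: "(\<And>n. absv (coeff f n) \<le> r) \<Longrightarrow> gauss_le r f"
  by (simp add: gauss_le_def)

lemma gauss_leD: "gauss_le r f \<Longrightarrow> absv (coeff f n) \<le> r"
  by (simp add: gauss_le_def)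

lemma gauss_le_nonneg: "gauss_le r f \<Longrightarrow> 0 \<le> r"
  using absv_nonneg order_trans gauss_leD by blast

lemma gauss_le_mono: "gauss_le r f \<Longrightarrow> r \<le> r' \<Longrightarrow> gauss_le r' f"
  by (auto simp: gauss_le_def intro: order_trans)

lemma gauss_le_0: "0 \<le> r \<Longrightarrow> gauss_le r 0"
  by (simp add: gauss_le_def)

lemma gauss_le_add: "gauss_le r f \<Longrightarrow> gauss_le r g \<Longrightarrow> gauss_le r (f + g)"
  by (auto simp: gauss_le_def intro: absv_add_le)

lemma gauss_le_diff: "gauss_le r f \<Longrightarrow> gauss_le r g \<Longrightarrow> gauss_le r (f - g)"
  by (auto simp: gauss_le_def intro: absv_diff_le)

lemma gauss_le_sum: "0 \<le> r \<Longrightarrow> (\<And>i. i \<in> A \<Longrightarrow> gauss_le r (f i)) \<Longrightarrow> gauss_le r (sum f A)"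
  by (auto simp: gauss_le_def coeff_sum intro!: absv_sum_le)

lemma gauss_le_mult:
  assumes "gauss_le r f" "gauss_le r' g"
  shows "gauss_le (r * r') (f * g)"
proof (rule gauss_leI)
  fix n
  show "absv (coeff (f * g) n) \<le> r * r'"
    unfolding coeff_mult using assms
    by (intro absv_sum_le absv_mult_le) (auto simp: gauss_le_nonneg gauss_leD)
qed

lemma gauss_le_mult1: "gauss_le r f \<Longrightarrow> gauss_le 1 g \<Longrightarrow> gauss_le r (f * g)"
  using gauss_le_mult[of r f 1 g] by simp

lemma gauss_le_mult1': "gauss_le 1 f \<Longrightarrow> gauss_le r g \<Longrightarrow> gauss_le r (f * g)"
  using gauss_le_mult[of 1 f r g] by simp

lemma gauss_le_1: "gauss_le 1 1"
  by (auto simp: gauss_le_def coeff_1)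

lemma gauss_le_power: "gauss_le 1 f \<Longrightarrow> gauss_le 1 (f ^ n)"
  by (induction n) (auto intro: gauss_le_1 gauss_le_mult1)

lemma gauss_le_prod: "(\<And>i. i \<in> A \<Longrightarrow> gauss_le 1 (f i)) \<Longrightarrow> gauss_le 1 (prod f A)"
  by (induction A rule: infinite_finite_induct) (auto intro: gauss_le_1 gauss_le_mult1)

lemma gauss_le_monom: "absv c \<le> r \<Longrightarrow> gauss_le r (monom c n)"
  by (auto simp: gauss_le_def intro: order_trans[OF absv_nonneg])

lemma gauss_le_const: "absv c \<le> r \<Longrightarrow> gauss_le r [:c:]"
  using gauss_le_monom[of c r 0] by (simp add: monom_0)

lemma gauss_le_smult: "absv c \<le> r \<Longrightarrow> gauss_le 1 f \<Longrightarrow> gauss_le r (smult c f)"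
  by (simp add: gauss_le_def absv_mult_le1)

lemma gauss_le_linear: "absv x \<le> 1 \<Longrightarrow> gauss_le 1 [:- x, 1:]"
  by (auto simp: gauss_le_def coeff_pCons split: nat.splits)

lemma gauss_le_of_nat_mult:
  "absv (of_nat n :: 'a::nonarchimedean_field) \<le> r \<Longrightarrow> gauss_le 1 f \<Longrightarrow> gauss_le r (of_nat n * f :: 'a poly)"
  by (simp add: of_nat_poly gauss_le_smult)

lemma coeff_pcompose_monom:
  fixes f :: "'a::comm_semiring_1 poly"
  assumes "q > 0"
  shows "coeff (pcompose f (monom 1 q)) n = (if q dvd n then coeff f (n div q) else 0)"
proof (induction f arbitrary: n)
  case (pCons a f)
  show ?case
  proof (cases "n < q")
    case True
    then show ?thesis using assms
      by (auto simp: pcompose_pCons coeff_monom_mult coeff_pCons split: nat.splits)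
  next
    case False
    then obtain k where "n = k + q" by (metis add.commute le_add_diff_inverse not_less)
    then show ?thesis using assms
      by (auto simp: pcompose_pCons coeff_monom_mult coeff_pCons pCons.IH split: nat.splits)
  qed
qed simp

lemma gauss_le_pcompose_monom:
  assumes "gauss_le r f" "q > 0"
  shows "gauss_le r (pcompose f (monom 1 q))"
  using gauss_leD[OF assms(1)] gauss_le_nonneg[OF assms(1)] assms(2)
  by (auto intro!: gauss_leI simp: coeff_pcompose_monom)

section \<open>Congruences modulo powers of the prime\<close>

text \<open>Powers of \<open>p\<close> tend to \<open>0\<close>, and a congruence modulo \<open>p^s\<close> becomes the bound
  \<open>|p|^s\<close> on the difference. The number \<open>|p|\<close> is called \<open>\<pi>\<close>.\<close>

locale residue_char =
  fixes p :: nat and K :: "'k::nonarchimedean_field itself"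
  assumes prime_p: "prime p" and odd_p: "odd p" and absv_p: "absv (of_nat p :: 'k) < 1"
begin

definition \<pi> :: real where "\<pi> = absv (of_nat p :: 'k)"

lemma p_ge_3: "p \<ge> 3"
  using prime_ge_2_nat[OF prime_p] odd_p by (cases "p = 2") auto

lemma p_pos [simp]: "0 < p"
  using p_ge_3 by simp

lemma p_ge_1 [simp]: "Suc 0 \<le> p"
  using p_ge_3 by linarith

lemma p_nonzero [simp]: "p \<noteq> 0"
  using p_ge_3 by linarith

lemma p_power_Suc: "p ^ Suc n = p ^ n + (p - 1) * p ^ n"
  using p_pos by (cases p) (simp_all add: algebra_simps del: p_pos)

lemma pi_pos [simp]: "0 < \<pi>"
  by (simp add: \<pi>_def)

lemma pi_less_1: "\<pi> < 1"
  using absv_p by (simp add: \<pi>_def)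

lemma pi_power_le: "m \<le> n \<Longrightarrow> \<pi> ^ n \<le> \<pi> ^ m"
  using pi_less_1 by (simp add: power_decreasing less_imp_le)

lemma pi_power_le_1 [simp]: "\<pi> ^ n \<le> 1"
  using pi_less_1 by (simp add: power_le_one less_imp_le)

lemma pi_power_nonneg [simp]: "0 \<le> \<pi> ^ n"
  using pi_pos by (simp add: less_imp_le)

lemma pi_power_tendsto: "(\<lambda>s. \<pi> ^ s) \<longlonglongrightarrow> 0"
  using pi_less_1 by (intro LIMSEQ_realpow_zero) (auto intro: less_imp_le)

lemma ex_pi_power_less: "0 < e \<Longrightarrow> \<exists>S. \<forall>s\<ge>S. \<pi> ^ s < e"
  using order_tendstoD(2)[OF pi_power_tendsto] by (simp add: eventually_sequentially)

lemma absv_int_dvd: "int p ^ s dvd n \<Longrightarrow> absv (of_int n :: 'k) \<le> \<pi> ^ s"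
  using absv_of_int_dvd[of "int p ^ s" n, where 'a='k] by (simp add: absv_power \<pi>_def)

lemma absv_nat_dvd: "p ^ s dvd n \<Longrightarrow> absv (of_nat n :: 'k) \<le> \<pi> ^ s"
  using absv_int_dvd[of s "int n"] by (metis of_int_of_nat_eq of_nat_dvd_iff of_nat_power)

text \<open>A Bezout relation with \<open>p\<close> would otherwise bound \<open>1\<close> by a number below \<open>1\<close>.\<close>

lemma absv_int_coprime:
  assumes "\<not> int p dvd n"
  shows "absv (of_int n :: 'k) = 1"
proof -
  have "coprime (int p) n"
    using prime_p assms by (simp add: prime_imp_coprime)
  then obtain u v where uv: "u * int p + v * n = 1"
    using bezout_int[of "int p" n] by auto
  have "1 \<le> absv (of_int n :: 'k)"
  proof (rule ccontr)
    assume *: "\<not> ?thesis"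
    have "absv (of_int (u * int p) :: 'k) < 1"
      using absv_int_dvd[of 1 "u * int p"] pi_less_1 by simp
    moreover have "absv (of_int (v * n) :: 'k) < 1"
      using * absv_of_int_dvd[of n "v * n", where 'a='k] by simp
    ultimately have "absv (of_int (u * int p) + of_int (v * n) :: 'k) < 1"
      by (rule absv_add_less)
    then show False
      using uv by (metis absv_one of_int_1 of_int_add order_less_irrefl)
  qed
  with absv_of_int_le_1[of n, where 'a='k] show ?thesis by simp
qed

lemma absv_int_le_imp_dvd:
  assumes "absv (of_int n :: 'k) \<le> \<pi> ^ s"
  shows "int p ^ s dvd n"
  using assms
proof (induction s arbitrary: n)
  case (Suc s)
  have "int p dvd n"
  proof (rule ccontr)
    assume "\<not> ?thesis"
    with Suc.prems have "1 \<le> \<pi> ^ Suc s" by (simp add: absv_int_coprime)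
    then show False using pi_less_1 pi_pos power_Suc_less_one[of \<pi> s] by simp
  qed
  then obtain k where k: "n = int p * k" by blast
  with Suc.prems have "\<pi> * absv (of_int k :: 'k) \<le> \<pi> * \<pi> ^ s"
    by (simp add: absv_mult \<pi>_def)
  then have "int p ^ s dvd k" using Suc.IH by simp
  then show ?case using k by simp
qed simp

text \<open>The inner binomial coefficients are divisible by \<open>p\<close>.\<close>

lemma gauss_le_freshman:
  fixes f g :: "'k poly"
  assumes f: "gauss_le 1 f" and g: "gauss_le 1 g"
  shows "gauss_le \<pi> ((f + g) ^ p - (f ^ p + g ^ p))"
proof -
  let ?t = "\<lambda>k. of_nat (p choose k) * f ^ k * g ^ (p - k)"
  have "(f + g) ^ p = (\<Sum>k\<le>p. ?t k)"
    by (rule binomial_ring)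
  also have "{..p} = insert 0 (insert p {1..<p})" by auto
  also have "sum ?t \<dots> = g ^ p + (f ^ p + sum ?t {1..<p})"
    by simp
  finally have "(f + g) ^ p - (f ^ p + g ^ p) = sum ?t {1..<p}" by simp
  moreover have "gauss_le \<pi> (sum ?t {1..<p})"
  proof (rule gauss_le_sum)
    fix k assume k: "k \<in> {1..<p}"
    then have "p ^ 1 dvd (p choose k)" using prime_p by (auto intro: dvd_choose_prime)
    then have "gauss_le \<pi> (of_nat (p choose k) * f ^ k)"
      using absv_nat_dvd[of 1 "p choose k"] f by (intro gauss_le_of_nat_mult gauss_le_power) simp_all
    then show "gauss_le \<pi> (?t k)"
      by (rule gauss_le_mult1[OF _ gauss_le_power[OF g]])
  qed (simp add: less_imp_le)
  ultimately show ?thesis by simp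
qed

text \<open>The binomial congruence, applied to one coefficient after the other.\<close>

lemma gauss_le_frobenius:
  fixes f :: "'k poly"
  assumes "gauss_le 1 f"
  shows "gauss_le \<pi> (f ^ p - pcompose (map_poly (\<lambda>c. c ^ p) f) (monom 1 p))"
  using assms
proof (induction f)
  case 0
  then show ?case using p_pos by (simp add: gauss_le_0 less_imp_le power_0_left del: p_pos)
next
  case (pCons a f)
  let ?\<sigma> = "map_poly (\<lambda>c::'k. c ^ p)"
  have a: "absv a \<le> 1" using gauss_leD[OF pCons.prems, of 0] by simp
  have f: "gauss_le 1 f"
  proof (rule gauss_leI)
    fix n show "absv (coeff f n) \<le> 1" using gauss_leD[OF pCons.prems, of "Suc n"] by simp
  qed
  have X: "pCons 0 f = monom 1 1 * f"
    by (simp add: monom_Suc)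
  have g: "gauss_le 1 (pCons 0 f)"
    unfolding X using f by (intro gauss_le_mult1 gauss_le_monom) auto
  have "pCons a f ^ p - pcompose (?\<sigma> (pCons a f)) (monom 1 p)
      = (([:a:] + pCons 0 f) ^ p - ([:a:] ^ p + pCons 0 f ^ p))
        + monom 1 p * (f ^ p - pcompose (?\<sigma> f) (monom 1 p))"
  proof -
    have "[:a:] + pCons 0 f = pCons a f" by simp
    moreover have "pCons 0 f ^ p = monom 1 p * f ^ p"
      by (simp add: X power_mult_distrib monom_power)
    moreover have "pcompose (?\<sigma> (pCons a f)) (monom 1 p)
        = [:a:] ^ p + monom 1 p * pcompose (?\<sigma> f) (monom 1 p)"
      by (simp add: map_poly_pCons pcompose_pCons poly_const_pow)
    ultimately show ?thesis by (simp add: algebra_simps)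
  qed
  moreover have "gauss_le \<pi> \<dots>"
  proof (rule gauss_le_add)
    show "gauss_le \<pi> (([:a:] + pCons 0 f) ^ p - ([:a:] ^ p + pCons 0 f ^ p))"
      using a g by (intro gauss_le_freshman gauss_le_const)
    show "gauss_le \<pi> (monom 1 p * (f ^ p - pcompose (?\<sigma> f) (monom 1 p)))"
      using pCons.IH[OF f] by (intro gauss_le_mult1' gauss_le_monom) auto
  qed
  ultimately show ?case by (simp only:)
qed

lemma gauss_le_power_diff:
  fixes f g :: "'k poly"
  assumes "gauss_le 1 f" "gauss_le 1 g" "gauss_le r (f - g)"
  shows "gauss_le r (f ^ n - g ^ n)"
  unfolding power_diff_sumr2 using assms
  by (intro gauss_le_mult1 gauss_le_sum gauss_le_power) auto

text \<open>One factor \<open>p\<close> is gained: in \<open>f^p - g^p = (f - g) \<Sum> g^(p-1-i) f^i\<close> all terms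
  of the sum are congruent to \<open>f^(p-1)\<close> modulo \<open>p\<close>, and there are \<open>p\<close> of them.\<close>

lemma gauss_le_power_p_diff:
  fixes f g :: "'k poly"
  assumes f: "gauss_le 1 f" and g: "gauss_le 1 g" and fg: "gauss_le (\<pi> ^ Suc e) (f - g)"
  shows "gauss_le (\<pi> ^ Suc (Suc e)) (f ^ p - g ^ p)"
proof -
  let ?S = "\<Sum>i<p. g ^ (p - Suc i) * f ^ i"
  have fg1: "gauss_le \<pi> (g - f)"
  proof -
    have "gauss_le \<pi> (f - g)"
      using pi_power_le[of 1 "Suc e"] by (intro gauss_le_mono[OF fg]) simp
    then show ?thesis by (simp add: gauss_le_def absv_minus_commute)
  qed
  have "?S = (\<Sum>i<p. (g ^ (p - Suc i) - f ^ (p - Suc i)) * f ^ i) + of_nat p * f ^ (p - 1)"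
  proof -
    have "g ^ (p - Suc i) * f ^ i = (g ^ (p - Suc i) - f ^ (p - Suc i)) * f ^ i + f ^ (p - 1)"
      if "i < p" for i
    proof -
      have "f ^ (p - Suc i) * f ^ i = f ^ (p - 1)" using that by (simp flip: power_add)
      then show ?thesis by (simp add: algebra_simps)
    qed
    then have "?S = (\<Sum>i<p. (g ^ (p - Suc i) - f ^ (p - Suc i)) * f ^ i + f ^ (p - 1))"
      by (intro sum.cong) auto
    then show ?thesis by (simp add: sum.distrib)
  qed
  moreover have "gauss_le \<pi> \<dots>"
    using f g fg1
    by (intro gauss_le_add gauss_le_sum gauss_le_mult1 gauss_le_power_diff gauss_le_power
        gauss_le_of_nat_mult) (auto simp: \<pi>_def)
  ultimately have "gauss_le (\<pi> ^ Suc e * \<pi>) ((f - g) * ?S)"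
    using fg by (intro gauss_le_mult) auto
  then show ?thesis by (simp add: power_diff_sumr2 mult.commute)
qed

lemma gauss_le_power_p_power_diff:
  fixes f g :: "'k poly"
  assumes f: "gauss_le 1 f" and g: "gauss_le 1 g" and fg: "gauss_le \<pi> (f - g)"
  shows "gauss_le (\<pi> ^ Suc e) (f ^ (p ^ e) - g ^ (p ^ e))"
proof (induction e)
  case (Suc e)
  then have "gauss_le (\<pi> ^ Suc (Suc e)) ((f ^ (p ^ e)) ^ p - (g ^ (p ^ e)) ^ p)"
    using f g by (intro gauss_le_power_p_diff gauss_le_power)
  then show ?case by (simp add: mult.commute flip: power_mult)
qed (use fg in simp)

end

section \<open>Dwork congruences\<close>

abbreviation stretch :: "nat \<Rightarrow> 'a::comm_semiring_1 poly \<Rightarrow> 'a poly" where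
  "stretch q f \<equiv> pcompose f (monom 1 q)"

lemma stretch_by_1: "stretch 1 f = f"
proof -
  have "monom 1 1 = [:0, 1::'a:]" by (simp add: monom_Suc monom_0)
  then show ?thesis by (simp only: pcompose_idR)
qed

lemma stretch_mult: "stretch q (f * g) = stretch q f * stretch q g"
  for f :: "'a::field poly"
  by (rule pcompose_mult)

lemma stretch_power: "stretch q (f ^ n) = stretch q f ^ n"
  for f :: "'a::field poly"
  by (induction n) (auto simp: pcompose_mult pcompose_1)

lemma stretch_stretch: "stretch q (stretch q' f) = stretch (q * q') f"
  for f :: "'a::field poly"
proof -
  have "stretch q (monom 1 q') = (monom 1 (q * q') :: 'a poly)"
  proof -
    have "monom 1 q' = (monom 1 1 ^ q' :: 'a poly)" by (simp add: monom_power)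
    moreover have "stretch q (monom 1 1) = (monom 1 q :: 'a poly)"
      by (simp add: monom_Suc pcompose_pCons pcompose_1)
    ultimately show ?thesis
      by (simp only: stretch_power) (simp add: monom_power del: One_nat_def)
  qed
  then show ?thesis by (simp flip: pcompose_assoc)
qed

lemma degree_stretch: "degree (stretch q f) = q * degree f"
  for f :: "'a::field poly"
  by (simp add: degree_pcompose degree_monom_eq mult.commute)

text \<open>The exponents of \<open>G(t^q)\<close> are multiples of \<open>q\<close>, so a contributing exponent of \<open>R\<close>
  is congruent to \<open>-1\<close> modulo \<open>q\<close>; below \<open>2q - 1\<close> there is only \<open>q - 1\<close>.\<close>

lemma coeff_mult_stretch:
  fixes R G :: "'a::field poly"
  assumes q: "q > 0" and N: "N > 0" and deg: "degree R \<le> 2 * (q - 1)"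
  shows "coeff (R * stretch q G) (q * N - 1) = coeff R (q - 1) * coeff G (N - 1)"
proof -
  let ?t = "\<lambda>i. coeff R i * coeff (stretch q G) (q * N - 1 - i)"
  have qN: "q - 1 \<le> q * N - 1" using q N by (simp add: diff_le_mono)
  have "coeff (R * stretch q G) (q * N - 1) = (\<Sum>i\<le>q * N - 1. ?t i)"
    by (rule coeff_mult)
  also have "\<dots> = (\<Sum>i\<in>{q - 1}. ?t i)"
  proof (rule sum.mono_neutral_right)
    show "\<forall>i\<in>{..q * N - 1} - {q - 1}. ?t i = 0"
    proof (intro ballI)
      fix i assume i: "i \<in> {..q * N - 1} - {q - 1}"
      show "?t i = 0"
      proof (cases "q dvd q * N - 1 - i \<and> i \<le> degree R")
        case True
        then obtain k where k: "q * N - 1 - i = q * k" by blast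
        then have "i + 1 = q * N - q * k"
        proof -
          have "q * N > 0" using q N by simp
          moreover have "i \<le> q * N - 1" using i by simp
          ultimately show ?thesis using k by linarith
        qed
        then have ik: "i + 1 = q * (N - k)" by (simp add: diff_mult_distrib2)
        moreover have "q * (N - k) < q * 2" unfolding ik[symmetric] using True deg q by linarith
        ultimately have "N - k = 1" using q by (cases "N - k") auto
        with ik i q have False by auto
        then show ?thesis ..
      next
        case False
        then show ?thesis by (auto simp: coeff_pcompose_monom q coeff_eq_0)
      qed
    qed
  qed (use qN in auto)
  also have "\<dots> = coeff R (q - 1) * coeff G (N - 1)"
  proof -
    have "q * N - 1 - (q - 1) = q * (N - 1)"
      using q N by (simp add: diff_mult_distrib2)
    then show ?thesis using q by (simp add: coeff_pcompose_monom)
  qed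
  finally show ?thesis .
qed

context residue_char
begin

text \<open>The arithmetic core of the Dwork congruence. Two sequences \<open>x\<close>, \<open>y\<close> whose quotients
  \<open>y\<^sub>k / x\<^sub>k\<close> vary slowly, the slower the smaller \<open>k\<close> is, are combined with
  coefficients \<open>r\<^sub>j\<close> that decay like \<open>p^j\<close>. Decay and variation compensate, so the
  combinations have the quotient \<open>y\<^sub>1 / x\<^sub>1\<close> modulo \<open>p^s\<close>.\<close>

lemma dwork_ratio_step:
  fixes r x y :: "nat \<Rightarrow> 'k"
  assumes x: "\<And>k. 1 \<le> k \<Longrightarrow> k \<le> s \<Longrightarrow> absv (x k) = 1"
    and y: "absv (y (Suc s)) \<le> 1" and r: "\<And>j. absv (r j) \<le> \<pi> ^ j" and s: "1 \<le> s"
    and rho: "\<And>k. 1 \<le> k \<Longrightarrow> k < s \<Longrightarrow>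
      absv (y k / x k - y (Suc k) / x (Suc k)) \<le> \<pi> ^ (s - k)"
  shows "absv ((\<Sum>j<Suc s. r j * y (Suc j)) - y 1 / x 1 * (\<Sum>j<s. r j * x (Suc j))) \<le> \<pi> ^ s"
proof -
  let ?\<rho> = "\<lambda>k. y k / x k"
  have tele: "absv (?\<rho> (Suc j) - ?\<rho> 1) \<le> \<pi> ^ (s - j)" if "j < s" for j
    using that
  proof (induction j)
    case (Suc j)
    have "absv (?\<rho> (Suc (Suc j)) - ?\<rho> (Suc j)) \<le> \<pi> ^ (s - Suc j)"
      using rho[of "Suc j"] Suc.prems by (simp add: absv_minus_commute)
    moreover have "absv (?\<rho> (Suc j) - ?\<rho> 1) \<le> \<pi> ^ (s - Suc j)"
      using Suc pi_power_le[of "s - Suc j" "s - j"] by (intro order_trans[OF Suc.IH]) auto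
    ultimately show ?case by (rule absv_trans_le)
  qed simp
  have "(\<Sum>j<Suc s. r j * y (Suc j)) - ?\<rho> 1 * (\<Sum>j<s. r j * x (Suc j))
      = (\<Sum>j<s. r j * y (Suc j) - ?\<rho> 1 * (r j * x (Suc j))) + r s * y (Suc s)"
    by (simp only: sum_subtractf sum_distrib_left sum.lessThan_Suc) simp
  moreover have "absv \<dots> \<le> \<pi> ^ s"
  proof (intro absv_add_le absv_sum_le)
    fix j assume j: "j \<in> {..<s}"
    have nz: "x (Suc j) \<noteq> 0" using x[of "Suc j"] j by auto
    have "r j * y (Suc j) - ?\<rho> 1 * (r j * x (Suc j))
        = r j * ((?\<rho> (Suc j) - ?\<rho> 1) * x (Suc j))"
      using nz by (simp add: field_simps)
    also have "absv \<dots> \<le> \<pi> ^ j * \<pi> ^ (s - j)"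
      using r[of j] tele[of j] x[of "Suc j"] j by (intro absv_mult_le absv_mult_le1) auto
    also have "\<dots> = \<pi> ^ s" using j by (simp flip: power_add)
    finally show "absv (r j * y (Suc j) - ?\<rho> 1 * (r j * x (Suc j))) \<le> \<pi> ^ s" .
  next
    show "absv (r s * y (Suc s)) \<le> \<pi> ^ s"
      using r[of s] y by (rule absv_mult_le1)
  qed simp
  ultimately show ?thesis by (simp only:)
qed

end

text \<open>The intended example of \<open>L n j\<close> is an integral polynomial \<open>\<Lambda>\<^sub>n\<close> in \<open>t\<close> and
  further variables, at a point whose coordinates have been raised to the power \<open>p^j\<close>; then the
  last assumption is the Frobenius congruence
  \<open>\<Lambda>(t, z)^p \<equiv> \<Lambda>(t^p, z^p)\<close> modulo \<open>p\<close>.\<close>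

locale frobenius_system = residue_char p K for p and K :: "'k::nonarchimedean_field itself" +
  fixes L :: "nat \<Rightarrow> nat \<Rightarrow> 'k poly"
  assumes L_integral: "gauss_le 1 (L n j)"
    and L_degree: "degree (L n j) \<le> 2 * (p - 1)"
    and L_frobenius: "gauss_le \<pi> (L n j ^ p - stretch p (L n (Suc j)))"
begin

text \<open>The index \<open>i\<close> is both the first polynomial of the product and the twist of all its
  members: these are the products that remain when the first \<open>i\<close> members have been split off.\<close>

definition chain :: "nat \<Rightarrow> nat \<Rightarrow> 'k poly" where
  "chain i s = (\<Prod>n=i..<s. L n i ^ p ^ (n - i))"

definition chain_coeff :: "nat \<Rightarrow> nat \<Rightarrow> 'k" where
  "chain_coeff i s = coeff (chain i s) (p ^ (s - i) - 1)"

lemma frobenius_iterate: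
  "gauss_le \<pi> (L n j ^ p ^ i - stretch (p ^ i) (L n (j + i)))"
proof (induction i)
  case 0
  then show ?case using stretch_by_1[of "L n j"] by (simp add: gauss_le_0 less_imp_le)
next
  case (Suc i)
  have st: "gauss_le 1 (stretch (p ^ i) (L n (j + i)))"
    by (intro gauss_le_pcompose_monom L_integral) simp
  have "L n j ^ p ^ Suc i - stretch (p ^ Suc i) (L n (j + Suc i))
      = ((L n j ^ p ^ i) ^ p - stretch (p ^ i) (L n (j + i)) ^ p)
        + stretch (p ^ i) (L n (j + i) ^ p - stretch p (L n (Suc (j + i))))"
    by (simp add: stretch_power stretch_stretch pcompose_diff mult.commute flip: power_mult)
  moreover have "gauss_le \<pi> \<dots>"
    using Suc.IH st L_frobenius
    by (intro gauss_le_add gauss_le_power_diff gauss_le_pcompose_monom gauss_le_power L_integral) auto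
  ultimately show ?case by simp
qed

lemma chain_integral: "gauss_le 1 (chain i s)"
  unfolding chain_def by (intro gauss_le_prod gauss_le_power L_integral)

lemma chain_coeff_integral: "absv (chain_coeff i s) \<le> 1"
  unfolding chain_coeff_def by (rule gauss_leD[OF chain_integral])

lemma chain_Suc: "i \<le> s \<Longrightarrow> chain i (Suc s) = chain i s * L s i ^ p ^ (s - i)"
  by (simp add: chain_def)

lemma chain_self [simp]: "chain s s = 1"
  by (simp add: chain_def)

lemma chain_coeff_self [simp]: "chain_coeff s s = 1"
  by (simp add: chain_coeff_def)

lemma degree_chain: "degree (chain i s) \<le> 2 * (p ^ (s - i) - 1)"
proof (induction s)
  case (Suc s)
  show ?case
  proof (cases "i \<le> s")
    case True
    have "degree (chain i (Suc s)) \<le> degree (chain i s) + degree (L s i ^ p ^ (s - i))"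
      unfolding chain_Suc[OF True] by (rule degree_mult_le)
    also have "degree (L s i ^ p ^ (s - i)) \<le> degree (L s i) * p ^ (s - i)"
      by (rule degree_power_le)
    also have "\<dots> \<le> 2 * (p - 1) * p ^ (s - i)"
      by (intro mult_right_mono L_degree) simp
    also have "degree (chain i s) + 2 * (p - 1) * p ^ (s - i)
        \<le> 2 * (p ^ (s - i) - 1) + 2 * (p - 1) * p ^ (s - i)"
      using Suc by simp
    also have "\<dots> = 2 * (p ^ (Suc s - i) - 1)"
    proof -
      have "p ^ (Suc s - i) = p ^ (s - i) + (p - 1) * p ^ (s - i)"
        using True p_power_Suc[of "s - i"] by (simp add: Suc_diff_le)
      moreover have "p ^ (s - i) \<ge> 1" by simp
      ultimately show ?thesis by (simp only: mult.assoc) linarith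
    qed
    finally show ?thesis by simp
  qed (simp add: chain_def)
qed (simp add: chain_def)

text \<open>The ghost terms measure how far the product is from being built of polynomials in
  \<open>t^(p^i)\<close>: the last factor is the difference between a power of the next polynomial and the
  corresponding power of its stretched and twisted form.\<close>

fun ghost :: "'k poly \<Rightarrow> nat \<Rightarrow> 'k poly" where
  "ghost Q 0 = Q"
| "ghost Q (Suc j) = (\<Sum>i<Suc j. ghost Q i * stretch (p ^ Suc i) (chain (Suc i) (Suc j)) *
      (L (Suc j) 0 ^ p ^ Suc j - stretch (p ^ Suc i) (L (Suc j) (Suc i)) ^ p ^ (j - i)))"

text \<open>Divisibility of the \<open>j\<close>-th ghost term by \<open>p^j\<close>: its \<open>i\<close>-th summand has \<open>p^i\<close>
  from the earlier ghost term, and the difference of \<open>p^(j-i-1)\<close>-th powers of polynomials that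
  agree modulo \<open>p\<close> gives the missing \<open>p^(j-i)\<close>.\<close>

lemma gauss_le_ghost:
  assumes "gauss_le 1 Q"
  shows "gauss_le (\<pi> ^ j) (ghost Q j)"
proof (induction j rule: less_induct)
  case (less j)
  show ?case
  proof (cases j)
    case (Suc j')
    have "gauss_le (\<pi> ^ Suc j') (ghost Q i * stretch (p ^ Suc i) (chain (Suc i) (Suc j')) *
      (L (Suc j') 0 ^ p ^ Suc j' - stretch (p ^ Suc i) (L (Suc j') (Suc i)) ^ p ^ (j' - i)))"
      if i: "i < Suc j'" for i
    proof -
      let ?A = "L (Suc j') 0 ^ p ^ Suc i" and ?B = "stretch (p ^ Suc i) (L (Suc j') (Suc i))"
      have "gauss_le (\<pi> ^ Suc (j' - i)) (?A ^ p ^ (j' - i) - ?B ^ p ^ (j' - i))"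
        using frobenius_iterate[of "Suc j'" 0 "Suc i"]
        by (intro gauss_le_power_p_power_diff gauss_le_power gauss_le_pcompose_monom L_integral) simp_all
      moreover have "?A ^ p ^ (j' - i) = L (Suc j') 0 ^ p ^ Suc j'"
        using i by (simp flip: power_mult power_Suc power_add)
      moreover have "gauss_le (\<pi> ^ i) (ghost Q i * stretch (p ^ Suc i) (chain (Suc i) (Suc j')))"
        using less[of i] i Suc by (intro gauss_le_mult1 gauss_le_pcompose_monom chain_integral) auto
      ultimately have "gauss_le (\<pi> ^ i * \<pi> ^ Suc (j' - i))
        (ghost Q i * stretch (p ^ Suc i) (chain (Suc i) (Suc j')) *
          (L (Suc j') 0 ^ p ^ Suc j' - ?B ^ p ^ (j' - i)))"
        by (intro gauss_le_mult) simp_all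
      moreover have "\<pi> ^ i * \<pi> ^ Suc (j' - i) = \<pi> ^ Suc j'"
        using i by (simp flip: power_add power_Suc)
      ultimately show ?thesis by (simp only:)
    qed
    then show ?thesis
      unfolding Suc ghost.simps by (intro gauss_le_sum pi_power_nonneg) simp
  qed (use assms in simp)
qed

lemma degree_ghost:
  assumes "degree Q \<le> 2 * (p - 1)"
  shows "degree (ghost Q j) \<le> 2 * (p ^ Suc j - 1)"
proof (induction j rule: less_induct)
  case (less j)
  show ?case
  proof (cases j)
    case (Suc j')
    have "degree (ghost Q i * stretch (p ^ Suc i) (chain (Suc i) (Suc j')) *
      (L (Suc j') 0 ^ p ^ Suc j' - stretch (p ^ Suc i) (L (Suc j') (Suc i)) ^ p ^ (j' - i)))
      \<le> 2 * (p ^ Suc (Suc j') - 1)" (is "degree (?a * ?b * ?c) \<le> _")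
      if i: "i < Suc j'" for i
    proof -
      have pw: "p ^ Suc i * p ^ (j' - i) = p ^ Suc j'"
        using i by (simp flip: power_Suc power_add)
      have le: "p ^ Suc i \<le> p ^ Suc j'"
        using i by (intro power_increasing) simp_all
      have "degree ?a \<le> 2 * (p ^ Suc i - 1)"
        using less[of i] i Suc by simp
      moreover have "degree ?b \<le> 2 * (p ^ Suc j' - p ^ Suc i)"
      proof -
        have "degree ?b \<le> p ^ Suc i * (2 * (p ^ (j' - i) - 1))"
          unfolding degree_stretch using degree_chain[of "Suc i" "Suc j'"] by (intro mult_left_mono) auto
        also have "\<dots> = 2 * (p ^ Suc j' - p ^ Suc i)"
          unfolding pw[symmetric] by (simp only: diff_mult_distrib2 mult.left_commute mult_1_right)
        finally show ?thesis .
      qed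
      moreover have "degree ?c \<le> 2 * (p - 1) * p ^ Suc j'"
      proof (rule degree_diff_le)
        have "degree (L (Suc j') 0 ^ p ^ Suc j') \<le> degree (L (Suc j') 0) * p ^ Suc j'"
          by (rule degree_power_le)
        also have "\<dots> \<le> 2 * (p - 1) * p ^ Suc j'"
          by (intro mult_right_mono L_degree) simp
        finally show "degree (L (Suc j') 0 ^ p ^ Suc j') \<le> 2 * (p - 1) * p ^ Suc j'" .
        have "degree (stretch (p ^ Suc i) (L (Suc j') (Suc i)) ^ p ^ (j' - i))
            \<le> degree (stretch (p ^ Suc i) (L (Suc j') (Suc i))) * p ^ (j' - i)"
          by (rule degree_power_le)
        also have "\<dots> = degree (L (Suc j') (Suc i)) * p ^ Suc j'"
          unfolding degree_stretch pw[symmetric] by (simp add: ac_simps)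
        also have "\<dots> \<le> 2 * (p - 1) * p ^ Suc j'"
          by (intro mult_right_mono L_degree) simp
        finally show "degree (stretch (p ^ Suc i) (L (Suc j') (Suc i)) ^ p ^ (j' - i))
            \<le> 2 * (p - 1) * p ^ Suc j'" .
      qed
      moreover have "degree (?a * ?b * ?c) \<le> degree ?a + degree ?b + degree ?c"
        using degree_mult_le[of "?a * ?b" ?c] degree_mult_le[of ?a ?b] by linarith
      moreover have "2 * (p ^ Suc i - 1) + 2 * (p ^ Suc j' - p ^ Suc i) + 2 * (p - 1) * p ^ Suc j'
          = 2 * (p ^ Suc (Suc j') - 1)"
      proof -
        have "p ^ Suc i \<ge> 1" by (rule one_le_power) simp
        then show ?thesis using le p_power_Suc[of "Suc j'"] by (simp only: mult.assoc)
      qed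
      ultimately show ?thesis by linarith
    qed
    then show ?thesis
      unfolding Suc ghost.simps by (intro degree_sum_le) auto
  qed (use assms in simp)
qed

text \<open>By induction on \<open>s\<close>: multiplying the expansion by the new factor and replacing that factor
  in each summand by its stretched form leaves, by definition, one more ghost term.\<close>

lemma ghost_expansion:
  assumes "1 \<le> s"
  shows "Q * (\<Prod>n=1..<s. L n 0 ^ p ^ n)
    = (\<Sum>j<s. ghost Q j * stretch (p ^ Suc j) (chain (Suc j) s))"
  using assms
proof (induction s rule: dec_induct)
  case base
  then show ?case by (simp add: pcompose_1)
next
  case (step s)
  then obtain s' where s': "s = Suc s'" by (cases s) auto
  have "Q * (\<Prod>n=1..<Suc s. L n 0 ^ p ^ n) = (Q * (\<Prod>n=1..<s. L n 0 ^ p ^ n)) * L s 0 ^ p ^ s"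
    using step by (simp add: mult.assoc)
  also have "\<dots> = (\<Sum>j<s. ghost Q j * stretch (p ^ Suc j) (chain (Suc j) s) * L s 0 ^ p ^ s)"
    by (simp only: step.IH sum_distrib_right)
  also have "\<dots> = (\<Sum>j<s. ghost Q j * stretch (p ^ Suc j) (chain (Suc j) (Suc s))) + ghost Q s"
    unfolding s' ghost.simps sum.distrib[symmetric]
    by (intro sum.cong) (auto simp: chain_Suc stretch_mult stretch_power algebra_simps)
  also have "\<dots> = (\<Sum>j<Suc s. ghost Q j * stretch (p ^ Suc j) (chain (Suc j) (Suc s)))"
    by (simp add: pcompose_1)
  finally show ?case .
qed

text \<open>By the degree bound on the ghost terms, taking the coefficient of \<open>t^(p^s - 1)\<close> turns
  each product in the ghost expansion into a product of coefficients. The first factor does not depend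
  on \<open>s\<close>, and the second does not depend on \<open>Q\<close>.\<close>

lemma dwork_expansion:
  assumes "1 \<le> s" and deg: "degree Q \<le> 2 * (p - 1)"
  shows "coeff (Q * (\<Prod>n=1..<s. L n 0 ^ p ^ n)) (p ^ s - 1)
    = (\<Sum>j<s. coeff (ghost Q j) (p ^ Suc j - 1) * chain_coeff (Suc j) s)"
proof -
  have "coeff (ghost Q j * stretch (p ^ Suc j) (chain (Suc j) s)) (p ^ s - 1)
      = coeff (ghost Q j) (p ^ Suc j - 1) * chain_coeff (Suc j) s" if "j < s" for j
  proof -
    have "p ^ s = p ^ Suc j * p ^ (s - Suc j)"
      using that by (simp flip: power_add power_Suc)
    then show ?thesis
      using coeff_mult_stretch[of "p ^ Suc j" "p ^ (s - Suc j)" "ghost Q j" "chain (Suc j) s"]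
        degree_ghost[OF deg, of j] by (simp add: chain_coeff_def del: power_Suc)
  qed
  then show ?thesis
    unfolding ghost_expansion[OF assms(1)] coeff_sum by (intro sum.cong) auto
qed

end

context residue_char
begin

lemma pi_power_Suc_le: "\<pi> ^ Suc j \<le> \<pi>"
  using mult_left_mono[OF pi_power_le_1[of j], of \<pi>] pi_pos by (simp add: less_imp_le)

lemma frobenius_system_shift:
  assumes "frobenius_system p L"
  shows "frobenius_system p (\<lambda>n j. L (n + i) (j + i))"
  using assms by (simp add: frobenius_system_def frobenius_system_axioms_def)

end

context frobenius_system
begin

lemma chain_shift:
  "frobenius_system.chain p (\<lambda>n j. L (n + i) (j + i)) k s = chain (k + i) (s + i)"
proof -
  interpret S: frobenius_system p K "\<lambda>n j. L (n + i) (j + i)"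
    using frobenius_system_axioms by (rule frobenius_system_shift)
  show ?thesis
    unfolding chain_def S.chain_def
    by (rule prod.reindex_bij_witness[of _ "\<lambda>n. n - i" "\<lambda>n. n + i"]) auto
qed

lemma chain_expansion:
  obtains r where "r 0 = coeff (L i i) (p - 1)" "\<And>j. absv (r j) \<le> \<pi> ^ j"
    "\<And>s. 1 \<le> s \<Longrightarrow> chain_coeff i (s + i) = (\<Sum>j<s. r j * chain_coeff (Suc j + i) (s + i))"
proof -
  interpret S: frobenius_system p K "\<lambda>n j. L (n + i) (j + i)"
    using frobenius_system_axioms by (rule frobenius_system_shift)
  define r where "r = (\<lambda>j. coeff (S.ghost (L i i) j) (p ^ Suc j - 1))"
  show ?thesis
  proof (rule that[of r])
    show "r 0 = coeff (L i i) (p - 1)" by (simp add: r_def)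
    show "absv (r j) \<le> \<pi> ^ j" for j
      unfolding r_def by (intro gauss_leD S.gauss_le_ghost L_integral)
    show "chain_coeff i (s + i) = (\<Sum>j<s. r j * chain_coeff (Suc j + i) (s + i))" if "1 \<le> s" for s
    proof -
      have "chain i (s + i) = S.chain 0 s" by (simp add: chain_shift)
      also have "\<dots> = L i i * (\<Prod>n=1..<s. L (n + i) (0 + i) ^ p ^ n)"
        unfolding S.chain_def using that by (simp add: prod.atLeast_Suc_lessThan)
      finally have "chain_coeff i (s + i)
          = coeff (L i i * (\<Prod>n=1..<s. L (n + i) (0 + i) ^ p ^ n)) (p ^ s - 1)"
        by (simp add: chain_coeff_def)
      also have "\<dots> = (\<Sum>j<s. r j * S.chain_coeff (Suc j) s)"
        unfolding r_def by (rule S.dwork_expansion[OF that L_degree])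
      also have "\<dots> = (\<Sum>j<s. r j * chain_coeff (Suc j + i) (s + i))"
        by (simp add: S.chain_coeff_def chain_coeff_def chain_shift)
      finally show ?thesis .
    qed
  qed
qed

end

text \<open>The condition for all the coefficients in question to be units.\<close>

locale ordinary_frobenius_system = frobenius_system p K L
  for p and K :: "'k::nonarchimedean_field itself" and L +
  assumes L_ordinary: "absv (coeff (L n n) (p - 1)) = 1"
begin

lemma absv_chain_coeff:
  assumes "i \<le> s"
  shows "absv (chain_coeff i s) = 1"
  using assms
proof (induction "s - i" arbitrary: i)
  case (Suc d)
  then have i: "i < s" "d = s - Suc i" by auto
  obtain r where r: "r 0 = coeff (L i i) (p - 1)" "\<And>j. absv (r j) \<le> \<pi> ^ j"
    "\<And>s. 1 \<le> s \<Longrightarrow> chain_coeff i (s + i) = (\<Sum>j<s. r j * chain_coeff (Suc j + i) (s + i))"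
    by (fact chain_expansion[of i])
  have one: "absv (chain_coeff (Suc i) s) = 1"
    using Suc.hyps(1)[of "Suc i"] i by simp
  obtain d where d: "s = Suc d + i" using i by (metis less_iff_Suc_add add.commute add_Suc_right)
  have "chain_coeff i s = (\<Sum>j<Suc d. r j * chain_coeff (Suc j + i) s)"
    using r(3)[of "Suc d"] unfolding d by simp
  also have "\<dots> = r 0 * chain_coeff (Suc i) s + (\<Sum>j<d. r (Suc j) * chain_coeff (Suc (Suc j) + i) s)"
    by (simp add: sum.lessThan_Suc_shift del: sum.lessThan_Suc)
  finally have "chain_coeff i s - r 0 * chain_coeff (Suc i) s
      = (\<Sum>j<d. r (Suc j) * chain_coeff (Suc (Suc j) + i) s)" by simp
  moreover have "absv \<dots> \<le> \<pi>"
  proof (intro absv_sum_le absv_mult_le1 chain_coeff_integral)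
    fix j show "absv (r (Suc j)) \<le> \<pi>"
      by (rule order_trans[OF r(2) pi_power_Suc_le])
  qed (simp add: less_imp_le)
  moreover have "absv (r 0 * chain_coeff (Suc i) s) = 1"
    using L_ordinary[of i] by (simp add: absv_mult one r(1))
  ultimately show ?case
    using absv_eq_of_close pi_less_1 by (metis order_le_less_trans)
qed simp

text \<open>By induction on the length \<open>s - i\<close>, the expansion expresses the coefficients that start at
  \<open>i\<close> by those that start later.\<close>

lemma dwork_ratio:
  assumes "i < s"
  shows "absv (chain_coeff i (Suc s) / chain_coeff i s
    - chain_coeff (Suc i) (Suc s) / chain_coeff (Suc i) s) \<le> \<pi> ^ (s - i)"
  using assms
proof (induction "s - i" arbitrary: i rule: less_induct)
  case less
  obtain r where r: "r 0 = coeff (L i i) (p - 1)" "\<And>j. absv (r j) \<le> \<pi> ^ j"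
    "\<And>s. 1 \<le> s \<Longrightarrow> chain_coeff i (s + i) = (\<Sum>j<s. r j * chain_coeff (Suc j + i) (s + i))"
    by (fact chain_expansion[of i])
  define d where "d = s - i"
  have d: "s = d + i" "1 \<le> d" using less.prems by (auto simp: d_def)
  define x where "x = (\<lambda>k. chain_coeff (k + i) s)"
  define y where "y = (\<lambda>k. chain_coeff (k + i) (Suc s))"
  have "absv ((\<Sum>j<Suc d. r j * y (Suc j)) - y 1 / x 1 * (\<Sum>j<d. r j * x (Suc j))) \<le> \<pi> ^ d"
  proof (rule dwork_ratio_step)
    show "absv (x k) = 1" if "1 \<le> k" "k \<le> d" for k
      unfolding x_def using that d by (intro absv_chain_coeff) simp
    show "absv (y k / x k - y (Suc k) / x (Suc k)) \<le> \<pi> ^ (d - k)" if "1 \<le> k" "k < d" for k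
      using less.hyps[of "k + i"] that d by (simp add: x_def y_def)
  qed (use r(2) d chain_coeff_integral in \<open>auto simp: y_def\<close>)
  moreover have "(\<Sum>j<Suc d. r j * y (Suc j)) = chain_coeff i (Suc s)"
    using r(3)[of "Suc d"] by (simp add: y_def d(1))
  moreover have "(\<Sum>j<d. r j * x (Suc j)) = chain_coeff i s"
    using r(3)[of d] d by (simp add: x_def)
  ultimately have *: "absv (chain_coeff i (Suc s) - y 1 / x 1 * chain_coeff i s) \<le> \<pi> ^ d" by simp
  have u: "absv (chain_coeff i s) = 1" using less.prems by (intro absv_chain_coeff) simp
  then have nz: "chain_coeff i s \<noteq> 0" by auto
  have "chain_coeff i (Suc s) / chain_coeff i s - y 1 / x 1
      = (chain_coeff i (Suc s) - y 1 / x 1 * chain_coeff i s) / chain_coeff i s"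
    using nz by (simp add: diff_divide_distrib)
  with * u show ?case by (simp add: absv_divide x_def y_def d_def)
qed

text \<open>Replacing the bottom member of the system by another polynomial \<open>Q\<close> multiplies all
  the coefficients by a factor that stabilises.\<close>

theorem dwork_congruence:
  assumes s: "1 \<le> s" and Q: "gauss_le 1 Q" "degree Q \<le> 2 * (p - 1)"
  defines "c \<equiv> \<lambda>s. coeff (Q * (\<Prod>n=1..<s. L n 0 ^ p ^ n)) (p ^ s - 1)"
  shows "absv (c (Suc s) / chain_coeff 0 (Suc s) - c s / chain_coeff 0 s) \<le> \<pi> ^ s"
proof -
  define \<rho> where "\<rho> = chain_coeff 1 (Suc s) / chain_coeff 1 s"
  have gen: "absv (coeff (P * (\<Prod>n=1..<Suc s. L n 0 ^ p ^ n)) (p ^ Suc s - 1)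
      - \<rho> * coeff (P * (\<Prod>n=1..<s. L n 0 ^ p ^ n)) (p ^ s - 1)) \<le> \<pi> ^ s"
    if P: "gauss_le 1 P" "degree P \<le> 2 * (p - 1)" for P
    unfolding \<rho>_def dwork_expansion[OF s P(2)] dwork_expansion[OF le_SucI[OF s] P(2)]
  proof (rule dwork_ratio_step)
    show "absv (coeff (ghost P j) (p ^ Suc j - 1)) \<le> \<pi> ^ j" for j
      by (intro gauss_leD gauss_le_ghost P)
  qed (use s in \<open>auto simp: chain_coeff_integral absv_chain_coeff dwork_ratio\<close>)
  have c: "absv (c (Suc s) - \<rho> * c s) \<le> \<pi> ^ s"
    unfolding c_def by (rule gen[OF Q])
  have chain0: "chain_coeff 0 s = coeff (L 0 0 * (\<Prod>n=1..<s. L n 0 ^ p ^ n)) (p ^ s - 1)"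
    if "1 \<le> s" for s
    using that by (simp add: chain_coeff_def chain_def prod.atLeast_Suc_lessThan)
  have t: "absv (chain_coeff 0 (Suc s) - \<rho> * chain_coeff 0 s) \<le> \<pi> ^ s"
    using gen[OF L_integral L_degree] s by (simp only: chain0)
  have u: "absv (chain_coeff 0 s) = 1" "absv (chain_coeff 0 (Suc s)) = 1"
    by (simp_all add: absv_chain_coeff)
  then have nz: "chain_coeff 0 s \<noteq> 0" "chain_coeff 0 (Suc s) \<noteq> 0" by auto
  have "c (Suc s) / chain_coeff 0 (Suc s) - c s / chain_coeff 0 s
    = ((c (Suc s) - \<rho> * c s) * chain_coeff 0 s - (chain_coeff 0 (Suc s) - \<rho> * chain_coeff 0 s) * c s)
      / (chain_coeff 0 (Suc s) * chain_coeff 0 s)"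
    using nz by (simp add: field_simps)
  also have "absv \<dots> \<le> \<pi> ^ s"
  proof -
    have "absv (c s) \<le> 1"
      unfolding c_def by (intro gauss_leD gauss_le_mult1 Q gauss_le_prod gauss_le_power L_integral)
    then have "absv ((c (Suc s) - \<rho> * c s) * chain_coeff 0 s
        - (chain_coeff 0 (Suc s) - \<rho> * chain_coeff 0 s) * c s) \<le> \<pi> ^ s"
      using u by (intro absv_diff_le[OF absv_mult_le1[OF c] absv_mult_le1[OF t]]) simp_all
    then show ?thesis using u by (simp add: absv_divide absv_mult)
  qed
  finally show ?thesis .
qed

text \<open>Modulo \<open>p\<close> only the zeroth ghost term, which is \<open>Q\<close>, contributes.\<close>

lemma dwork_leading_term:
  assumes s: "1 \<le> s" and Q: "gauss_le 1 Q" "degree Q \<le> 2 * (p - 1)"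
  shows "absv (coeff (Q * (\<Prod>n=1..<s. L n 0 ^ p ^ n)) (p ^ s - 1)
    - coeff Q (p - 1) * chain_coeff 1 s) \<le> \<pi>"
proof -
  obtain d where d: "s = Suc d" using s by (cases s) auto
  have "coeff (Q * (\<Prod>n=1..<s. L n 0 ^ p ^ n)) (p ^ s - 1) - coeff Q (p - 1) * chain_coeff 1 s
      = (\<Sum>j<d. coeff (ghost Q (Suc j)) (p ^ Suc (Suc j) - 1) * chain_coeff (Suc (Suc j)) s)"
    unfolding dwork_expansion[OF s Q(2)] unfolding d
    by (simp only: sum.lessThan_Suc_shift) simp
  also have "absv \<dots> \<le> \<pi>"
  proof (intro absv_sum_le absv_mult_le1 chain_coeff_integral)
    fix j show "absv (coeff (ghost Q (Suc j)) (p ^ Suc (Suc j) - 1)) \<le> \<pi>"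
      by (rule order_trans[OF gauss_leD[OF gauss_le_ghost[OF Q(1)]] pi_power_Suc_le])
  qed (simp add: less_imp_le)
  finally show ?thesis .
qed

end

section \<open>The digits\<close>

context residue_char
begin

lemma digits_close:
  fixes w :: "nat \<Rightarrow> nat" and x :: 'k
  assumes "(\<lambda>i. of_nat (w i) * of_nat p ^ i) sums x"
  shows "absv ((\<Sum>i<s. of_nat (w i) * of_nat p ^ i) - x) \<le> \<pi> ^ s"
proof -
  let ?S = "\<lambda>n. \<Sum>i<n. of_nat (w i) * of_nat p ^ i :: 'k"
  have tail: "absv (?S s - ?S n) \<le> \<pi> ^ s" if "s \<le> n" for n
  proof -
    have "?S n = ?S s + (\<Sum>i\<in>{s..<n}. of_nat (w i) * of_nat p ^ i)"
      using that by (simp add: lessThan_atLeast0 sum.atLeastLessThan_concat)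
    then have "?S s - ?S n = - (\<Sum>i\<in>{s..<n}. of_nat (w i) * of_nat p ^ i)" by simp
    also have "absv \<dots> \<le> \<pi> ^ s"
      unfolding absv_minus
    proof (intro absv_sum_le absv_mult_le1' absv_of_nat_le_1)
      fix i assume "i \<in> {s..<n}"
      then show "absv (of_nat p ^ i :: 'k) \<le> \<pi> ^ s"
        using pi_power_le[of s i] by (simp add: absv_power \<pi>_def)
    qed simp
    finally show ?thesis .
  qed
  have "?S \<longlonglongrightarrow> x" using assms by (simp add: sums_def)
  then have "\<forall>\<^sub>F n in sequentially. absv (?S n - x) < \<pi> ^ s"
    by (simp add: tendsto_absv_iff)
  then obtain n where "n \<ge> s" "absv (?S n - x) < \<pi> ^ s"
    by (auto simp: eventually_sequentially) (meson nle_le)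
  then show ?thesis using absv_trans_le[OF tail[of n]] by simp
qed

text \<open>The partial sums of length \<open>s\<close> agree modulo \<open>p^s\<close>, which determines the digits one
  after the other.\<close>

lemma digits_unique:
  fixes w w' :: "nat \<Rightarrow> nat" and x :: 'k
  assumes "\<And>i. w i \<le> p - 1" "\<And>i. w' i \<le> p - 1"
    and "(\<lambda>i. of_nat (w i) * of_nat p ^ i) sums x" "(\<lambda>i. of_nat (w' i) * of_nat p ^ i) sums x"
  shows "w = w'"
proof
  fix i show "w i = w' i"
  proof (induction i rule: less_induct)
    case (less i)
    let ?S = "\<lambda>w. \<Sum>i<Suc i. of_nat (w i) * of_nat p ^ i :: 'k"
    have "absv (?S w - ?S w') \<le> \<pi> ^ Suc i"
      using digits_close[OF assms(3), of "Suc i"] digits_close[OF assms(4), of "Suc i"]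
      by (subst (asm) (2) absv_minus_commute) (rule absv_trans_le)
    moreover have "(\<Sum>j<i. of_nat (w j) * of_nat p ^ j) = (\<Sum>j<i. of_nat (w' j) * of_nat p ^ j :: 'k)"
      using less by (intro sum.cong) auto
    ultimately have "absv (of_int ((int (w i) - int (w' i)) * int p ^ i) :: 'k) \<le> \<pi> ^ Suc i"
      by (simp add: algebra_simps)
    then have "int p ^ Suc i dvd (int (w i) - int (w' i)) * int p ^ i"
      by (rule absv_int_le_imp_dvd)
    then have dvd: "int p dvd int (w i) - int (w' i)" by simp
    have "\<bar>int (w i) - int (w' i)\<bar> < int p"
      using assms(1)[of i] assms(2)[of i] p_ge_3 by linarith
    then have "int (w i) - int (w' i) = 0"
      using dvd_imp_le_int[OF _ dvd] by linarith
    then show ?case by simp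
  qed
qed

text \<open>The exponents \<open>N\<^sub>s = (p^s - \<lambda>)/2\<close> are integers that tend to \<open>-\<lambda>/2\<close>, and
  \<open>N\<^sub>s\<^sub>+\<^sub>1\<close> agrees with \<open>N\<^sub>s\<close> modulo \<open>p^s\<close>. So their lower digits are those of
  \<open>-\<lambda>/2\<close>; once \<open>p^s\<close> exceeds \<open>|\<lambda>|\<close>, the number \<open>N\<^sub>s\<close> lies between
  \<open>0\<close> and \<open>p^s\<close> and has no other digits.\<close>

lemma digit_props:
  assumes l: "odd l"
  shows digit_le: "digit TYPE('k) p l i \<le> p - 1"
    and digit_sum: "\<bar>l\<bar> < int p ^ s \<Longrightarrow> (\<Sum>i<s. digit TYPE('k) p l i * p ^ i) = nat ((int p ^ s - l) div 2)"
proof -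
  define N where "N = (\<lambda>s. (int p ^ s - l) div 2)"
  have N2: "2 * N s = int p ^ s - l" for s
    using l odd_p by (simp add: N_def)
  define w where "w = (\<lambda>i. nat ((N (Suc i) div int p ^ i) mod int p))"
  have w_int: "int (w i) = (N (Suc i) div int p ^ i) mod int p" for i
    by (simp add: w_def)
  have w_le: "w i \<le> p - 1" for i
  proof -
    have "(N (Suc i) div int p ^ i) mod int p < int p" by simp
    then show ?thesis using w_int[of i] by linarith
  qed
  have sum_w: "(\<Sum>i<s. int (w i) * int p ^ i) = N s mod int p ^ s" for s
  proof (induction s)
    case (Suc s)
    obtain k where k: "int p - 1 = 2 * k" using odd_p by (elim oddE) auto
    have "2 * (N (Suc s) - N s) = int p ^ s * (int p - 1)"
      using N2[of s] N2[of "Suc s"] by (simp add: algebra_simps)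
    then have "N (Suc s) - N s = int p ^ s * k" by (simp add: k)
    then have "N (Suc s) = N s + int p ^ s * k" by simp
    then have "N (Suc s) mod int p ^ s = N s mod int p ^ s" by simp
    moreover have "N (Suc s) mod int p ^ Suc s
        = int p ^ s * (N (Suc s) div int p ^ s mod int p) + N (Suc s) mod int p ^ s"
      using zmod_zmult2_eq[of "int p" "N (Suc s)" "int p ^ s"] by (simp add: mult.commute)
    ultimately show ?case using Suc by (simp add: w_int)
  qed simp
  have sums_w: "(\<lambda>i. of_nat (w i) * of_nat p ^ i :: 'k) sums (- of_int l / 2)"
    unfolding sums_def tendsto_absv_iff
  proof (intro allI impI)
    fix e :: real assume "e > 0"
    then obtain S where S: "\<And>s. s \<ge> S \<Longrightarrow> \<pi> ^ s < e" using ex_pi_power_less by blast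
    show "\<forall>\<^sub>F s in sequentially. absv ((\<Sum>i<s. of_nat (w i) * of_nat p ^ i) - - of_int l / 2 :: 'k) < e"
      unfolding eventually_sequentially
    proof (intro exI[of _ S] allI impI)
      fix s assume s: "s \<ge> S"
      have "(\<Sum>i<s. of_nat (w i) * of_nat p ^ i) = (of_int (\<Sum>i<s. int (w i) * int p ^ i) :: 'k)"
        by simp
      also have "\<dots> = of_int (N s - int p ^ s * (N s div int p ^ s))"
        by (simp add: sum_w minus_mult_div_eq_mod)
      finally have E: "(\<Sum>i<s. of_nat (w i) * of_nat p ^ i)
        = (of_int (N s - int p ^ s * (N s div int p ^ s)) :: 'k)" .
      have "2 * ((\<Sum>i<s. of_nat (w i) * of_nat p ^ i) - - of_int l / 2)
          = (of_int (2 * N s - 2 * (int p ^ s * (N s div int p ^ s)) + l) :: 'k)"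
        unfolding E by (simp add: right_diff_distrib)
      also have "2 * N s - 2 * (int p ^ s * (N s div int p ^ s)) + l
          = int p ^ s * (1 - 2 * (N s div int p ^ s))"
        by (simp only: N2) (simp add: algebra_simps)
      finally have "absv (2 * ((\<Sum>i<s. of_nat (w i) * of_nat p ^ i) - - of_int l / 2) :: 'k) \<le> \<pi> ^ s"
        using absv_int_dvd[of s "int p ^ s * (1 - 2 * (N s div int p ^ s))"] by simp
      moreover have "absv (2 :: 'k) = 1"
      proof -
        have "\<not> int p dvd 2" using p_ge_3 zdvd_imp_le[of "int p" 2] by linarith 
        from absv_int_coprime[OF this] show ?thesis by simp
      qed
      ultimately show "absv ((\<Sum>i<s. of_nat (w i) * of_nat p ^ i) - - of_int l / 2 :: 'k) < e"
        using S[OF s] by (simp only: absv_mult mult_1_left)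
    qed
  qed
  have "digit TYPE('k) p l = w"
    unfolding digit_def
  proof (rule the_equality)
    fix w' :: "nat \<Rightarrow> nat"
    assume "(\<forall>i. w' i \<le> p - 1) \<and> (\<lambda>i. of_nat (w' i) * of_nat p ^ i :: 'k) sums (- of_int l / 2)"
    then show "w' = w" using w_le sums_w by (intro digits_unique[of w' w]) auto
  qed (use w_le sums_w in auto)
  moreover have "(\<Sum>i<s. w i * p ^ i) = nat ((int p ^ s - l) div 2)" if s: "\<bar>l\<bar> < int p ^ s" for s
  proof -
    have "0 \<le> N s" "N s < int p ^ s" using N2[of s] s by auto
    then have "int (\<Sum>i<s. w i * p ^ i) = N s" using sum_w[of s] by simp
    then have "(\<Sum>i<s. w i * p ^ i) = nat (N s)" by (metis nat_int)
    then show ?thesis by (simp only: N_def)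
  qed
  ultimately show "digit TYPE('k) p l i \<le> p - 1"
    "\<bar>l\<bar> < int p ^ s \<Longrightarrow> (\<Sum>i<s. digit TYPE('k) p l i * p ^ i) = nat ((int p ^ s - l) div 2)"
    using w_le by auto
qed

section \<open>The polynomials as products over digits\<close>

text \<open>The polynomial whose coefficient of \<open>t^(p-1)\<close> is \<open>h(z; w)\<close>.\<close>

definition Lam :: "nat \<Rightarrow> 'k^2 \<Rightarrow> 'k poly" where
  "Lam w x = monom 1 w * ([:- (x$1), 1:] * [:- (x$2), 1:]) ^ ((p - 1) div 2)"

text \<open>Raising the coordinates to the power \<open>p^j\<close> stands in for the \<open>j\<close>-th iterate of
  a lift of Frobenius. It is not additive on the field, but it is modulo \<open>p\<close>.\<close>

definition frob :: "nat \<Rightarrow> 'k^2 \<Rightarrow> 'k^2" where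
  "frob j x = (\<chi> i. x $ i ^ p ^ j)"

lemma frob_integral: "x \<in> integral_points \<Longrightarrow> frob j x \<in> integral_points"
  by (auto simp: integral_points_def frob_def absv_power power_le_one)

lemma frob_0 [simp]: "frob 0 x = x"
  by (simp add: frob_def)

lemma frob_Suc: "frob (Suc j) x = frob 1 (frob j x)"
  by (simp add: frob_def mult.commute flip: power_mult)

lemma hpol_eq_coeff_Lam: "hpol p w x = coeff (Lam w x) (p - 1)"
  unfolding hpol_def Lam_def power_mult_distrib mult.assoc ..

lemma Lam_integral:
  assumes "x \<in> integral_points"
  shows "gauss_le 1 (Lam w x)"
  unfolding Lam_def using assms
  by (intro gauss_le_mult1 gauss_le_power gauss_le_linear gauss_le_monom) (auto simp: integral_points_def)

lemma degree_Lam: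
  assumes "w \<le> p - 1"
  shows "degree (Lam w x) \<le> 2 * (p - 1)"
proof -
  have "degree (Lam w x) \<le> w + 2 * ((p - 1) div 2)"
    unfolding Lam_def power_mult_distrib
    by (intro order_trans[OF degree_mult_le] add_mono order_trans[OF degree_monom_le])
       (auto intro!: order_trans[OF degree_mult_le] simp: degree_linear_power)
  then show ?thesis using assms by linarith
qed

lemma gauss_le_mult_diff:
  fixes f :: "'k poly"
  assumes "gauss_le r (f - f')" "gauss_le r (g - g')" "gauss_le 1 f'" "gauss_le 1 g"
  shows "gauss_le r (f * g - f' * g')"
proof -
  have "f * g - f' * g' = (f - f') * g + f' * (g - g')" by (simp add: algebra_simps)
  also have "gauss_le r \<dots>"
    using assms by (intro gauss_le_add gauss_le_mult1 gauss_le_mult1')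
  finally show ?thesis .
qed

lemma linear_frobenius:
  fixes c :: 'k
  assumes "absv c \<le> 1"
  shows "gauss_le \<pi> ([:- c, 1:] ^ p - stretch p [:- (c ^ p), 1:])"
proof -
  have "map_poly (\<lambda>c::'k. c ^ p) [:- c, 1:] = [:- (c ^ p), 1:]"
    using odd_p by (simp add: map_poly_pCons power_0_left)
  then show ?thesis
    using gauss_le_frobenius[OF gauss_le_linear[OF assms]] by (simp only:)
qed

lemma Lam_frobenius:
  assumes x: "x \<in> integral_points"
  shows "gauss_le \<pi> (Lam w x ^ p - stretch p (Lam w (frob 1 x)))"
proof -
  have i: "absv (x$1) \<le> 1" "absv (x$2) \<le> 1" using x by (auto simp: integral_points_def)
  let ?M = "(p - 1) div 2" and ?P = "\<lambda>x. [:- (x$1), 1:] * [:- (x$2), 1:] :: 'k poly"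
  have y: "frob 1 x $ 1 = x$1 ^ p" "frob 1 x $ 2 = x$2 ^ p" by (simp_all add: frob_def)
  have iy: "absv (x$1 ^ p) \<le> 1" "absv (x$2 ^ p) \<le> 1" using i by (auto simp: absv_power power_le_one)
  have P: "gauss_le \<pi> (?P x ^ p - stretch p (?P (frob 1 x)))"
    unfolding power_mult_distrib stretch_mult y
    by (intro gauss_le_mult_diff linear_frobenius gauss_le_pcompose_monom gauss_le_linear gauss_le_power i iy) simp
  have m: "monom 1 w ^ p = stretch p (monom 1 w :: 'k poly)"
  proof -
    have "monom 1 w = (monom 1 1 ^ w :: 'k poly)" by (simp add: monom_power)
    then have "stretch p (monom 1 w) = (stretch p (monom 1 1) ^ w :: 'k poly)"
      by (simp only: stretch_power)
    also have "stretch p (monom 1 1) = (monom 1 p :: 'k poly)"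
      by (simp add: monom_Suc pcompose_pCons pcompose_1)
    finally show ?thesis by (simp add: monom_power mult.commute)
  qed
  have "gauss_le \<pi> ((?P x ^ p) ^ ?M - stretch p (?P (frob 1 x)) ^ ?M)"
    unfolding stretch_mult y
    by (rule gauss_le_power_diff[OF _ _ P[unfolded stretch_mult y]])
      (intro gauss_le_mult1 gauss_le_pcompose_monom gauss_le_linear gauss_le_power i iy; simp)+
  then have "gauss_le \<pi> (monom 1 w ^ p * ((?P x ^ p) ^ ?M - stretch p (?P (frob 1 x)) ^ ?M))"
    by (intro gauss_le_mult1' gauss_le_power gauss_le_monom) auto
  also have "monom 1 w ^ p * ((?P x ^ p) ^ ?M - stretch p (?P (frob 1 x)) ^ ?M)
      = Lam w x ^ p - stretch p (Lam w (frob 1 x))"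
    unfolding Lam_def stretch_mult stretch_power m[symmetric]
    by (simp add: power_mult_distrib right_diff_distrib mult.commute flip: power_mult)
  finally show ?thesis .
qed

text \<open>The \<open>p\<close>-th power of the polynomial in question is congruent modulo \<open>p\<close> both to its
  Frobenius twist and to the polynomial with \<open>p\<close>-th powers of coefficients; comparing
  coefficients, \<open>h\<close> at the twisted point is \<open>h^p\<close> modulo \<open>p\<close>.\<close>

lemma hpol_frob:
  assumes x: "x \<in> integral_points" and h: "absv (hpol p w x) = 1"
  shows "absv (hpol p w (frob j x)) = 1"
proof (induction j)
  case (Suc j)
  let ?y = "frob j x"
  have y: "?y \<in> integral_points" using x by (rule frob_integral)
  have "gauss_le \<pi> ((Lam w ?y ^ p - stretch p (Lam w (frob 1 ?y)))
      - (Lam w ?y ^ p - stretch p (map_poly (\<lambda>c. c ^ p) (Lam w ?y))))"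
    using y by (intro gauss_le_diff[OF Lam_frobenius gauss_le_frobenius] Lam_integral)
  then have "absv (hpol p w ?y ^ p - hpol p w (frob 1 ?y)) \<le> \<pi>"
    by (auto dest!: gauss_leD[of \<pi> _ "p * (p - 1)"]
        simp: coeff_pcompose_monom hpol_eq_coeff_Lam coeff_map_poly power_0_left)
  then have "absv (hpol p w (frob 1 ?y) - hpol p w ?y ^ p) < absv (hpol p w ?y ^ p)"
    using Suc pi_less_1 by (simp add: absv_minus_commute absv_power)
  then have "absv (hpol p w (frob 1 ?y)) = absv (hpol p w ?y ^ p)"
    by (rule absv_eq_of_close)
  then show ?case unfolding frob_Suc[of j] using Suc by (simp add: absv_power)
qed (use h in simp)

lemma frobenius_system_Lam:
  assumes "x \<in> integral_points" "\<And>n. w n \<le> p - 1"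
  shows "frobenius_system p (\<lambda>n j. Lam (w n) (frob j x))"
proof unfold_locales
  fix n j
  show "gauss_le 1 (Lam (w n) (frob j x))" using assms by (intro Lam_integral frob_integral)
  show "degree (Lam (w n) (frob j x)) \<le> 2 * (p - 1)" using assms by (intro degree_Lam)
  show "gauss_le \<pi> (Lam (w n) (frob j x) ^ p - stretch p (Lam (w n) (frob (Suc j) x)))"
    unfolding frob_Suc[of j] using assms by (intro Lam_frobenius frob_integral)
qed

end

section \<open>The limit vector\<close>

lemma absv_prod_eq_1D:
  assumes "finite A" "\<And>i. i \<in> A \<Longrightarrow> absv (f i) \<le> 1" "absv (prod f A :: 'a::nonarchimedean_field) = 1"
    "i \<in> A"
  shows "absv (f i) = 1"
proof -
  have "absv (prod f A) = absv (f i) * (\<Prod>j\<in>A - {i}. absv (f j))"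
    unfolding absv_prod by (rule prod.remove[OF assms(1,4)])
  also have "\<dots> \<le> absv (f i) * 1"
    using assms(2) by (intro mult_left_mono prod_le_1) auto
  finally show ?thesis using assms(2)[OF assms(4)] assms(3) by simp
qed

lemma dist_vec2_le: "dist x y \<le> dist (x$1) (y$1) + dist (x$2) (y$2)"
  for x y :: "'a::metric_space^2"
  using L2_set_le_sum[of "UNIV :: 2 set" "\<lambda>i. dist (x$i) (y$i)"]
  by (simp add: dist_vec_def sum_2)

context residue_char
begin

text \<open>The polynomial whose coefficient of \<open>t^(p-1)\<close> is \<open>g\<^sub>j(z; w)\<close>; it takes the
  place of the bottom factor of \<open>\<Phi>\<^sub>s\<close> in the definition of \<open>I\<^sub>s\<close>.\<close>

definition Qpol :: "2 \<Rightarrow> nat \<Rightarrow> 'k^2 \<Rightarrow> 'k poly" where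
  "Qpol j w x = monom 1 w * [:- (x$1), 1:] ^ ((p - 1) div 2 - (if j = 1 then 1 else 0))
     * [:- (x$2), 1:] ^ ((p - 1) div 2 - (if j = 2 then 1 else 0))"

lemma half_p_pos: "0 < (p - 1) div 2"
  using p_ge_3 by linarith

lemma Qpol_mult: "Qpol j w x * [:- (x$j), 1:] = Lam w x"
proof -
  obtain m where m: "(p - 1) div 2 = Suc m" using half_p_pos by (cases "(p - 1) div 2") auto
  have 1: "c * A ^ (Suc m - 1) * B ^ (Suc m - 0) * A = c * (A * B) ^ Suc m"
    and 2: "c * A ^ (Suc m - 0) * B ^ (Suc m - 1) * B = c * (A * B) ^ Suc m" for c A B :: "'k poly"
    by (simp_all add: power_mult_distrib ac_simps)
  have neq: "((1::2) = 2) = False" "((2::2) = 1) = False" by simp_all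
  consider "j = 1" | "j = 2" using exhaust_2[of j] by blast
  then show ?thesis
  proof cases
    assume j: "j = 1"
    show ?thesis unfolding Qpol_def Lam_def m j by (simp only: refl if_True neq if_False 1)
  next
    assume j: "j = 2"
    show ?thesis unfolding Qpol_def Lam_def m j by (simp only: refl if_True neq if_False 2)
  qed
qed

lemma gpol_eq_coeff_Qpol: "gpol p j w x = coeff (Qpol j w x) (p - 1)"
  by (simp add: gpol_def Qpol_def)

lemma Qpol_integral:
  assumes "x \<in> integral_points"
  shows "gauss_le 1 (Qpol j w x)"
  unfolding Qpol_def using assms
  by (intro gauss_le_mult1 gauss_le_power gauss_le_linear gauss_le_monom) (auto simp: integral_points_def)

lemma degree_Qpol:
  assumes "w \<le> p - 1"
  shows "degree (Qpol j w x) \<le> 2 * (p - 1)"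
proof -
  have "degree (Qpol j w x) \<le> w + (p - 1) div 2 + (p - 1) div 2"
    unfolding Qpol_def
    by (intro order_trans[OF degree_mult_le] add_mono degree_monom_le)
       (simp_all only: degree_linear_power diff_le_self)
  then show ?thesis using assms by linarith
qed

lemma hpol_le_1: "(x :: 'k^2) \<in> integral_points \<Longrightarrow> absv (hpol p w x) \<le> 1"
  unfolding hpol_eq_coeff_Lam by (rule gauss_leD[OF Lam_integral])

lemma gpol_le_1: "(x :: 'k^2) \<in> integral_points \<Longrightarrow> absv (gpol p j w x) \<le> 1"
  unfolding gpol_eq_coeff_Qpol by (rule gauss_leD[OF Qpol_integral])

lemma finite_digits:
  assumes "odd l"
  shows "finite (range (digit TYPE('k) p l))"
  using digit_le[OF assms] by (auto intro: finite_subset[OF _ finite_atMost[of "p - 1"]])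

lemma Dom_integral: "x \<in> Dom p l \<Longrightarrow> (x :: 'k^2) \<in> integral_points"
  by (simp add: Dom_def)

lemma Dom_hpol:
  assumes "odd l" "(x :: 'k^2) \<in> Dom p l"
  shows "absv (hpol p (digit TYPE('k) p l n) x) = 1"
proof (rule absv_prod_eq_1D[OF finite_digits[OF assms(1)]])
  show "absv (\<Prod>w\<in>range (digit TYPE('k) p l). hpol p w x) = 1"
    using assms(2) by (simp add: Dom_def Hpol_def)
qed (auto intro: hpol_le_1 Dom_integral assms)

text \<open>All factors of \<open>G\<^sub>j\<close> are integral, so each of them is a unit if the product is.\<close>

lemma Dom_star_coprime_subset: "(Dom_star_coprime p l :: ('k^2) set) \<subseteq> Dom p l"
proof
  fix x :: "'k^2" assume x: "x \<in> Dom_star_coprime p l"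
  then obtain j where int: "x \<in> integral_points" and "absv (Gpol p j l x) = 1"
    by (auto simp: Dom_star_coprime_def)
  then have 1: "absv (gpol p j (digit TYPE('k) p l 0) x) * absv (Hpol p l x) = 1"
    by (simp add: Gpol_def Hpol_def absv_mult)
  have le: "absv (Hpol p l x) \<le> 1"
    unfolding Hpol_def absv_prod by (intro prod_le_1) (simp add: hpol_le_1 int)
  have "absv (gpol p j (digit TYPE('k) p l 0) x) * absv (Hpol p l x) \<le> 1 * absv (Hpol p l x)"
    by (intro mult_right_mono gpol_le_1 int) simp
  then have "absv (Hpol p l x) = 1" using 1 le by linarith
  then show "x \<in> Dom p l" by (simp add: Dom_def int)
qed

lemma Dom_star_subset: "(Dom_star p l :: ('k^2) set) \<subseteq> Dom p l"
  using Dom_star_coprime_subset by (auto simp: Dom_star_def)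

text \<open>The digits of the exponent of \<open>t\<close> are those of \<open>-\<lambda>/2\<close>, and all \<open>s\<close> digits of
  \<open>(p^s - 1)/2\<close> are \<open>(p - 1)/2\<close>.\<close>

lemma Phi_eq_prod:
  assumes l: "odd l" "\<bar>l\<bar> < int p ^ s"
  shows "Phi p s l x = (\<Prod>n<s. Lam (digit TYPE('k) p l n) x ^ p ^ n)"
proof -
  let ?w = "digit TYPE('k) p l" and ?M = "(p - 1) div 2"
  let ?P = "[:- (x$1), 1:] * [:- (x$2), 1:]"
  have "(\<Prod>n<s. Lam (?w n) x ^ p ^ n) = (\<Prod>n<s. monom 1 (?w n * p ^ n)) * ?P ^ (\<Sum>n<s. ?M * p ^ n)"
    unfolding Lam_def power_mult_distrib prod.distrib power_sum
    by (simp add: monom_power mult.commute flip: power_mult power_mult_distrib)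
  also have "(\<Prod>n<s. monom 1 (?w n * p ^ n)) = (monom 1 (\<Sum>n<s. ?w n * p ^ n) :: 'k poly)"
    by (induction s) (simp_all add: mult_monom)
  also have "(\<Sum>n<s. ?w n * p ^ n) = nat ((int p ^ s - l) div 2)"
    using l by (rule digit_sum)
  also have "(\<Sum>n<s. ?M * p ^ n) = (p ^ s - 1) div 2"
  proof -
    have "2 * (\<Sum>n<s. ?M * p ^ n) = (\<Sum>n<s. (p - 1) * p ^ n)"
      using odd_p by (simp add: sum_distrib_left flip: mult.assoc)
    also have "\<dots> = p ^ s - 1"
    proof (induction s)
      case (Suc s)
      have "p ^ s \<ge> 1" by simp
      then show ?case using Suc p_power_Suc[of s] by simp
    qed simp
    finally show ?thesis by simp
  qed
  finally show ?thesis
    by (simp only: Phi_def power_mult_distrib mult.assoc)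
qed

lemma coeff_Phi_div:
  assumes "Phi p s l x = f * [:- (x$j), 1:]"
  shows "Ivec p s l x $ j = coeff f (p ^ s - 1)"
proof -
  have "Phi p s l x div [:- (x$j), 1:] = f"
    unfolding assms by (rule nonzero_mult_div_cancel_right) simp
  then show ?thesis by (simp add: Ivec_def)
qed

lemma Ivec_eq_coeff_prod:
  fixes x :: "'k^2"
  assumes l: "odd l" "\<bar>l\<bar> < int p ^ s" and s: "1 \<le> s"
  shows "Ivec p s l x $ j = coeff (Qpol j (digit TYPE('k) p l 0) x
    * (\<Prod>n=1..<s. Lam (digit TYPE('k) p l n) x ^ p ^ n)) (p ^ s - 1)"
proof (rule coeff_Phi_div)
  show "Phi p s l x = Qpol j (digit TYPE('k) p l 0) x
      * (\<Prod>n=1..<s. Lam (digit TYPE('k) p l n) x ^ p ^ n) * [:- (x$j), 1:]"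
    unfolding Phi_eq_prod[OF l] lessThan_atLeast0
    using s by (simp add: prod.atLeast_Suc_lessThan ac_simps flip: Qpol_mult[of j _ x]
        del: mult_pCons_left mult_pCons_right)
qed

lemma ordinary_system:
  fixes x :: "'k^2"
  assumes l: "odd l" and x: "x \<in> Dom p l"
  shows "ordinary_frobenius_system p (\<lambda>n j. Lam (digit TYPE('k) p l n) (frob j x))"
proof -
  interpret frobenius_system p K "\<lambda>n j. Lam (digit TYPE('k) p l n) (frob j x)"
    by (intro frobenius_system_Lam Dom_integral[OF x] digit_le[OF l])
  show ?thesis
  proof
    fix n
    show "absv (coeff (Lam (digit TYPE('k) p l n) (frob n x)) (p - 1)) = 1"
      unfolding hpol_eq_coeff_Lam[symmetric]
      by (intro hpol_frob Dom_integral[OF x] Dom_hpol[OF l x])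
  qed
qed

lemma Tpol_eq_chain_coeff:
  fixes x :: "'k^2"
  assumes l: "odd l" "\<bar>l\<bar> < int p ^ s" and x: "x \<in> Dom p l"
  shows "Tpol p s l x
    = frobenius_system.chain_coeff p (\<lambda>n j. Lam (digit TYPE('k) p l n) (frob j x)) 0 s"
proof -
  interpret ordinary_frobenius_system p K "\<lambda>n j. Lam (digit TYPE('k) p l n) (frob j x)"
    using l(1) x by (rule ordinary_system)
  show ?thesis
    by (simp add: Tpol_def Phi_eq_prod[OF l] chain_coeff_def chain_def lessThan_atLeast0)
qed

lemma Tpol_unit:
  fixes x :: "'k^2"
  assumes l: "odd l" "\<bar>l\<bar> < int p ^ s" and x: "x \<in> Dom p l"
  shows "absv (Tpol p s l x) = 1"
proof -
  interpret ordinary_frobenius_system p K "\<lambda>n j. Lam (digit TYPE('k) p l n) (frob j x)"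
    using l(1) x by (rule ordinary_system)
  show ?thesis
    unfolding Tpol_eq_chain_coeff[OF l x] by (rule absv_chain_coeff) simp
qed

lemma Ivec_ratio_step:
  fixes x :: "'k^2"
  assumes l: "odd l" "\<bar>l\<bar> < int p ^ s" and x: "x \<in> Dom p l" and s: "1 \<le> s"
  shows "absv (Ivec p (Suc s) l x $ j / Tpol p (Suc s) l x - Ivec p s l x $ j / Tpol p s l x) \<le> \<pi> ^ s"
proof -
  interpret ordinary_frobenius_system p K "\<lambda>n j. Lam (digit TYPE('k) p l n) (frob j x)"
    using l(1) x by (rule ordinary_system)
  have "int p ^ s \<le> int p ^ Suc s" by (intro power_increasing) (simp_all add: Suc_le_eq)
  then have l': "\<bar>l\<bar> < int p ^ Suc s" using l(2) by linarith
  show ?thesis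
    unfolding Tpol_eq_chain_coeff[OF l x] Tpol_eq_chain_coeff[OF l(1) l' x]
      Ivec_eq_coeff_prod[OF l s] Ivec_eq_coeff_prod[OF l(1) l' le_SucI[OF s]]
    using dwork_congruence[OF s Qpol_integral[OF Dom_integral[OF x]] degree_Qpol[OF digit_le[OF l(1)]]]
    by simp
qed

lemma Ivec_ratio_close:
  fixes x :: "'k^2"
  assumes l: "odd l" "\<bar>l\<bar> < int p ^ s" and x: "x \<in> Dom p l" and s: "1 \<le> s" and n: "s \<le> n"
  shows "absv (Ivec p n l x $ j / Tpol p n l x - Ivec p s l x $ j / Tpol p s l x) \<le> \<pi> ^ s"
  using n
proof (induction n rule: dec_induct)
  case (step n)
  have "int p ^ s \<le> int p ^ n" using step(1) by (intro power_increasing) (simp_all add: Suc_le_eq)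
  then have "absv (Ivec p (Suc n) l x $ j / Tpol p (Suc n) l x - Ivec p n l x $ j / Tpol p n l x) \<le> \<pi> ^ n"
    using l x s step(1) by (intro Ivec_ratio_step) auto
  then have "absv (Ivec p (Suc n) l x $ j / Tpol p (Suc n) l x - Ivec p n l x $ j / Tpol p n l x) \<le> \<pi> ^ s"
    using pi_power_le[OF step(1)] by linarith
  then show ?case using step(3) by (rule absv_trans_le)
qed simp

lemma ex_p_power_gt: "\<exists>S\<ge>1. \<forall>s\<ge>S. \<bar>l\<bar> < int p ^ s"
proof -
  have "\<bar>l\<bar> < int p ^ s" if "s \<ge> Suc (nat \<bar>l\<bar>)" for s
  proof -
    have "s < p ^ s" using p_ge_3 by (intro power_gt_expt) simp
    then have "int s < int p ^ s" by (simp flip: of_nat_power)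
    then show ?thesis using that by linarith
  qed
  then show ?thesis by (intro exI[of _ "Suc (nat \<bar>l\<bar>)"]) auto
qed

lemma calI_uniform_limit:
  assumes l: "odd l"
  shows "uniform_limit (Dom p l) (\<lambda>s a. inverse (Tpol p s l a) *s Ivec p s l a)
    (calI p l :: 'k^2 \<Rightarrow> 'k^2) sequentially"
proof -
  let ?f = "\<lambda>s a. inverse (Tpol p s l a) *s Ivec p s l a :: 'k^2"
  obtain S where S: "S \<ge> 1" "\<And>s. s \<ge> S \<Longrightarrow> \<bar>l\<bar> < int p ^ s" using ex_p_power_gt by blast
  have "uniformly_Cauchy_on (Dom p l) ?f"
  proof (rule uniformly_Cauchy_onI')
    fix e :: real assume "e > 0"
    then obtain S' where S': "\<And>s. s \<ge> S' \<Longrightarrow> \<pi> ^ s < e / 2" using ex_pi_power_less[of "e / 2"] by auto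
    have "dist (?f m a) (?f n a) < e" if a: "a \<in> Dom p l" and mn: "m \<ge> max S S'" "n > m" for a m n
    proof -
      have "dist (?f m a $ j) (?f n a $ j) \<le> \<pi> ^ m" for j
        using Ivec_ratio_close[of l m a n j] l a mn S
        by (simp add: dist_eq_absv absv_minus_commute field_class.field_divide_inverse mult.commute)
      from this[of 1] this[of 2] show ?thesis
        using dist_vec2_le[of "?f m a" "?f n a"] S'[of m] mn by linarith
    qed
    then show "\<exists>M. \<forall>x\<in>Dom p l. \<forall>m\<ge>M. \<forall>n>m. dist (?f m x) (?f n x) < e" by blast
  qed
  then obtain f where "uniform_limit (Dom p l) ?f f sequentially"
    using Cauchy_uniformly_convergent by (auto simp: uniformly_convergent_on_def)
  then show ?thesis unfolding calI_def
    by (rule someI[where P = "\<lambda>f. uniform_limit (Dom p l) ?f f sequentially"])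
qed

text \<open>The explicit rate of convergence that all later estimates use.\<close>

lemma calI_close:
  fixes x :: "'k^2"
  assumes l: "odd l" "\<bar>l\<bar> < int p ^ s" and x: "x \<in> Dom p l" and s: "1 \<le> s"
  shows "absv (calI p l x $ j - Ivec p s l x $ j / Tpol p s l x) \<le> \<pi> ^ s"
proof -
  let ?f = "\<lambda>s. inverse (Tpol p s l x) *s Ivec p s l x :: 'k^2"
  have "\<forall>\<^sub>F n in sequentially. dist (?f n) (calI p l x) < \<pi> ^ s"
    by (rule eventually_mono[OF uniform_limitD[OF calI_uniform_limit[OF l(1)], of "\<pi> ^ s"]])
      (use x in simp_all)
  then have "\<forall>\<^sub>F n in sequentially. dist (?f n) (calI p l x) < \<pi> ^ s \<and> s \<le> n"
    using eventually_ge_at_top by (rule eventually_conj)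
  then obtain n where n: "n \<ge> s" "dist (?f n) (calI p l x) < \<pi> ^ s"
    using eventually_happens'[OF sequentially_bot] by blast
  have "dist (?f n $ j) (calI p l x $ j) \<le> \<pi> ^ s"
    using dist_vec_nth_le[of "?f n" j "calI p l x"] n(2) by linarith
  then have "absv (calI p l x $ j - Ivec p n l x $ j / Tpol p n l x) \<le> \<pi> ^ s"
    by (simp add: dist_eq_absv absv_minus_commute field_class.field_divide_inverse mult.commute)
  then show ?thesis
    using Ivec_ratio_close[OF l x s n(1)] by (rule absv_trans_le)
qed

end

section \<open>Congruences between the approximating vectors\<close>

text \<open>The other coordinate; it allows both directions \<open>i\<close> to be treated at once.\<close>

definition other :: "2 \<Rightarrow> 2" where "other i = (if i = 1 then 2 else 1)"

lemma other_simps [simp]: "other 1 = 2" "other 2 = 1"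
  by (simp_all add: other_def)

lemma eq_or_other: "j = i \<or> j = other i"
  using exhaust_2[of i] exhaust_2[of j] by auto

lemma other_neq [simp]: "other i \<noteq> i" "i \<noteq> other i"
  using exhaust_2[of i] by auto

lemma Phi_split:
  "Phi p s l x = monom 1 1 ^ nat ((int p ^ s - l) div 2)
     * [:- (x$i), 1:] ^ ((p ^ s - 1) div 2) * [:- (x$other i), 1:] ^ ((p ^ s - 1) div 2)"
proof -
  have "monom 1 1 ^ k = (monom 1 k :: 'a poly)" for k by (simp add: monom_power)
  then show ?thesis using exhaust_2[of i] by (auto simp: Phi_def mult.assoc mult.commute[of "_ ^ _" "_ ^ _"])
qed

text \<open>The remainder \<open>D\<close> is integral whatever \<open>n\<close> is. This makes the Taylor expansions of
  \<open>I\<^sub>s\<close> uniform in \<open>s\<close>.\<close>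

lemma taylor_power:
  fixes f :: "'a::nonarchimedean_field poly"
  assumes f: "gauss_le 1 f" and h: "absv h \<le> 1"
  shows "\<exists>D. gauss_le 1 D \<and> (f - [:h:]) ^ n = f ^ n - smult (of_nat n * h) (f ^ (n - 1)) + smult (h\<^sup>2) D"
proof (induction n)
  case 0
  then show ?case by (intro exI[of _ 0]) (simp add: gauss_le_0)
next
  case (Suc n)
  then obtain D where D: "gauss_le 1 D"
    "(f - [:h:]) ^ n = f ^ n - smult (of_nat n * h) (f ^ (n - 1)) + smult (h\<^sup>2) D" by blast
  define D' where "D' = (f - [:h:]) * D + smult (of_nat n) (f ^ (n - 1))"
  have n: "smult (of_nat n) (f * f ^ (n - 1)) = smult (of_nat n) (f ^ n)"
    by (cases n) auto
  have "(f - [:h:]) ^ Suc n = (f - [:h:]) * (f ^ n - smult (of_nat n * h) (f ^ (n - 1)) + smult (h\<^sup>2) D)"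
    by (simp add: D(2))
  also have "\<dots> = f ^ Suc n - smult h (smult (of_nat n) (f * f ^ (n - 1))) - smult h (f ^ n) + smult (h\<^sup>2) D'"
    by (simp add: D'_def algebra_simps smult_add_right smult_diff_right power2_eq_square)
  also have "\<dots> = f ^ Suc n - smult (of_nat (Suc n) * h) (f ^ (Suc n - 1)) + smult (h\<^sup>2) D'"
    unfolding n by (simp add: algebra_simps smult_add_left)
  finally have "(f - [:h:]) ^ Suc n = f ^ Suc n - smult (of_nat (Suc n) * h) (f ^ (Suc n - 1)) + smult (h\<^sup>2) D'" .
  moreover have "gauss_le 1 D'"
    unfolding D'_def using D(1) f h
    by (intro gauss_le_add gauss_le_mult1 gauss_le_diff gauss_le_const gauss_le_smult
        absv_of_nat_le_1 gauss_le_power)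
  ultimately show ?case by blast
qed

context residue_char
begin

text \<open>The source of all differential and difference equations modulo \<open>p^s\<close>.\<close>

lemma coeff_pderiv_small:
  fixes f :: "'k poly"
  assumes "gauss_le 1 f"
  shows "absv (coeff (pderiv f) (p ^ s - 1)) \<le> \<pi> ^ s"
proof -
  have "coeff (pderiv f) (p ^ s - 1) = of_nat (p ^ s) * coeff f (p ^ s)"
    by (simp add: coeff_pderiv flip: of_nat_Suc del: of_nat_power)
  then show ?thesis
    using absv_mult_le1[OF absv_nat_dvd[OF dvd_refl] gauss_leD[OF assms, of "p ^ s"]] by (simp only:)
qed

context
  fixes s :: nat and l :: int
  assumes l: "odd l" "\<bar>l\<bar> < int p ^ s" and s: "2 \<le> s"
begin

text \<open>Both exponents in \<open>\<Phi>\<^sub>s\<close>, written so that they can be lowered without truncated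
  subtraction: by one for \<open>t\<close>, by two for the linear factors.\<close>

lemma half_exponents:
  obtains k M where "nat ((int p ^ s - l) div 2) = Suc k" "(p ^ s - 1) div 2 = Suc (Suc M)"
    "2 * of_nat k + 2 = (of_nat (p ^ s) - of_int l :: 'k)"
    "2 * of_nat M + 4 = (of_nat (p ^ s) - 1 :: 'k)"
proof -
  let ?k = "nat ((int p ^ s - l) div 2)" and ?M = "(p ^ s - 1) div 2"
  have k: "2 * int ?k = int p ^ s - l" using l odd_p by simp
  then have "?k > 0" using l(2) by linarith
  then obtain k where k': "?k = Suc k" by (cases ?k) auto
  \<comment> \<open>The first bound \<open>9 \<le> p^s\<close> is what \<open>2 \<le> s\<close> is for: it makes the exponent of a linear factor at least 2.\<close>
  have "p ^ 2 \<le> p ^ s" using s by (intro power_increasing) simp_all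
  moreover have "3 ^ 2 \<le> p ^ 2" using p_ge_3 by (intro power_mono) simp_all
  ultimately have 9: "9 \<le> p ^ s" by simp
  then have "?M \<ge> 2" by linarith
  then obtain M where M: "?M = Suc (Suc M)" by (metis Suc_le_D numeral_2_eq_2 Suc_le_mono)
  have M2: "2 * ?M = p ^ s - 1" using odd_p by simp
  show ?thesis
  proof (rule that[OF k' M])
    have "of_int (2 * int (Suc k)) = (of_int (int p ^ s - l) :: 'k)" using k k' by simp
    then show "2 * of_nat k + 2 = (of_nat (p ^ s) - of_int l :: 'k)" by (simp add: algebra_simps)
    have "2 * M + 5 = p ^ s" using M2 M 9 by linarith
    then have "(of_nat (p ^ s) :: 'k) = of_nat (2 * M + 5)" by simp
    then show "2 * of_nat M + 4 = (of_nat (p ^ s) - 1 :: 'k)" by simp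
  qed
qed

lemma Ivec_eq_coeff:
  fixes x :: "'k^2"
  assumes "nat ((int p ^ s - l) div 2) = k" "(p ^ s - 1) div 2 = Suc M"
  shows "Ivec p s l x $ i
    = coeff (monom 1 1 ^ k * [:- (x$i), 1:] ^ M * [:- (x$other i), 1:] ^ Suc M) (p ^ s - 1)"
proof (rule coeff_Phi_div)
  have "a * b ^ Suc M * c = a * b ^ M * c * b" for a b c :: "'k poly" by (simp add: ac_simps)
  then show "Phi p s l x
      = monom 1 1 ^ k * [:- (x$i), 1:] ^ M * [:- (x$other i), 1:] ^ Suc M * [:- (x$i), 1:]"
    unfolding Phi_split[of p s l x i] assms by blast
qed

lemma Ivec_other_eq_coeff:
  fixes x :: "'k^2"
  assumes "nat ((int p ^ s - l) div 2) = k" "(p ^ s - 1) div 2 = Suc M"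
  shows "Ivec p s l x $ other i
    = coeff (monom 1 1 ^ k * [:- (x$i), 1:] ^ Suc M * [:- (x$other i), 1:] ^ M) (p ^ s - 1)"
proof (rule coeff_Phi_div)
  have "a * c * b ^ Suc M = a * c * b ^ M * b" for a b c :: "'k poly" by (simp add: ac_simps)
  then show "Phi p s l x
      = monom 1 1 ^ k * [:- (x$i), 1:] ^ Suc M * [:- (x$other i), 1:] ^ M * [:- (x$other i), 1:]"
    unfolding Phi_split[of p s l x i] assms by blast
qed

text \<open>The discrete equation: \<open>t^(-1) \<Phi>\<close> belongs to \<open>\<lambda> + 2\<close>, and the coefficient of
  \<open>t^(p^s - 1)\<close> of a derivative is divisible by \<open>p^s\<close>.\<close>

lemma Tpol_shift:
  fixes x :: "'k^2"
  assumes x: "x \<in> integral_points"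
  shows "absv (of_int l * Tpol p s (l + 2) x + (Ivec p s l x $ 1 + Ivec p s l x $ 2)) \<le> \<pi> ^ s"
proof -
  obtain k M where k: "nat ((int p ^ s - l) div 2) = Suc k" "2 * of_nat k + 2 = (of_nat (p ^ s) - of_int l :: 'k)"
    and M: "(p ^ s - 1) div 2 = Suc (Suc M)" "2 * of_nat M + 4 = (of_nat (p ^ s) - 1 :: 'k)"
    by (rule half_exponents)
  have k': "nat ((int p ^ s - (l + 2)) div 2) = k" using k(1) by linarith
  define t X Y where "t = (monom 1 1 :: 'k poly)" and "X = [:- (x$1), 1:]" and "Y = [:- (x$2), 1:]"
  let ?c = "\<lambda>f. coeff f (p ^ s - 1)"
  have d: "pderiv t = 1" "pderiv X = 1" "pderiv Y = 1"
    by (simp_all add: t_def X_def Y_def pderiv_monom pderiv_pCons monom_0)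
  have int: "gauss_le 1 t" "gauss_le 1 X" "gauss_le 1 Y"
    unfolding t_def X_def Y_def using x
    by (auto intro!: gauss_le_monom gauss_le_linear simp: integral_points_def)
  define A B C where "A = t ^ k * X ^ Suc (Suc M) * Y ^ Suc (Suc M)"
    and "B = t ^ Suc k * X ^ Suc M * Y ^ Suc (Suc M)" and "C = t ^ Suc k * X ^ Suc (Suc M) * Y ^ Suc M"
  have T: "Tpol p s (l + 2) x = ?c A"
    unfolding Tpol_def Phi_split[of p s "l + 2" x 1] k' M(1) by (simp add: A_def t_def X_def Y_def)
  have I: "Ivec p s l x $ 1 = ?c B" "Ivec p s l x $ 2 = ?c C"
    using Ivec_eq_coeff[OF k(1) M(1), of x 1] Ivec_other_eq_coeff[OF k(1) M(1), of x 1]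
    by (simp_all add: B_def C_def t_def X_def Y_def)
  have "pderiv (t ^ Suc k * X ^ Suc (Suc M) * Y ^ Suc (Suc M))
      = smult (of_nat (Suc k)) A + smult (of_nat (Suc (Suc M))) (B + C)"
    unfolding pderiv_mult pderiv_power_Suc d A_def B_def C_def
    by (simp add: smult_add_right algebra_simps del: of_nat_Suc)
  moreover have "gauss_le 1 (t ^ Suc k * X ^ Suc (Suc M) * Y ^ Suc (Suc M))"
    by (intro gauss_le_mult1 gauss_le_power int)
  ultimately have "absv (of_nat (Suc k) * ?c A + of_nat (Suc (Suc M)) * (?c B + ?c C)) \<le> \<pi> ^ s"
    using coeff_pderiv_small by (metis coeff_add coeff_smult)
  then have "absv (2 * (of_nat (Suc k) * ?c A + of_nat (Suc (Suc M)) * (?c B + ?c C))) \<le> \<pi> ^ s"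
    by (rule absv_mult_le1'[OF absv_two_le_1])
  moreover have "absv (of_nat (p ^ s) * (?c A + (?c B + ?c C))) \<le> \<pi> ^ s"
    by (intro absv_mult_le1 absv_nat_dvd absv_add_le gauss_leD)
       (auto simp: A_def B_def C_def intro!: gauss_le_mult1 gauss_le_power int)
  ultimately have "absv (of_nat (p ^ s) * (?c A + (?c B + ?c C))
      - 2 * (of_nat (Suc k) * ?c A + of_nat (Suc (Suc M)) * (?c B + ?c C))) \<le> \<pi> ^ s"
    by (intro absv_diff_le)
  also have "of_nat (p ^ s) * (?c A + (?c B + ?c C))
      - 2 * (of_nat (Suc k) * ?c A + of_nat (Suc (Suc M)) * (?c B + ?c C))
      = of_nat (p ^ s) * (?c A + (?c B + ?c C)) - ((2 * of_nat k + 2) * ?c A + (2 * of_nat M + 4) * (?c B + ?c C))"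
    by (simp add: algebra_simps del: of_nat_power)
  also have "\<dots> = of_int l * ?c A + (?c B + ?c C)"
    unfolding k(2) M(2) by (simp add: algebra_simps del: of_nat_power)
  finally show ?thesis unfolding T I .
qed

text \<open>Dividing by \<open>t\<close>: the identity \<open>t - (t - z\<^sub>i) = z\<^sub>i\<close>, times
  \<open>\<Phi> / (t (t - z\<^sub>i))\<close>.\<close>

lemma Ivec_shift:
  fixes x :: "'k^2"
  shows "x $ i * Ivec p s (l + 2) x $ i = Ivec p s l x $ i - Tpol p s (l + 2) x"
proof -
  obtain k M where k: "nat ((int p ^ s - l) div 2) = Suc k"
    and M: "(p ^ s - 1) div 2 = Suc (Suc M)"
    by (rule half_exponents)
  have k': "nat ((int p ^ s - (l + 2)) div 2) = k" using k by linarith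
  define t X Y where "t = (monom 1 1 :: 'k poly)" and "X = [:- (x$i), 1:]" and "Y = [:- (x$other i), 1:]"
  have tX: "t = X + [:x$i:]" by (simp add: t_def X_def monom_Suc monom_0)
  let ?c = "\<lambda>f. coeff f (p ^ s - 1)"
  have T: "Tpol p s (l + 2) x = ?c (t ^ k * X ^ Suc (Suc M) * Y ^ Suc (Suc M))"
    unfolding Tpol_def Phi_split[of p s "l + 2" x i] k' M by (simp add: t_def X_def Y_def)
  have I: "Ivec p s l x $ i = ?c (t ^ Suc k * X ^ Suc M * Y ^ Suc (Suc M))"
    using Ivec_eq_coeff[OF k M, of x i] by (simp add: t_def X_def Y_def)
  have "Phi p s (l + 2) x = t ^ k * X ^ Suc M * Y ^ Suc (Suc M) * X"
    unfolding Phi_split[of p s "l + 2" x i] k' M t_def[symmetric] X_def[symmetric] Y_def[symmetric]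
    by (simp add: ac_simps)
  then have I': "Ivec p s (l + 2) x $ i = ?c (t ^ k * X ^ Suc M * Y ^ Suc (Suc M))"
    unfolding X_def by (rule coeff_Phi_div)
  have "t ^ Suc k * X ^ Suc M * Y ^ Suc (Suc M) - t ^ k * X ^ Suc (Suc M) * Y ^ Suc (Suc M)
      = (t - X) * (t ^ k * X ^ Suc M * Y ^ Suc (Suc M))"
    by (simp add: algebra_simps)
  also have "\<dots> = smult (x$i) (t ^ k * X ^ Suc M * Y ^ Suc (Suc M))" by (simp add: tX)
  finally show ?thesis unfolding T I I' by (metis coeff_diff coeff_smult)
qed

text \<open>The differential equations. The vector \<open>J\<close> is the partial derivative of \<open>I\<^sub>s\<close> with
  respect to \<open>z\<^sub>i\<close>; the number \<open>E\<close> is the coefficient of \<open>t^(p^s - 1)\<close> in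
  \<open>\<Phi> / ((t - z\<^sub>1)(t - z\<^sub>2))\<close>, by partial fractions equal to
  \<open>(I\<^sub>1 - I\<^sub>2) / (z\<^sub>1 - z\<^sub>2)\<close>. The \<open>i\<close>-th component of \<open>J\<close> involves
  \<open>\<Phi> / (t - z\<^sub>i)^2\<close>, which is eliminated by means of the derivative of
  \<open>t \<Phi> / (t - z\<^sub>i)\<close>.\<close>

lemma Ivec_dynamics:
  fixes x :: "'k^2"
  assumes x: "x \<in> integral_points"
  obtains E and J :: "'k^2" where "absv E \<le> 1" "\<And>j. absv (J $ j) \<le> 1"
    "(x$i - x$other i) * E = Ivec p s l x $ i - Ivec p s l x $ other i"
    "absv (2 * x$i * J$i + (of_int l + 1) * Ivec p s l x $ i + Ivec p s l x $ other i + x$i * E) \<le> \<pi> ^ s"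
    "absv (2 * x$i * J$other i - x$i * E) \<le> \<pi> ^ s"
    "\<And>h j. absv h \<le> 1 \<Longrightarrow>
      absv (Ivec p s l (x + axis i h) $ j - Ivec p s l x $ j - h * J $ j) \<le> absv (h\<^sup>2)"
proof -
  obtain k M where k: "nat ((int p ^ s - l) div 2) = Suc k" "2 * of_nat k + 2 = (of_nat (p ^ s) - of_int l :: 'k)"
    and M: "(p ^ s - 1) div 2 = Suc (Suc M)" "2 * of_nat M + 4 = (of_nat (p ^ s) - 1 :: 'k)"
    by (rule half_exponents)
  define t X Y where "t = (monom 1 1 :: 'k poly)" and "X = [:- (x$i), 1:]" and "Y = [:- (x$other i), 1:]"
  let ?c = "\<lambda>f. coeff f (p ^ s - 1)"
  have tX: "t = X + [:x$i:]" by (simp add: t_def X_def monom_Suc monom_0)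
  have YX: "Y - X = [:x$i - x$other i:]" by (simp add: X_def Y_def)
  have d: "pderiv t = 1" "pderiv X = 1" "pderiv Y = 1"
    by (simp_all add: t_def X_def Y_def pderiv_monom pderiv_pCons monom_0)
  have int: "gauss_le 1 t" "gauss_le 1 X" "gauss_le 1 Y"
    unfolding t_def X_def Y_def using x
    by (auto intro!: gauss_le_monom gauss_le_linear simp: integral_points_def)
  define B C F G where "B = t ^ Suc k * X ^ Suc M * Y ^ Suc (Suc M)"
    and "C = t ^ Suc k * X ^ Suc (Suc M) * Y ^ Suc M"
    and "F = t ^ Suc k * X ^ Suc M * Y ^ Suc M"
    and "G = t ^ Suc k * X ^ M * Y ^ Suc (Suc M)"
  have ints: "absv (?c B) \<le> 1" "absv (?c C) \<le> 1" "absv (?c F) \<le> 1" "absv (?c G) \<le> 1"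
    unfolding B_def C_def F_def G_def by (intro gauss_leD gauss_le_mult1 gauss_le_power int)+
  have I: "Ivec p s l x $ i = ?c B" "Ivec p s l x $ other i = ?c C"
    using Ivec_eq_coeff[OF k(1) M(1), of x i] Ivec_other_eq_coeff[OF k(1) M(1), of x i]
    by (simp_all add: B_def C_def t_def X_def Y_def)
  define J :: "'k^2" where
    "J = (\<chi> j. if j = i then - of_nat (Suc M) * ?c G else - of_nat (Suc (Suc M)) * ?c F)"
  have J: "J $ i = - of_nat (Suc M) * ?c G" "J $ other i = - of_nat (Suc (Suc M)) * ?c F"
    by (simp_all add: J_def)
  have xi: "absv (x$i) \<le> 1" using x by (simp add: integral_points_def)
  show ?thesis
  proof (rule that[of "?c F" J])
    show "absv (?c F) \<le> 1" by (rule ints)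
    show "absv (J $ j) \<le> 1" for j
      using eq_or_other[of j i] absv_mult_le1'[OF absv_of_nat_le_1 ints(3)]
        absv_mult_le1'[OF absv_of_nat_le_1 ints(4)]
      by (auto simp: J absv_mult simp del: of_nat_Suc)
    have "B - C = (Y - X) * F" by (simp add: B_def C_def F_def algebra_simps)
    also have "\<dots> = smult (x$i - x$other i) F" by (simp add: YX)
    finally show "(x$i - x$other i) * ?c F = Ivec p s l x $ i - Ivec p s l x $ other i"
      unfolding I by (metis coeff_diff coeff_smult)
    have E1: "t * G = B + smult (x$i) G"
      unfolding B_def G_def by (subst tX) (simp add: algebra_simps)
    have E2: "t * F = C + smult (x$i) F"
      unfolding C_def F_def by (subst tX) (simp add: algebra_simps)
    have "pderiv (t ^ Suc (Suc k) * X ^ Suc M * Y ^ Suc (Suc M))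
        = smult (of_nat (Suc (Suc k))) B + smult (of_nat (Suc M)) (t * G)
          + smult (of_nat (Suc (Suc M))) (t * F)"
      unfolding pderiv_mult pderiv_power_Suc d B_def F_def G_def
      by (simp add: smult_add_right algebra_simps del: of_nat_Suc)
    also have "\<dots> = smult (of_nat (Suc (Suc k))) B + smult (of_nat (Suc M)) (B + smult (x$i) G)
          + smult (of_nat (Suc (Suc M))) (C + smult (x$i) F)"
      unfolding E1 E2 ..
    finally have "?c (pderiv (t ^ Suc (Suc k) * X ^ Suc M * Y ^ Suc (Suc M)))
      = of_nat (Suc (Suc k)) * ?c B + of_nat (Suc M) * (?c B + x$i * ?c G)
          + of_nat (Suc (Suc M)) * (?c C + x$i * ?c F)" (is "_ = ?S")
      by (simp del: of_nat_Suc)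
    moreover have "gauss_le 1 (t ^ Suc (Suc k) * X ^ Suc M * Y ^ Suc (Suc M))"
      by (intro gauss_le_mult1 gauss_le_power int)
    ultimately have "absv ?S \<le> \<pi> ^ s"
      using coeff_pderiv_small by metis
    then have "absv (2 * ?S) \<le> \<pi> ^ s"
      by (rule absv_mult_le1'[OF absv_two_le_1])
    moreover have "absv (of_nat (p ^ s) * (2 * ?c B + ?c C + x$i * ?c F)) \<le> \<pi> ^ s"
      by (intro absv_mult_le1 absv_nat_dvd absv_add_le ints absv_mult_le1' xi) auto
    ultimately have "absv (of_nat (p ^ s) * (2 * ?c B + ?c C + x$i * ?c F) - 2 * ?S) \<le> \<pi> ^ s"
      by (intro absv_diff_le)
    also have "of_nat (p ^ s) * (2 * ?c B + ?c C + x$i * ?c F) - 2 * ?S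
      = of_nat (p ^ s) * (2 * ?c B + ?c C + x$i * ?c F)
        - (((2 * of_nat k + 2) + (2 * of_nat M + 4)) * ?c B + (2 * of_nat M + 4) * (?c C + x$i * ?c F))
        + 2 * x$i * J$i"
      unfolding J by (simp add: algebra_simps del: of_nat_power)
    also have "\<dots> = 2 * x$i * J$i + (of_int l + 1) * ?c B + ?c C + x$i * ?c F"
      unfolding k(2) M(2) by (simp add: algebra_simps del: of_nat_power)
    finally show "absv (2 * x$i * J$i + (of_int l + 1) * Ivec p s l x $ i + Ivec p s l x $ other i
        + x$i * ?c F) \<le> \<pi> ^ s"
      unfolding I .
    have "2 * x$i * J$other i - x$i * ?c F = - ((2 * of_nat M + 4) + 1) * (x$i * ?c F)"
      unfolding J by (simp add: algebra_simps)
    also have "\<dots> = - (of_nat (p ^ s) * (x$i * ?c F))"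
      unfolding M(2) by simp
    also have "absv \<dots> \<le> \<pi> ^ s"
      unfolding absv_minus
      by (intro absv_mult_le1 absv_nat_dvd absv_mult_le1' xi ints) auto
    finally show "absv (2 * x$i * J$other i - x$i * ?c F) \<le> \<pi> ^ s" .
    show "absv (Ivec p s l (x + axis i h) $ j - Ivec p s l x $ j - h * J $ j) \<le> absv (h\<^sup>2)"
      if h: "absv h \<le> 1" for h j
    proof -
      have Xh: "[:- ((x + axis i h) $ i), 1:] = X - [:h:]"
        and Yh: "[:- ((x + axis i h) $ other i), 1:] = Y"
        by (simp_all add: X_def Y_def axis_def)
      consider "j = i" | "j = other i" using eq_or_other[of j i] by blast
      then show ?thesis
      proof cases
        assume j: "j = i"
        obtain D where D: "gauss_le 1 D" "(X - [:h:]) ^ Suc M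
            = X ^ Suc M - smult (of_nat (Suc M) * h) (X ^ (Suc M - 1)) + smult (h\<^sup>2) D"
          using taylor_power[OF int(2) h] by blast
        have "Ivec p s l (x + axis i h) $ i = ?c (t ^ Suc k * (X - [:h:]) ^ Suc M * Y ^ Suc (Suc M))"
          unfolding Ivec_eq_coeff[OF k(1) M(1), of "x + axis i h" i] Xh Yh t_def ..
        also have "t ^ Suc k * (X - [:h:]) ^ Suc M * Y ^ Suc (Suc M)
            = B - smult (of_nat (Suc M) * h) G + smult (h\<^sup>2) (t ^ Suc k * D * Y ^ Suc (Suc M))"
          unfolding D(2) B_def G_def by (simp add: algebra_simps del: power_Suc of_nat_Suc)
        finally have "Ivec p s l (x + axis i h) $ i - ?c B - h * J $ i = h\<^sup>2 * ?c (t ^ Suc k * D * Y ^ Suc (Suc M))"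
          unfolding J by (simp del: power_Suc of_nat_Suc)
        also have "absv \<dots> \<le> absv (h\<^sup>2)"
          by (intro absv_mult_le1 gauss_leD gauss_le_mult1 gauss_le_power int D) simp
        finally show ?thesis unfolding j I .
      next
        assume j: "j = other i"
        obtain D where D: "gauss_le 1 D" "(X - [:h:]) ^ Suc (Suc M)
            = X ^ Suc (Suc M) - smult (of_nat (Suc (Suc M)) * h) (X ^ (Suc (Suc M) - 1)) + smult (h\<^sup>2) D"
          using taylor_power[OF int(2) h] by blast
        have "Ivec p s l (x + axis i h) $ other i = ?c (t ^ Suc k * (X - [:h:]) ^ Suc (Suc M) * Y ^ Suc M)"
          unfolding Ivec_other_eq_coeff[OF k(1) M(1), of "x + axis i h" i] Xh Yh t_def ..
        also have "t ^ Suc k * (X - [:h:]) ^ Suc (Suc M) * Y ^ Suc M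
            = C - smult (of_nat (Suc (Suc M)) * h) F + smult (h\<^sup>2) (t ^ Suc k * D * Y ^ Suc M)"
          unfolding D(2) C_def F_def by (simp add: algebra_simps del: power_Suc of_nat_Suc)
        finally have "Ivec p s l (x + axis i h) $ other i - ?c C - h * J $ other i = h\<^sup>2 * ?c (t ^ Suc k * D * Y ^ Suc M)"
          unfolding J by (simp del: power_Suc of_nat_Suc)
        also have "absv \<dots> \<le> absv (h\<^sup>2)"
          by (intro absv_mult_le1 gauss_leD gauss_le_mult1 gauss_le_power int D) simp
        finally show ?thesis unfolding j I .
      qed
    qed
  qed
qed

end

end

section \<open>The line spanned by the limit vector\<close>

text \<open>The sign convention depends on \<open>i\<close>, so that formulas for the direction \<open>i\<close> have the
  same shape for both values of \<open>i\<close>.\<close>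

definition wedge :: "2 \<Rightarrow> 'a::comm_ring^2 \<Rightarrow> 'a^2 \<Rightarrow> 'a" where
  "wedge i v w = v $ i * w $ other i - v $ other i * w $ i"

lemma wedge_other: "wedge (other i) v w = - wedge i v w"
  using exhaust_2[of i] by (auto simp: wedge_def)

lemma wedge_le:
  fixes v w :: "'a::nonarchimedean_field^2"
  assumes "\<And>j. absv (v $ j) \<le> r" "\<And>j. absv (w $ j) \<le> r'"
  shows "absv (wedge i v w) \<le> r * r'"
  unfolding wedge_def by (intro absv_diff_le absv_mult_le assms)

lemma wedge_add_left: "wedge i (u + v) w = wedge i u w + wedge i v w"
  by (simp add: wedge_def algebra_simps)

lemma wedge_add_right: "wedge i w (u + v) = wedge i w u + wedge i w v"
  by (simp add: wedge_def algebra_simps)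

lemma wedge_diff_left: "wedge i (u - v) w = wedge i u w - wedge i v w"
  by (simp add: wedge_def algebra_simps)

lemma wedge_diff_right: "wedge i w (u - v) = wedge i w u - wedge i w v"
  by (simp add: wedge_def algebra_simps)

lemma wedge_scale_left: "wedge i (c *s u) w = c * wedge i u w"
  by (simp add: wedge_def algebra_simps)

lemma wedge_scale_right: "wedge i u (c *s w) = c * wedge i u w"
  by (simp add: wedge_def algebra_simps)

lemma wedge_self [simp]: "wedge i v v = 0"
  by (simp add: wedge_def mult.commute)

lemma mem_span_iff_wedge:
  fixes w :: "'a::field^2"
  assumes "w \<noteq> 0"
  shows "v \<in> vec.span {w} \<longleftrightarrow> wedge i v w = 0"
proof
  assume "v \<in> vec.span {w}"
  then obtain c where "v = c *s w" by (auto simp: vec.span_singleton)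
  then show "wedge i v w = 0" by (simp add: wedge_scale_left)
next
  assume 0: "wedge i v w = 0"
  from assms obtain j where j: "w $ j \<noteq> 0" by (auto simp: vec_eq_iff)
  have "wedge j v w = 0" using 0 eq_or_other[of j i] wedge_other[of i v w] by auto
  have "v $ k = v $ j / w $ j * w $ k" for k
  proof (cases "k = j")
    case False
    then have k: "k = other j" using eq_or_other[of k j] by blast
    have "v $ other j * w $ j = v $ j * w $ other j" using \<open>wedge j v w = 0\<close> by (simp add: wedge_def)
    then show ?thesis unfolding k using j by (simp add: nonzero_eq_divide_eq)
  qed (use j in simp)
  then have "v = (v $ j / w $ j) *s w" unfolding vec_eq_iff vector_smult_component by blast
  then show "v \<in> vec.span {w}" by (auto simp: vec.span_singleton)
qed

context residue_char
begin

lemma lipschitz_from_axes: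
  fixes F :: "'k^2 \<Rightarrow> 'k"
  assumes step: "\<And>x i h. x \<in> integral_points \<Longrightarrow> absv h \<le> 1 \<Longrightarrow> absv (F (x + axis i h) - F x) \<le> absv h"
    and x: "x \<in> integral_points" and y: "y \<in> integral_points" and d: "\<And>i. absv (x$i - y$i) \<le> d"
  shows "absv (F x - F y) \<le> d"
proof -
  define z where "z = y + axis 1 (x$1 - y$1)"
  have z: "z $ 1 = x $ 1" "z $ 2 = y $ 2" by (simp_all add: z_def axis_def)
  have zx: "x = z + axis 2 (x$2 - y$2)"
    using z by (simp add: vec_eq_iff forall_2 axis_def)
  have int: "z \<in> integral_points"
    using x y z by (auto simp: integral_points_def forall_2)
  have le: "absv (x$i - y$i) \<le> 1" for i
    using x y by (intro absv_diff_le) (auto simp: integral_points_def)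
  have "absv (F x - F z) \<le> d"
    using step[OF int le[of 2], of 2] d[of 2] unfolding zx[symmetric] by linarith
  moreover have "absv (F z - F y) \<le> d"
    using step[OF y le[of 1], of 1] d[of 1] unfolding z_def[symmetric] by linarith
  ultimately show ?thesis by (rule absv_trans_le)
qed

lemma Ivec_integral:
  fixes x :: "'k^2"
  assumes l: "odd l" "\<bar>l\<bar> < int p ^ s" and s: "1 \<le> s" and x: "x \<in> integral_points"
  shows "absv (Ivec p s l x $ j) \<le> 1"
  unfolding Ivec_eq_coeff_prod[OF l s]
  by (intro gauss_leD gauss_le_mult1 gauss_le_prod gauss_le_power Qpol_integral Lam_integral x)

lemma Ivec_lipschitz:
  fixes x y :: "'k^2"
  assumes l: "odd l" "\<bar>l\<bar> < int p ^ s" and s: "2 \<le> s"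
    and x: "x \<in> integral_points" and y: "y \<in> integral_points" and d: "\<And>i. absv (x$i - y$i) \<le> d"
  shows "absv (Ivec p s l x $ j - Ivec p s l y $ j) \<le> d"
proof (rule lipschitz_from_axes[OF _ x y d])
  fix x :: "'k^2" and i and h :: 'k assume x: "x \<in> integral_points" and h: "absv h \<le> 1"
  obtain J :: "'k^2" where J: "\<And>j. absv (J $ j) \<le> 1" "\<And>h j. absv h \<le> 1 \<Longrightarrow>
      absv (Ivec p s l (x + axis i h) $ j - Ivec p s l x $ j - h * J $ j) \<le> absv (h\<^sup>2)"
    by (rule Ivec_dynamics[OF l s x, of i]) (blast intro: that)
  have "absv (h\<^sup>2) \<le> absv h" using h by (simp add: power2_eq_square absv_mult mult_left_le)
  with J(2)[OF h, of j] have "absv (Ivec p s l (x + axis i h) $ j - Ivec p s l x $ j - h * J $ j) \<le> absv h"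
    by linarith
  from absv_add_le[OF this absv_mult_le1[OF order_refl J(1)[of j], of h]]
  show "absv (Ivec p s l (x + axis i h) $ j - Ivec p s l x $ j) \<le> absv h" by simp
qed

lemma Tpol_lipschitz:
  fixes x y :: "'k^2"
  assumes x: "x \<in> integral_points" and y: "y \<in> integral_points" and d: "\<And>i. absv (x$i - y$i) \<le> d"
  shows "absv (Tpol p s l x - Tpol p s l y) \<le> d"
proof (rule lipschitz_from_axes[OF _ x y d])
  fix x :: "'k^2" and i and h :: 'k assume x: "x \<in> integral_points" and h: "absv h \<le> 1"
  let ?M = "(p ^ s - 1) div 2"
  let ?m = "monom 1 1 ^ nat ((int p ^ s - l) div 2) :: 'k poly" and ?Y = "[:- (x$other i), 1:]"
  let ?X = "[:- (x$i), 1:]" and ?X' = "[:- (x$i + h), 1:]"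
  have int: "absv (x $ j) \<le> 1" for j using x by (simp add: integral_points_def)
  have "gauss_le (absv h) (?X' ^ ?M - ?X ^ ?M)"
  proof (rule gauss_le_power_diff)
    show "gauss_le 1 ?X'" "gauss_le 1 ?X" using int h by (intro gauss_le_linear absv_add_le; simp)+
    show "gauss_le (absv h) (?X' - ?X)"
      using gauss_le_const[of "- h" "absv h"] by simp
  qed
  then have "gauss_le (absv h) (?m * (?X' ^ ?M - ?X ^ ?M) * ?Y ^ ?M)"
    by (intro gauss_le_mult1 gauss_le_mult1' gauss_le_power gauss_le_linear gauss_le_monom int) simp
  also have "?m * (?X' ^ ?M - ?X ^ ?M) * ?Y ^ ?M = Phi p s l (x + axis i h) - Phi p s l x"
    unfolding Phi_split[of p s l _ i] by (simp add: axis_def algebra_simps del: mult_pCons_left mult_pCons_right)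
  finally show "absv (Tpol p s l (x + axis i h) - Tpol p s l x) \<le> absv h"
    unfolding Tpol_def coeff_diff[symmetric] by (rule gauss_leD)
qed

lemma ex_large_exponent:
  fixes l :: int and e :: real
  assumes "0 < e"
  obtains s where "2 \<le> s" "\<bar>l\<bar> < int p ^ s" "\<bar>l + 2\<bar> < int p ^ s" "\<pi> ^ s < e"
proof -
  obtain S1 where "\<And>s. s \<ge> S1 \<Longrightarrow> \<bar>l\<bar> < int p ^ s" using ex_p_power_gt by blast
  moreover obtain S2 where "\<And>s. s \<ge> S2 \<Longrightarrow> \<bar>l + 2\<bar> < int p ^ s" using ex_p_power_gt by blast
  moreover obtain S3 where "\<And>s. s \<ge> S3 \<Longrightarrow> \<pi> ^ s < e" using ex_pi_power_less[OF assms] by blast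
  ultimately show ?thesis by (intro that[of "max (max S1 S2) (max S3 2)"]) auto
qed

text \<open>The side conditions on \<open>s\<close> are those under which the congruences for \<open>\<lambda>\<close> and
  \<open>\<lambda> + 2\<close> are available.\<close>

lemma le_all_powers_imp_0:
  fixes x :: 'k
  assumes "\<And>s. 2 \<le> s \<Longrightarrow> \<bar>l\<bar> < int p ^ s \<Longrightarrow> \<bar>l + 2\<bar> < int p ^ s \<Longrightarrow> absv x \<le> C * \<pi> ^ s"
  shows "x = 0"
proof (rule ccontr)
  assume "x \<noteq> 0"
  then have pos: "0 < absv x / (\<bar>C\<bar> + 1)" by simp
  obtain s where s: "2 \<le> s" "\<bar>l\<bar> < int p ^ s" "\<bar>l + 2\<bar> < int p ^ s" "\<pi> ^ s < absv x / (\<bar>C\<bar> + 1)"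
    using ex_large_exponent[OF pos] by blast
  have "absv x \<le> C * \<pi> ^ s" using s by (intro assms)
  also have "\<dots> \<le> (\<bar>C\<bar> + 1) * \<pi> ^ s" by (intro mult_right_mono) auto
  also have "\<dots> < absv x" using s(4) by (simp add: field_simps)
  finally show False by simp
qed

text \<open>The functions \<open>I\<^sub>s\<close> and \<open>T\<^sub>s\<close> are Lipschitz with constant 1 for every \<open>s\<close>, and
  \<open>T\<^sub>s\<close> is a unit on the domain.\<close>

lemma calI_lipschitz:
  fixes x y :: "'k^2"
  assumes l: "odd l" and x: "x \<in> Dom p l" and y: "y \<in> Dom p l"
    and d: "0 < d" "\<And>i. absv (x$i - y$i) \<le> d"
  shows "absv (calI p l x $ j - calI p l y $ j) \<le> d"
proof -
  obtain s where s: "2 \<le> s" "\<bar>l\<bar> < int p ^ s" "\<pi> ^ s < d"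
    using ex_large_exponent[OF d(1)] by metis
  let ?I = "\<lambda>x. Ivec p s l x $ j" and ?T = "\<lambda>x. Tpol p s l x"
  have T: "absv (?T x) = 1" "absv (?T y) = 1" using Tpol_unit[OF l s(2)] x y by auto
  then have nz: "?T x \<noteq> 0" "?T y \<noteq> 0" by auto
  have I: "absv (?I x - ?I y) \<le> d"
    by (rule Ivec_lipschitz[OF l s(2,1) Dom_integral[OF x] Dom_integral[OF y] d(2)])
  have T': "absv (?T y - ?T x) \<le> d"
    by (rule Tpol_lipschitz[OF Dom_integral[OF y] Dom_integral[OF x]])
       (use d(2) in \<open>simp add: absv_minus_commute\<close>)
  have Iy: "absv (?I y) \<le> 1"
    using s by (intro Ivec_integral l Dom_integral[OF y]) auto
  have "?I x / ?T x - ?I y / ?T y = ((?I x - ?I y) * ?T y + (?T y - ?T x) * ?I y) / (?T x * ?T y)"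
    using nz by (simp add: field_simps)
  also have "absv \<dots> = absv ((?I x - ?I y) * ?T y + (?T y - ?T x) * ?I y)"
    using T by (simp add: absv_divide absv_mult)
  also have "\<dots> \<le> d" using T by (intro absv_add_le absv_mult_le1 I T' Iy) simp
  finally have *: "absv (?I x / ?T x - ?I y / ?T y) \<le> d" .
  have "absv (calI p l x $ j - ?I x / ?T x) \<le> d"
    using calI_close[OF l s(2) x, of j] s by linarith
  moreover have "absv (?I y / ?T y - calI p l y $ j) \<le> d"
    using calI_close[OF l s(2) y, of j] s by (simp add: absv_minus_commute)
  ultimately show ?thesis using absv_trans_le * by blast
qed

text \<open>If \<open>p\<close> does not divide \<open>\<lambda>\<close>, the \<open>j\<close>-th component is a unit, since modulo \<open>p\<close> it
  is \<open>g\<^sub>j\<close> times a unit. If \<open>p\<close> divides \<open>\<lambda>\<close>, then \<open>\<lambda> T\<^sub>s(\<lambda> + 2)\<close> is minus the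
  sum of the components of \<open>I\<^sub>s\<close> modulo \<open>p^s\<close>; it has the norm of \<open>\<lambda>\<close>, so the
  components cannot both tend to \<open>0\<close>.\<close>

lemma calI_nonzero:
  fixes x :: "'k^2"
  assumes l: "odd l" and x: "x \<in> Dom_star p l"
  shows "calI p l x \<noteq> 0"
proof (cases "int p dvd l")
  case False
  with x obtain j where int: "x \<in> integral_points" and "absv (Gpol p j l x) = 1"
    by (auto simp: Dom_star_def Dom_star_coprime_def)
  then have G: "absv (gpol p j (digit TYPE('k) p l 0) x) * absv (Hpol p l x) = 1"
    by (simp add: Gpol_def Hpol_def absv_mult)
  have xD: "x \<in> Dom p l" using x Dom_star_subset by blast
  then have g: "absv (gpol p j (digit TYPE('k) p l 0) x) = 1" using G by (simp add: Dom_def)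
  interpret ordinary_frobenius_system p K "\<lambda>n j. Lam (digit TYPE('k) p l n) (frob j x)"
    using l xD by (rule ordinary_system)
  obtain s where s: "2 \<le> s" "\<bar>l\<bar> < int p ^ s" and small: "\<pi> ^ s < 1"
    using ex_large_exponent[OF zero_less_one] by blast
  then have s1: "1 \<le> s" by simp
  have "absv (Ivec p s l x $ j - gpol p j (digit TYPE('k) p l 0) x * chain_coeff 1 s) \<le> \<pi>"
    using dwork_leading_term[OF s1 Qpol_integral[OF int] degree_Qpol[OF digit_le[OF l]]]
    unfolding Ivec_eq_coeff_prod[OF l s(2) s1] gpol_eq_coeff_Qpol by simp
  moreover have "absv (gpol p j (digit TYPE('k) p l 0) x * chain_coeff 1 s) = 1"
    using absv_chain_coeff[OF s1] g by (simp add: absv_mult)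
  ultimately have "absv (Ivec p s l x $ j) = 1"
    using absv_eq_of_close[of "Ivec p s l x $ j"
      "gpol p j (digit TYPE('k) p l 0) x * chain_coeff 1 s"] pi_less_1 by linarith
  then have "absv (Ivec p s l x $ j / Tpol p s l x) = 1"
    using Tpol_unit[OF l s(2) xD] by (simp add: absv_divide)
  moreover have "absv (calI p l x $ j - Ivec p s l x $ j / Tpol p s l x) < 1"
    by (rule order_le_less_trans[OF calI_close[OF l s(2) xD s1] small])
  ultimately have "absv (calI p l x $ j) = 1"
    using absv_eq_of_close[of "calI p l x $ j" "Ivec p s l x $ j / Tpol p s l x"] by linarith
  then show ?thesis by auto
next
  case True
  with x have xD: "x \<in> Dom p l" and xD': "x \<in> Dom p (l + 2)"
    using Dom_star_coprime_subset[of "l + 2"] by (auto simp: Dom_star_def)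
  show ?thesis
  proof
    assume 0: "calI p l x = 0"
    have "of_int l = (0 :: 'k)"
    proof (rule le_all_powers_imp_0[of l _ 1])
      fix s :: nat assume s: "2 \<le> s" "\<bar>l\<bar> < int p ^ s" "\<bar>l + 2\<bar> < int p ^ s"
      have I: "absv (Ivec p s l x $ j) \<le> \<pi> ^ s" for j
        using calI_close[OF l s(2) xD, of j] s 0 Tpol_unit[OF l s(2) xD] by (simp add: absv_divide)
      have "absv (of_int l * Tpol p s (l + 2) x + (Ivec p s l x $ 1 + Ivec p s l x $ 2)
          - (Ivec p s l x $ 1 + Ivec p s l x $ 2)) \<le> \<pi> ^ s"
        by (intro absv_diff_le absv_add_le I Tpol_shift l s Dom_integral[OF xD])
      then show "absv (of_int l :: 'k) \<le> 1 * \<pi> ^ s"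
        using Tpol_unit[of "l + 2" s x] l s xD' by (simp add: absv_mult)
    qed
    then show False using l by simp
  qed
qed

lemma fiber_iff_wedge:
  fixes x :: "'k^2"
  assumes "odd l" "x \<in> Dom_star p l"
  shows "v \<in> fiber p (x, l) \<longleftrightarrow> wedge i v (calI p l x) = 0"
  unfolding fiber_def fst_conv snd_conv by (rule mem_span_iff_wedge[OF calI_nonzero[OF assms]])

lemma wedge_calI_close:
  fixes x :: "'k^2"
  assumes l: "odd l" "\<bar>l\<bar> < int p ^ s" and s: "1 \<le> s" and x: "x \<in> Dom p l"
    and v: "\<And>j. absv (v $ j) \<le> C"
  shows "absv (Tpol p s l x * wedge i v (calI p l x) - wedge i v (Ivec p s l x)) \<le> C * \<pi> ^ s"
proof -
  let ?T = "Tpol p s l x"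
  have T: "absv ?T = 1" by (rule Tpol_unit[OF l x])
  then have nz: "?T \<noteq> 0" by auto
  have "?T * wedge i v (calI p l x) - wedge i v (Ivec p s l x)
      = ?T * wedge i v (calI p l x - inverse ?T *s Ivec p s l x)"
    using nz by (simp add: wedge_diff_right wedge_scale_right right_diff_distrib flip: mult.assoc)
  also have "absv \<dots> = absv (wedge i v (calI p l x - inverse ?T *s Ivec p s l x))"
    using T by (simp add: absv_mult)
  also have "\<dots> \<le> C * \<pi> ^ s"
    using calI_close[OF l x s] by (intro wedge_le v) (simp add: field_class.field_divide_inverse mult.commute)
  finally show ?thesis .
qed

text \<open>The wedge product with the limit vector vanishes, and \<open>I\<^sub>s\<close> differs from a multiple of the
  limit vector by \<open>p^s\<close>.\<close>

lemma wedge_Ivec_le: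
  fixes x :: "'k^2"
  assumes l: "odd l" "\<bar>l\<bar> < int p ^ s" and s: "1 \<le> s" and x: "x \<in> Dom_star p l"
    and v: "v \<in> fiber p (x, l)" "\<And>j. absv (v $ j) \<le> C"
  shows "absv (wedge i v (Ivec p s l x)) \<le> C * \<pi> ^ s"
proof -
  have "wedge i v (calI p l x) = 0" using fiber_iff_wedge[OF l(1) x] v(1) by blast
  then show ?thesis
    using wedge_calI_close[OF l s subsetD[OF Dom_star_subset x], of v C i] v(2)
    by (simp only: mult_zero_right diff_0 absv_minus)
qed

text \<open>The converse: \<open>T\<^sub>s\<close> is a unit, so the wedge product with the limit vector is as small as
  those with \<open>I\<^sub>s\<close>. The condition on \<open>\<lambda> - 2\<close> makes the congruences for \<open>\<lambda> - 2\<close>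
  available when the line over \<open>\<lambda>\<close> is the target of the qKZ operator.\<close>

lemma fiberI_wedge_Ivec:
  fixes x :: "'k^2"
  assumes l: "odd l" and x: "x \<in> Dom_star p l"
    and small: "\<And>e. 0 < e \<Longrightarrow> \<exists>S. \<forall>s\<ge>S. 2 \<le> s \<longrightarrow> \<bar>l\<bar> < int p ^ s \<longrightarrow> \<bar>l - 2\<bar> < int p ^ s \<longrightarrow>
      absv (wedge i v (Ivec p s l x)) \<le> e"
  shows "v \<in> fiber p (x, l)"
proof -
  have xD: "x \<in> Dom p l" using x Dom_star_subset by blast
  define C where "C = max (absv (v $ 1)) (absv (v $ 2)) + 1"
  have C: "absv (v $ j) \<le> C" for j using exhaust_2[of j] by (auto simp: C_def)
  have C0: "0 < C" using order_trans[OF absv_nonneg[of "v$1"], of "max (absv (v $ 1)) (absv (v $ 2))"]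
    by (simp add: C_def)
  have "wedge i v (calI p l x) = 0"
  proof (rule ccontr)
    assume nz: "wedge i v (calI p l x) \<noteq> 0"
    define e where "e = absv (wedge i v (calI p l x)) / 2"
    have e: "0 < e" "absv (wedge i v (calI p l x)) = 2 * e" using nz by (simp_all add: e_def)
    obtain S where S: "\<And>s. s \<ge> S \<Longrightarrow> 2 \<le> s \<Longrightarrow> \<bar>l\<bar> < int p ^ s \<Longrightarrow> \<bar>l - 2\<bar> < int p ^ s \<Longrightarrow>
      absv (wedge i v (Ivec p s l x)) \<le> e"
      using small[OF e(1)] by blast
    obtain S1 where S1: "\<And>s. s \<ge> S1 \<Longrightarrow> \<bar>l\<bar> < int p ^ s" using ex_p_power_gt by blast
    obtain S2 where S2: "\<And>s. s \<ge> S2 \<Longrightarrow> \<bar>l - 2\<bar> < int p ^ s" using ex_p_power_gt by blast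
    obtain S3 where S3: "\<And>s. s \<ge> S3 \<Longrightarrow> \<pi> ^ s < e / C" using ex_pi_power_less[of "e / C"] e C0 by auto
    define s where "s = max (max S S1) (max (max S2 S3) 2)"
    have s: "s \<ge> S" "s \<ge> S1" "s \<ge> S2" "s \<ge> S3" "2 \<le> s" by (simp_all add: s_def)
    have "absv (Tpol p s l x * wedge i v (calI p l x)) \<le> e"
    proof -
      have "C * \<pi> ^ s \<le> e" using S3[OF s(4)] C0 by (simp add: field_simps)
      with wedge_calI_close[OF l S1[OF s(2)] _ xD C, of i] s(5)
      have "absv (Tpol p s l x * wedge i v (calI p l x) - wedge i v (Ivec p s l x)) \<le> e" by simp
      from absv_add_le[OF this S[OF s(1,5) S1[OF s(2)] S2[OF s(3)]]] show ?thesis by simp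
    qed
    then show False
      using Tpol_unit[OF l S1[OF s(2)] xD] e by (simp add: absv_mult)
  qed
  then show ?thesis using fiber_iff_wedge[OF l x] by blast
qed

end

section \<open>Sums of double families\<close>

lemma has_sum_absv_le:
  fixes f :: "'i \<Rightarrow> 'a::nonarchimedean_field"
  assumes "(f has_sum S) A" "\<And>i. i \<in> A \<Longrightarrow> absv (f i) \<le> B" "0 \<le> B"
  shows "absv S \<le> B"
proof (rule ccontr)
  assume "\<not> absv S \<le> B"
  then have "0 < absv S - B" by simp
  then have "\<forall>\<^sub>F X in finite_subsets_at_top A. absv (sum f X - S) < absv S - B"
    using assms(1) by (simp add: has_sum_def tendsto_absv_iff)
  moreover have "\<forall>\<^sub>F X in finite_subsets_at_top A. X \<subseteq> A"
    by (rule eventually_finite_subsets_at_top_weakI)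
  ultimately have "\<forall>\<^sub>F X in finite_subsets_at_top A. absv (sum f X - S) < absv S - B \<and> X \<subseteq> A"
    by (rule eventually_conj)
  then obtain X where X: "X \<subseteq> A" "absv (sum f X - S) < absv S - B"
    using eventually_happens'[OF finite_subsets_at_top_neq_bot] by blast
  have "absv (sum f X) \<le> B"
    using X(1) assms(2,3) by (intro absv_sum_le) auto
  moreover have "absv (sum f X) = absv S"
    using X(2) assms(3) by (intro absv_eq_of_close) linarith
  ultimately show False using \<open>\<not> absv S \<le> B\<close> by simp
qed

lemma has_sum_diff:
  fixes f g :: "'i \<Rightarrow> 'a::topological_ab_group_add"
  assumes "(f has_sum S) A" "(g has_sum T) A"
  shows "((\<lambda>i. f i - g i) has_sum (S - T)) A"
  using has_sum_add[OF assms(1), of "\<lambda>i. - g i" "- T"] assms(2) by (simp add: has_sum_uminus)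

lemma has_sum_imp_terms_bounded:
  fixes f :: "'i \<Rightarrow> 'a::nonarchimedean_field"
  assumes "(f has_sum S) A"
  shows "\<exists>B. \<forall>i\<in>A. absv (f i) \<le> B"
proof -
  have "\<forall>\<^sub>F X in finite_subsets_at_top A. absv (sum f X - S) < 1"
    using assms zero_less_one by (simp add: has_sum_def tendsto_absv_iff)
  then obtain X where X: "finite X" "X \<subseteq> A"
    "\<forall>Y. finite Y \<and> X \<subseteq> Y \<and> Y \<subseteq> A \<longrightarrow> absv (sum f Y - S) < 1"
    unfolding eventually_finite_subsets_at_top by blast
  have "absv (f i) \<le> (\<Sum>j\<in>X. absv (f j)) + 1" if i: "i \<in> A" for i
  proof (cases "i \<in> X")
    case True
    then have "absv (f i) \<le> (\<Sum>j\<in>X. absv (f j))" using X(1) by (intro member_le_sum) auto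
    then show ?thesis by simp
  next
    case False
    have 1: "absv (sum f (insert i X) - S) < 1" using X(1,2) i by (intro X(3)[rule_format]) auto
    have 2: "absv (sum f X - S) < 1" using X(1,2) by (intro X(3)[rule_format]) auto
    have "f i = (sum f (insert i X) - S) - (sum f X - S)" using False X(1) by simp
    then have "absv (f i) < 1" using absv_diff_less[OF 1 2] by simp
    moreover have "0 \<le> (\<Sum>j\<in>X. absv (f j))" by (intro sum_nonneg) simp
    ultimately show ?thesis by linarith
  qed
  then show ?thesis by blast
qed

text \<open>The sums over squares form a Cauchy sequence: by the ultrametric inequality the terms outside
  a square together contribute no more than the largest of them.\<close>

lemma geometric_bound_summable:
  fixes f :: "nat \<times> nat \<Rightarrow> 'a::nonarchimedean_field"
  assumes f: "\<And>m n. absv (f (m, n)) \<le> C * q ^ (m + n)" and q: "0 \<le> q" "q < 1"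
  shows "f summable_on UNIV"
proof -
  define T where "T = (\<lambda>N. sum f ({..<N} \<times> {..<N}))"
  have C: "0 \<le> C" using order_trans[OF absv_nonneg f[of 0 0]] by simp
  have tail: "absv (sum f Y - T N) \<le> C * q ^ N" if "finite Y" "{..<N} \<times> {..<N} \<subseteq> Y" for Y N
  proof -
    have "sum f Y - T N = sum f (Y - {..<N} \<times> {..<N})"
      unfolding T_def using that by (simp add: sum_diff)
    also have "absv \<dots> \<le> C * q ^ N"
    proof (rule absv_sum_le)
      fix i assume i: "i \<in> Y - {..<N} \<times> {..<N}"
      obtain m n where mn: "i = (m, n)" by (cases i)
      with i have "N \<le> m + n" by auto
      then have "C * q ^ (m + n) \<le> C * q ^ N"
        using q C by (intro mult_left_mono power_decreasing) auto
      then show "absv (f i) \<le> C * q ^ N" using f[of m n] mn by simp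
    qed (use C q in simp)
    finally show ?thesis .
  qed
  have lim: "(\<lambda>N. C * q ^ N) \<longlonglongrightarrow> 0"
    using tendsto_mult_right_zero[OF LIMSEQ_realpow_zero[OF q]] by simp
  have small: "\<exists>N0. \<forall>N\<ge>N0. C * q ^ N < e" if "0 < e" for e
    using order_tendstoD(2)[OF lim that] by (simp add: eventually_sequentially)
  have "Cauchy T"
    unfolding Cauchy_altdef
  proof (intro allI impI)
    fix e :: real assume "0 < e"
    then obtain N0 where N0: "\<And>N. N \<ge> N0 \<Longrightarrow> C * q ^ N < e" using small by blast
    have "dist (T m) (T n) < e" if "m \<ge> N0" "n > m" for m n
    proof -
      have "absv (T n - T m) \<le> C * q ^ m"
        using tail[of "{..<n} \<times> {..<n}" m] that(2) unfolding T_def by fastforce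
      then show ?thesis using N0[OF that(1)] by (simp add: dist_eq_absv absv_minus_commute)
    qed
    then show "\<exists>M. \<forall>m\<ge>M. \<forall>n>m. dist (T m) (T n) < e" by blast
  qed
  then obtain S where S: "T \<longlonglongrightarrow> S" using Cauchy_convergent convergent_def by blast
  have "(f has_sum S) UNIV"
    unfolding has_sum_def tendsto_absv_iff
  proof (intro allI impI)
    fix e :: real assume e: "0 < e"
    then obtain N0 where N0: "\<And>N. N \<ge> N0 \<Longrightarrow> C * q ^ N < e" using small by blast
    have "\<forall>\<^sub>F N in sequentially. absv (T N - S) < e \<and> N0 \<le> N"
      using S e eventually_ge_at_top by (intro eventually_conj) (auto simp: tendsto_absv_iff)
    then obtain N where N: "absv (T N - S) < e" "N0 \<le> N"
      using eventually_happens'[OF sequentially_bot] by blast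
    show "\<forall>\<^sub>F X in finite_subsets_at_top UNIV. absv (sum f X - S) < e"
      unfolding eventually_finite_subsets_at_top
    proof (intro exI[of _ "{..<N} \<times> {..<N}"] conjI allI impI)
      fix Y :: "(nat \<times> nat) set" assume "finite Y \<and> {..<N} \<times> {..<N} \<subseteq> Y \<and> Y \<subseteq> UNIV"
      then have "absv (sum f Y - T N) < e" using tail[of Y N] N0[OF N(2)] by linarith
      from absv_add_less[OF this N(1)] show "absv (sum f Y - S) < e" by simp
    qed auto
  qed
  then show ?thesis by (rule has_sum_imp_summable)
qed

section \<open>Double power series\<close>

definition ps_sums :: "(nat \<Rightarrow> nat \<Rightarrow> 'a::nonarchimedean_field) \<Rightarrow> 'a \<Rightarrow> 'a \<Rightarrow> 'a \<Rightarrow> bool" where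
  "ps_sums c x y S \<longleftrightarrow> ((\<lambda>(m, n). c m n * x ^ m * y ^ n) has_sum S) UNIV"

lemma ps_sums_unique: "ps_sums c x y S \<Longrightarrow> ps_sums c x y S' \<Longrightarrow> S = S'"
  unfolding ps_sums_def by (rule has_sum_unique)

lemma ps_sums_add:
  assumes "ps_sums c x y S" "ps_sums d x y T"
  shows "ps_sums (\<lambda>m n. c m n + d m n) x y (S + T)"
  using has_sum_add[OF assms[unfolded ps_sums_def]]
  by (simp add: ps_sums_def case_prod_unfold distrib_right)

lemma ps_sums_cmult:
  assumes "ps_sums c x y S"
  shows "ps_sums (\<lambda>m n. a * c m n) x y (a * S)"
  using has_sum_cmult_right[OF assms[unfolded ps_sums_def], of a]
  by (simp add: ps_sums_def case_prod_unfold mult.assoc)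

text \<open>Multiplication of a double power series by its first or second variable, on coefficients.\<close>

definition shift1 :: "(nat \<Rightarrow> nat \<Rightarrow> 'a::zero) \<Rightarrow> nat \<Rightarrow> nat \<Rightarrow> 'a" where
  "shift1 c m n = (case m of 0 \<Rightarrow> 0 | Suc m' \<Rightarrow> c m' n)"

definition shift2 :: "(nat \<Rightarrow> nat \<Rightarrow> 'a::zero) \<Rightarrow> nat \<Rightarrow> nat \<Rightarrow> 'a" where
  "shift2 c m n = (case n of 0 \<Rightarrow> 0 | Suc n' \<Rightarrow> c m n')"

lemma shift_simps [simp]:
  "shift1 c 0 n = 0" "shift1 c (Suc m) n = c m n" "shift2 c m 0 = 0" "shift2 c m (Suc n) = c m n"
  by (simp_all add: shift1_def shift2_def)

lemma has_sum_shift_Suc: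
  fixes g :: "nat \<times> 'b \<Rightarrow> 'a::{comm_monoid_add, topological_space}"
  assumes S: "((\<lambda>(m, n). g (Suc m, n)) has_sum S) UNIV" and 0: "\<And>n. g (0, n) = 0"
  shows "(g has_sum S) UNIV"
proof -
  let ?h = "\<lambda>(m, n :: 'b). (Suc m, n)"
  have inj: "inj ?h" by (auto simp: inj_def)
  have "(\<lambda>(m, n). g (Suc m, n)) = g \<circ> ?h" by (auto simp: fun_eq_iff)
  then have "(g has_sum S) (range ?h)" using S has_sum_reindex[OF inj] by metis
  also have "(g has_sum S) (range ?h) \<longleftrightarrow> (g has_sum S) UNIV"
  proof (rule has_sum_cong_neutral)
    fix i assume i: "i \<in> UNIV - range ?h"
    obtain m n where mn: "i = (m, n)" by (cases i)
    have "m = 0"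
    proof (rule ccontr)
      assume "m \<noteq> 0"
      then obtain m' where "m = Suc m'" by (cases m) auto
      then have "i = ?h (m', n)" using mn by simp
      with i show False by blast
    qed
    then show "g i = 0" using mn 0 by simp
  qed auto
  finally show ?thesis .
qed

lemma ps_sums_shift1:
  assumes "ps_sums c x y S"
  shows "ps_sums (shift1 c) x y (x * S)"
proof -
  let ?g = "\<lambda>(m, n). shift1 c m n * x ^ m * y ^ n"
  have "((\<lambda>i. x * (case i of (m, n) \<Rightarrow> c m n * x ^ m * y ^ n)) has_sum x * S) UNIV"
    using assms unfolding ps_sums_def by (rule has_sum_cmult_right)
  also have "(\<lambda>i. x * (case i of (m, n) \<Rightarrow> c m n * x ^ m * y ^ n)) = (\<lambda>(m, n). ?g (Suc m, n))"
    by (auto simp: fun_eq_iff ac_simps)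
  finally show ?thesis unfolding ps_sums_def by (rule has_sum_shift_Suc) simp
qed

lemma ps_sums_swap: "ps_sums c x y S \<longleftrightarrow> ps_sums (\<lambda>m n. c n m) y x S"
proof -
  have "(\<lambda>(m, n). c m n * x ^ m * y ^ n) = (\<lambda>(m, n). c n m * y ^ m * x ^ n) \<circ> prod.swap"
    by (auto simp: fun_eq_iff ac_simps)
  then show ?thesis
    unfolding ps_sums_def using has_sum_reindex[of prod.swap UNIV "\<lambda>(m, n). c n m * y ^ m * x ^ n" S]
    by (simp add: surj_swap)
qed

lemma ps_sums_shift2:
  assumes "ps_sums c x y S"
  shows "ps_sums (shift2 c) x y (y * S)"
proof -
  have "ps_sums (shift1 (\<lambda>m n. c n m)) y x (y * S)"
    using assms by (subst (asm) ps_sums_swap) (rule ps_sums_shift1)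
  moreover have "shift1 (\<lambda>m n. c n m) = (\<lambda>m n. shift2 c n m)"
    by (auto simp: fun_eq_iff shift1_def shift2_def)
  ultimately show ?thesis by (subst ps_sums_swap) simp
qed

lemma ps_term_le:
  assumes c: "\<And>m n. absv (c m n) \<le> C * R ^ (m + n)" and R: "0 \<le> R"
    and x: "absv x \<le> e" and y: "absv y \<le> e"
  shows "absv (c m n * x ^ m * y ^ n :: 'a::nonarchimedean_field) \<le> C * (R * e) ^ (m + n)"
proof -
  have "absv (x ^ m) \<le> e ^ m" "absv (y ^ n) \<le> e ^ n"
    using x y by (auto simp: absv_power intro!: power_mono)
  then have "absv (c m n * x ^ m * y ^ n) \<le> C * R ^ (m + n) * e ^ m * e ^ n"
    by (intro absv_mult_le c)
  then show ?thesis by (simp add: power_add power_mult_distrib ac_simps)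
qed

lemma ps_summable:
  fixes x y :: "'a::nonarchimedean_field"
  assumes c: "\<And>m n. absv (c m n) \<le> C * R ^ (m + n)" and R: "0 \<le> R"
    and x: "absv x \<le> e" and y: "absv y \<le> e" and e: "R * e < 1"
  shows "\<exists>S. ps_sums c x y S"
proof -
  have "0 \<le> e" using x absv_nonneg order_trans by blast
  then have "(\<lambda>(m, n). c m n * x ^ m * y ^ n) summable_on UNIV"
    using ps_term_le[OF c R x y] R e by (intro geometric_bound_summable[of _ C "R * e"]) auto
  then show ?thesis by (auto simp: ps_sums_def summable_on_def)
qed

section \<open>Analytic functions of two variables\<close>

definition polydisc :: "'a::nonarchimedean_field^2 \<Rightarrow> real \<Rightarrow> ('a^2) set" where
  "polydisc a e = {x. \<forall>i. absv (x$i - a$i) < e}"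

lemma polydisc_iff: "x \<in> polydisc a e \<longleftrightarrow> absv (x$1 - a$1) < e \<and> absv (x$2 - a$2) < e"
  by (simp add: polydisc_def forall_2)

lemma polydisc_mono: "d \<le> e \<Longrightarrow> polydisc a d \<subseteq> polydisc a e"
  by (auto simp: polydisc_iff)

lemma center_in_polydisc: "0 < e \<Longrightarrow> a \<in> polydisc a e"
  by (simp add: polydisc_iff)

lemma polydisc_add_axis: "x \<in> polydisc a e \<Longrightarrow> absv h < e \<Longrightarrow> x + axis i h \<in> polydisc a e"
  using absv_add_less[of "x$i - a$i" e h]
  by (auto simp: polydisc_def axis_def algebra_simps)

lemma open_contains_polydisc:
  assumes "open U" "a \<in> U"
  obtains e where "0 < e" "polydisc a e \<subseteq> U"
proof -
  obtain A where A: "\<And>i. open (A i)" "\<And>i. a $ i \<in> A i" "\<And>y. (\<forall>i. y $ i \<in> A i) \<Longrightarrow> y \<in> U"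
    using assms unfolding open_vec_def by metis
  obtain e1 where e1: "0 < e1" "\<And>y. dist y (a$1) < e1 \<Longrightarrow> y \<in> A 1"
    using A(1,2)[of 1] unfolding open_dist by blast
  obtain e2 where e2: "0 < e2" "\<And>y. dist y (a$2) < e2 \<Longrightarrow> y \<in> A 2"
    using A(1,2)[of 2] unfolding open_dist by blast
  show ?thesis
  proof (rule that[of "min e1 e2"])
    show "polydisc a (min e1 e2) \<subseteq> U"
    proof
      fix x assume "x \<in> polydisc a (min e1 e2)"
      then have "x $ 1 \<in> A 1" "x $ 2 \<in> A 2"
        using e1(2) e2(2) by (auto simp: polydisc_iff dist_eq_absv)
      then show "x \<in> U" by (intro A(3)) (simp add: forall_2)
    qed
  qed (use e1 e2 in simp)
qed

text \<open>Convergence in a polydisc is replaced by a geometric bound on the coefficients and a radius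
  inside the resulting domain of convergence; after shrinking the polydisc this is no restriction, and
  it is stable under the operations below.\<close>

definition analytic_at :: "('a::nonarchimedean_field^2 \<Rightarrow> 'a) \<Rightarrow> 'a^2 \<Rightarrow> bool" where
  "analytic_at f a \<longleftrightarrow> (\<exists>C R e c. 0 < R \<and> 0 < e \<and> R * e < 1 \<and>
     (\<forall>m n. absv (c m n) \<le> C * R ^ (m + n)) \<and>
     (\<forall>x\<in>polydisc a e. ps_sums c (x$1 - a$1) (x$2 - a$2) (f x)))"

lemma analytic_atE:
  assumes "analytic_at f a"
  obtains C R e c where "0 \<le> C" "0 < R" "0 < e" "R * e < 1"
    "\<And>m n. absv (c m n) \<le> C * R ^ (m + n)"
    "\<And>x. x \<in> polydisc a e \<Longrightarrow> ps_sums c (x$1 - a$1) (x$2 - a$2) (f x)"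
proof -
  obtain C R e c where *: "0 < R" "0 < e" "R * e < 1"
    "\<And>m n. absv (c m n) \<le> C * R ^ (m + n)"
    "\<And>x. x \<in> polydisc a e \<Longrightarrow> ps_sums c (x$1 - a$1) (x$2 - a$2) (f x)"
    using assms unfolding analytic_at_def by blast
  have "0 \<le> C" using order_trans[OF absv_nonneg *(4)[of 0 0]] by simp
  with * show ?thesis by (intro that[of C R e c])
qed

lemma analytic_atI:
  assumes e: "0 < e" and R: "0 \<le> R" and c: "\<And>m n. absv (c m n) \<le> C * R ^ (m + n)"
    and f: "\<And>x. x \<in> polydisc a e \<Longrightarrow> ps_sums c (x$1 - a$1) (x$2 - a$2) (f x)"
  shows "analytic_at f a"
proof -
  define R' where "R' = max R 1"
  define e' where "e' = min e (1 / (2 * R'))"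
  have R': "0 < R'" "R \<le> R'" by (auto simp: R'_def)
  have e': "0 < e'" "e' \<le> e" using e R' by (auto simp: e'_def)
  have "R' * e' \<le> R' * (1 / (2 * R'))" using R' by (intro mult_left_mono) (auto simp: e'_def)
  then have Re: "R' * e' < 1" using R' by simp
  have C: "0 \<le> C" using order_trans[OF absv_nonneg c[of 0 0]] by simp
  have "absv (c m n) \<le> C * R' ^ (m + n)" for m n
    by (rule order_trans[OF c]) (use R R' C in \<open>auto intro!: mult_left_mono power_mono\<close>)
  moreover have "ps_sums c (x$1 - a$1) (x$2 - a$2) (f x)" if "x \<in> polydisc a e'" for x
    using f that polydisc_mono[OF e'(2)] by blast
  ultimately show ?thesis unfolding analytic_at_def using R' e' Re by blast
qed

lemma analytic_at_cong:
  assumes f: "analytic_at f a" and e: "0 < e" "\<And>x. x \<in> polydisc a e \<Longrightarrow> f x = g x"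
  shows "analytic_at g a"
proof -
  obtain C R d c where *: "0 < R" "0 < d"
    "\<And>m n. absv (c m n) \<le> C * R ^ (m + n)"
    "\<And>x. x \<in> polydisc a d \<Longrightarrow> ps_sums c (x$1 - a$1) (x$2 - a$2) (f x)"
    using f by (rule analytic_atE) blast
  show ?thesis
  proof (rule analytic_atI[of "min d e" R c C])
    fix x assume "x \<in> polydisc a (min d e)"
    then have "x \<in> polydisc a d" "x \<in> polydisc a e" by (auto simp: polydisc_iff)
    then show "ps_sums c (x$1 - a$1) (x$2 - a$2) (g x)" using *(4) e(2) by metis
  qed (use * e in auto)
qed

lemma analytic_at_add:
  assumes "analytic_at f a" "analytic_at g a"
  shows "analytic_at (\<lambda>x. f x + g x) a"
proof -
  obtain C1 R1 e1 c where 1: "0 \<le> C1" "0 < R1" "0 < e1"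
    "\<And>m n. absv (c m n) \<le> C1 * R1 ^ (m + n)"
    "\<And>x. x \<in> polydisc a e1 \<Longrightarrow> ps_sums c (x$1 - a$1) (x$2 - a$2) (f x)"
    using assms(1) by (rule analytic_atE) blast
  obtain C2 R2 e2 d where 2: "0 \<le> C2" "0 < R2" "0 < e2"
    "\<And>m n. absv (d m n) \<le> C2 * R2 ^ (m + n)"
    "\<And>x. x \<in> polydisc a e2 \<Longrightarrow> ps_sums d (x$1 - a$1) (x$2 - a$2) (g x)"
    using assms(2) by (rule analytic_atE) blast
  define C R where "C = max C1 C2" and "R = max R1 R2"
  show ?thesis
  proof (rule analytic_atI[of "min e1 e2" R "\<lambda>m n. c m n + d m n" C])
    fix m n
    have "C1 * R1 ^ (m + n) \<le> C * R ^ (m + n)" "C2 * R2 ^ (m + n) \<le> C * R ^ (m + n)"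
      using 1(1,2) 2(1,2) by (auto simp: C_def R_def intro!: mult_mono power_mono)
    then show "absv (c m n + d m n) \<le> C * R ^ (m + n)"
      using 1(4)[of m n] 2(4)[of m n] by (intro absv_add_le) linarith+
  next
    fix x assume "x \<in> polydisc a (min e1 e2)"
    then have "x \<in> polydisc a e1" "x \<in> polydisc a e2" by (auto simp: polydisc_iff)
    then show "ps_sums (\<lambda>m n. c m n + d m n) (x$1 - a$1) (x$2 - a$2) (f x + g x)"
      by (intro ps_sums_add 1 2)
  qed (use 1 2 in \<open>auto simp: R_def\<close>)
qed

lemma analytic_at_cmult:
  assumes "analytic_at f a"
  shows "analytic_at (\<lambda>x. k * f x) a"
proof -
  obtain C R e c where *: "0 < R" "0 < e"
    "\<And>m n. absv (c m n) \<le> C * R ^ (m + n)"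
    "\<And>x. x \<in> polydisc a e \<Longrightarrow> ps_sums c (x$1 - a$1) (x$2 - a$2) (f x)"
    using assms by (rule analytic_atE) blast
  show ?thesis
  proof (rule analytic_atI[of e R "\<lambda>m n. k * c m n" "absv k * C"])
    show "absv (k * c m n) \<le> absv k * C * R ^ (m + n)" for m n
      using mult_left_mono[OF *(3)[of m n] absv_nonneg[of k]] by (simp add: absv_mult mult.assoc)
  qed (use * in \<open>auto intro: ps_sums_cmult\<close>)
qed

lemma analytic_at_diff:
  assumes "analytic_at f a" "analytic_at g a"
  shows "analytic_at (\<lambda>x. f x - g x) a"
  using analytic_at_add[OF assms(1) analytic_at_cmult[OF assms(2), of "- 1"]] by simp

lemma shift1_bound:
  fixes c :: "nat \<Rightarrow> nat \<Rightarrow> 'a::nonarchimedean_field"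
  assumes "0 < R" "0 \<le> C" "\<And>m n. absv (c m n) \<le> C * R ^ (m + n)"
  shows "absv (shift1 c m n) \<le> C / R * R ^ (m + n)"
  using assms(1,2) assms(3)[of "m - 1" n] by (cases m) auto

lemma analytic_at_mult_coord1:
  assumes "analytic_at f a"
  shows "analytic_at (\<lambda>x. x $ 1 * f x) a"
proof -
  obtain C R e c where *: "0 \<le> C" "0 < R" "0 < e"
    "\<And>m n. absv (c m n) \<le> C * R ^ (m + n)"
    "\<And>x. x \<in> polydisc a e \<Longrightarrow> ps_sums c (x$1 - a$1) (x$2 - a$2) (f x)"
    using assms by (rule analytic_atE) blast
  have "analytic_at (\<lambda>x. (x $ 1 - a $ 1) * f x) a"
  proof (rule analytic_atI[of e R "shift1 c" "C / R"])
    show "absv (shift1 c m n) \<le> C / R * R ^ (m + n)" for m n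
      by (rule shift1_bound[OF *(2,1,4)])
  qed (use * in \<open>auto intro: ps_sums_shift1\<close>)
  from analytic_at_add[OF this analytic_at_cmult[OF assms, of "a $ 1"]]
  show ?thesis by (simp add: algebra_simps)
qed

text \<open>Exchange of the coordinates, which reduces the second variable to the first.\<close>

definition swapv :: "'a^2 \<Rightarrow> 'a^2" where "swapv x = (\<chi> i. x $ other i)"

lemma swapv_nth [simp]: "swapv x $ 1 = x $ 2" "swapv x $ 2 = x $ 1"
  by (simp_all add: swapv_def)

lemma swapv_swapv [simp]: "swapv (swapv x) = x"
  by (simp add: vec_eq_iff forall_2)

lemma swapv_in_polydisc: "swapv x \<in> polydisc (swapv a) e \<longleftrightarrow> x \<in> polydisc a e"
  by (auto simp: polydisc_iff)

lemma swapv_add_axis: "swapv (x + axis i h) = swapv x + axis (other i) h"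
  using exhaust_2[of i] by (auto simp: vec_eq_iff forall_2 axis_def)

lemma analytic_at_swap:
  assumes "analytic_at f a"
  shows "analytic_at (\<lambda>x. f (swapv x)) (swapv a)"
proof -
  obtain C R e c where *: "0 < R" "0 < e"
    "\<And>m n. absv (c m n) \<le> C * R ^ (m + n)"
    "\<And>x. x \<in> polydisc a e \<Longrightarrow> ps_sums c (x$1 - a$1) (x$2 - a$2) (f x)"
    using assms by (rule analytic_atE) blast
  show ?thesis
  proof (rule analytic_atI[of e R "\<lambda>m n. c n m" C])
    show "absv (c n m) \<le> C * R ^ (m + n)" for m n using *(3)[of n m] by (simp add: add.commute)
    fix x assume "x \<in> polydisc (swapv a) e"
    then have "swapv x \<in> polydisc a e" using swapv_in_polydisc[of "swapv x" a e] by simp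
    from *(4)[OF this] have "ps_sums c (x$2 - a$2 + a$2 - a$1) (x$1 - a$2) (f (swapv x))"
      by (simp)
    then show "ps_sums (\<lambda>m n. c n m) (x$1 - swapv a$1) (x$2 - swapv a$2) (f (swapv x))"
      by (subst ps_sums_swap) simp
  qed (use * in auto)
qed

lemma analytic_at_mult_coord:
  assumes "analytic_at f a"
  shows "analytic_at (\<lambda>x. x $ i * f x) a"
proof -
  have "analytic_at (\<lambda>x. x $ 2 * f x) a"
    using analytic_at_swap[OF analytic_at_mult_coord1[OF analytic_at_swap[OF assms]]] by simp
  then show ?thesis using analytic_at_mult_coord1[OF assms] exhaust_2[of i] by auto
qed

lemma analytic_at_continuous:
  assumes "analytic_at f a" "0 < \<epsilon>"
  obtains d where "0 < d" "\<And>x. x \<in> polydisc a d \<Longrightarrow> absv (f x - f a) < \<epsilon>"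
proof -
  obtain C R e c where *: "0 \<le> C" "0 < R" "0 < e" "R * e < 1"
    "\<And>m n. absv (c m n) \<le> C * R ^ (m + n)"
    "\<And>x. x \<in> polydisc a e \<Longrightarrow> ps_sums c (x$1 - a$1) (x$2 - a$2) (f x)"
    using assms(1) by (rule analytic_atE) blast
  define d where "d = min e (\<epsilon> / (2 * (C * R + 1)))"
  have CR: "0 < C * R + 1" using *(1,2) by (simp add: add_nonneg_pos)
  have d: "0 < d" "d \<le> e" "d \<le> \<epsilon> / (2 * (C * R + 1))" using *(3) assms(2) CR by (auto simp: d_def)
  have "d * (2 * (C * R + 1)) \<le> \<epsilon>" using d(3) CR by (simp add: pos_le_divide_eq)
  moreover have "d * (2 * (C * R + 1)) = 2 * (C * R * d) + 2 * d" by (simp add: algebra_simps)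
  moreover have "0 \<le> C * R * d" using *(1,2) d(1) by simp
  ultimately have small: "C * R * d < \<epsilon>" using d(1) by linarith
  have Rd: "0 \<le> R * d" "R * d \<le> 1"
    using *(2,4) d(1) mult_left_mono[OF d(2), of R] by (simp, linarith)
  show ?thesis
  proof (rule that[OF d(1)])
    fix x assume x: "x \<in> polydisc a d"
    let ?X = "x$1 - a$1" and ?Y = "x$2 - a$2"
    have xe: "x \<in> polydisc a e" using x polydisc_mono[OF d(2)] by blast
    have "ps_sums c 0 0 (f a)" using *(6)[OF center_in_polydisc[OF *(3)]] by simp
    from has_sum_diff[OF *(6)[OF xe, unfolded ps_sums_def] this[unfolded ps_sums_def]]
    have "((\<lambda>i. (case i of (m, n) \<Rightarrow> c m n * ?X ^ m * ?Y ^ n) - (case i of (m, n) \<Rightarrow> c m n * 0 ^ m * 0 ^ n))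
        has_sum (f x - f a)) UNIV" .
    then have "absv (f x - f a) \<le> C * R * d"
    proof (rule has_sum_absv_le)
      fix i :: "nat \<times> nat"
      obtain m n where mn: "i = (m, n)" by (cases i)
      show "absv ((case i of (m, n) \<Rightarrow> c m n * ?X ^ m * ?Y ^ n) - (case i of (m, n) \<Rightarrow> c m n * 0 ^ m * 0 ^ n))
          \<le> C * R * d"
      proof (cases "m + n")
        case 0
        then show ?thesis using mn *(1,2) d(1) by simp
      next
        case (Suc k)
        have "absv (c m n * ?X ^ m * ?Y ^ n) \<le> C * (R * d) ^ (m + n)"
          using x *(2) by (intro ps_term_le *(5)) (auto simp: polydisc_iff)
        also have "\<dots> \<le> C * (R * d)"
          unfolding Suc using Rd *(1) by (intro mult_left_mono) (auto simp: mult_left_le power_le_one)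
        finally show ?thesis using mn Suc by (cases m; cases n) (auto simp: mult.assoc)
      qed
    qed (use * d in auto)
    then show "absv (f x - f a) < \<epsilon>" using small by linarith
  qed
qed

lemma analytic_at_of_coeffs:
  fixes a :: "'a::nonarchimedean_field^2"
  assumes c: "\<And>m n. absv (c m n) \<le> C * R ^ (m + n)" and "0 < R" "0 < e" "R * e < 1"
  obtains g where "analytic_at g a"
    "\<And>x. x \<in> polydisc a e \<Longrightarrow> ps_sums c (x$1 - a$1) (x$2 - a$2) (g x)"
proof -
  define g where "g = (\<lambda>x :: 'a^2. THE S. ps_sums c (x$1 - a$1) (x$2 - a$2) S)"
  have g: "ps_sums c (x$1 - a$1) (x$2 - a$2) (g x)" if x: "x \<in> polydisc a e" for x
  proof -
    have "\<exists>S. ps_sums c (x$1 - a$1) (x$2 - a$2) S"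
      using x assms(2,4) by (intro ps_summable[OF c, of _ e]) (auto simp: polydisc_iff)
    then have "\<exists>!S. ps_sums c (x$1 - a$1) (x$2 - a$2) S" using ps_sums_unique by blast
    then show ?thesis unfolding g_def by (rule theI')
  qed
  have "analytic_at g a"
    by (rule analytic_atI[OF assms(3) _ c g]) (use assms(2) in auto)
  then show ?thesis using g by (rule that)
qed

text \<open>Termwise differentiation: the quadratic remainder of each monomial is bounded
  geometrically, so the remainder of the sum is quadratic as well.\<close>

lemma power_taylor_absv:
  fixes x h :: "'a::nonarchimedean_field"
  assumes x: "absv x \<le> e" and h: "absv h \<le> e" and e: "0 < e"
  shows "absv ((x + h) ^ m - x ^ m - of_nat m * h * x ^ (m - 1)) \<le> absv (h\<^sup>2) * (e ^ m / e\<^sup>2)"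
proof (induction m)
  case (Suc m)
  define D where "D = (x + h) ^ m - x ^ m - of_nat m * h * x ^ (m - 1)"
  have "(x + h) ^ Suc m - x ^ Suc m - of_nat (Suc m) * h * x ^ (Suc m - 1)
      = (x + h) * D + h\<^sup>2 * (of_nat m * x ^ (m - 1))"
    by (cases m) (simp_all add: D_def algebra_simps power2_eq_square)
  moreover have "absv ((x + h) * D) \<le> e * (absv (h\<^sup>2) * (e ^ m / e\<^sup>2))"
    using Suc x h unfolding D_def by (intro absv_mult_le absv_add_le)
  moreover have "absv (h\<^sup>2 * (of_nat m * x ^ (m - 1))) \<le> absv (h\<^sup>2) * (e ^ Suc m / e\<^sup>2)"
  proof (cases m)
    case (Suc k)
    have "absv (x ^ k) \<le> e ^ k" using x by (simp add: absv_power power_mono)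
    moreover have "e ^ Suc m / e\<^sup>2 = e ^ k" using e Suc by (simp add: power2_eq_square)
    moreover have "m - 1 = k" using Suc by simp
    ultimately have "absv (of_nat m * x ^ (m - 1)) \<le> e ^ Suc m / e\<^sup>2"
      by (simp only: absv_mult_le1' absv_of_nat_le_1)
    then show ?thesis unfolding absv_mult[of "h\<^sup>2"] by (intro mult_left_mono) auto
  qed (use e in simp)
  ultimately show ?case by (auto intro!: absv_add_le simp: ac_simps)
qed (use e in simp)

lemma analytic_at_partial1:
  assumes "analytic_at f a"
  obtains g e B where "analytic_at g a" "0 < e" "0 \<le> B"
    "\<And>x h. x \<in> polydisc a e \<Longrightarrow> absv h < e \<Longrightarrow>
      absv (f (x + axis 1 h) - f x - h * g x) \<le> B * absv (h\<^sup>2)"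
proof -
  obtain C R e c where *: "0 \<le> C" "0 < R" "0 < e" "R * e < 1"
    "\<And>m n. absv (c m n) \<le> C * R ^ (m + n)"
    "\<And>x. x \<in> polydisc a e \<Longrightarrow> ps_sums c (x$1 - a$1) (x$2 - a$2) (f x)"
    using assms by (rule analytic_atE) blast
  define c' where "c' = (\<lambda>m n. of_nat (Suc m) * c (Suc m) n)"
  have c': "absv (c' m n) \<le> (C * R) * R ^ (m + n)" for m n
    using absv_mult_le1'[OF absv_of_nat_le_1 *(5)[of "Suc m" n], of "Suc m"]
    by (simp add: c'_def ac_simps del: of_nat_Suc)
  obtain g where ga: "analytic_at g a"
    and g: "\<And>x. x \<in> polydisc a e \<Longrightarrow> ps_sums c' (x$1 - a$1) (x$2 - a$2) (g x)"
    using analytic_at_of_coeffs[OF c' *(2-4), of a] by blast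
  show ?thesis
  proof (rule that[of g e "C / e\<^sup>2"])
    show "analytic_at g a" by (rule ga)
    fix x :: "'a^2" and h :: 'a assume x: "x \<in> polydisc a e" and h: "absv h < e"
    let ?X = "x$1 - a$1" and ?Y = "x$2 - a$2"
    have "((\<lambda>(m, n). of_nat m * h * c m n * ?X ^ (m - 1) * ?Y ^ n) has_sum h * g x) UNIV"
    proof -
      let ?g = "\<lambda>(m, n). of_nat m * h * c m n * ?X ^ (m - 1) * ?Y ^ n"
      have "((\<lambda>i. h * (case i of (m, n) \<Rightarrow> c' m n * ?X ^ m * ?Y ^ n)) has_sum h * g x) UNIV"
        using g[OF x] unfolding ps_sums_def by (rule has_sum_cmult_right)
      also have "(\<lambda>i. h * (case i of (m, n) \<Rightarrow> c' m n * ?X ^ m * ?Y ^ n)) = (\<lambda>(m, n). ?g (Suc m, n))"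
        by (auto simp: fun_eq_iff c'_def ac_simps)
      finally show ?thesis by (rule has_sum_shift_Suc) simp
    qed
    moreover have "ps_sums c (?X + h) ?Y (f (x + axis 1 h))"
      using *(6)[OF polydisc_add_axis[OF x h, of 1]] by (simp add: axis_def algebra_simps)
    ultimately have "((\<lambda>i. (case i of (m, n) \<Rightarrow> c m n * (?X + h) ^ m * ?Y ^ n)
        - (case i of (m, n) \<Rightarrow> c m n * ?X ^ m * ?Y ^ n)
        - (case i of (m, n) \<Rightarrow> of_nat m * h * c m n * ?X ^ (m - 1) * ?Y ^ n))
        has_sum (f (x + axis 1 h) - f x - h * g x)) UNIV"
      using *(6)[OF x] unfolding ps_sums_def by (intro has_sum_diff)
    then show "absv (f (x + axis 1 h) - f x - h * g x) \<le> C / e\<^sup>2 * absv (h\<^sup>2)"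
    proof (rule has_sum_absv_le)
      fix i :: "nat \<times> nat"
      obtain m n where mn: "i = (m, n)" by (cases i)
      let ?D = "(?X + h) ^ m - ?X ^ m - of_nat m * h * ?X ^ (m - 1)"
      have X: "absv ?X \<le> e" "absv ?Y \<le> e" using x by (auto simp: polydisc_iff)
      have Yn: "absv (?Y ^ n) \<le> e ^ n" using X by (simp add: absv_power power_mono)
      have "absv (c m n * ?D * ?Y ^ n) \<le> C * R ^ (m + n) * (absv (h\<^sup>2) * (e ^ m / e\<^sup>2)) * e ^ n"
        using h *(3) by (intro absv_mult_le *(5) power_taylor_absv X Yn) auto
      also have "\<dots> = C / e\<^sup>2 * absv (h\<^sup>2) * (R * e) ^ (m + n)"
        by (simp add: power_add power_mult_distrib ac_simps)
      also have "\<dots> \<le> C / e\<^sup>2 * absv (h\<^sup>2) * 1"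
        using *(1-4) by (intro mult_left_mono power_le_one) auto
      finally show "absv ((case i of (m, n) \<Rightarrow> c m n * (?X + h) ^ m * ?Y ^ n)
        - (case i of (m, n) \<Rightarrow> c m n * ?X ^ m * ?Y ^ n)
        - (case i of (m, n) \<Rightarrow> of_nat m * h * c m n * ?X ^ (m - 1) * ?Y ^ n)) \<le> C / e\<^sup>2 * absv (h\<^sup>2)"
        by (simp add: mn algebra_simps)
    qed (use *(1,3) in simp)
  qed (use *(1,3) in auto)
qed

section \<open>Division by a linear form\<close>

text \<open>Coefficients of the quotient of \<open>\<Sum> c\<^sub>m\<^sub>n x^m y^n\<close> by \<open>x - \<theta> y\<close>, up to a
  remainder in \<open>y\<close> alone, and by \<open>\<delta> + x - \<theta> y\<close> for \<open>\<delta> \<noteq> 0\<close>. Both are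
  found by comparing coefficients, and the recursions show that geometric bounds persist.\<close>

fun quot_coeff :: "(nat \<Rightarrow> nat \<Rightarrow> 'a::comm_ring) \<Rightarrow> 'a \<Rightarrow> nat \<Rightarrow> nat \<Rightarrow> 'a" where
  "quot_coeff c \<theta> m 0 = c (Suc m) 0"
| "quot_coeff c \<theta> m (Suc n) = c (Suc m) (Suc n) + \<theta> * quot_coeff c \<theta> (Suc m) n"

fun unit_quot_coeff :: "(nat \<Rightarrow> nat \<Rightarrow> 'a::field) \<Rightarrow> 'a \<Rightarrow> 'a \<Rightarrow> nat \<Rightarrow> nat \<Rightarrow> 'a" where
  "unit_quot_coeff c \<delta> \<theta> 0 0 = c 0 0 / \<delta>"
| "unit_quot_coeff c \<delta> \<theta> (Suc m) 0 = (c (Suc m) 0 - unit_quot_coeff c \<delta> \<theta> m 0) / \<delta>"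
| "unit_quot_coeff c \<delta> \<theta> 0 (Suc n) = (c 0 (Suc n) + \<theta> * unit_quot_coeff c \<delta> \<theta> 0 n) / \<delta>"
| "unit_quot_coeff c \<delta> \<theta> (Suc m) (Suc n) =
    (c (Suc m) (Suc n) - unit_quot_coeff c \<delta> \<theta> m (Suc n) + \<theta> * unit_quot_coeff c \<delta> \<theta> (Suc m) n) / \<delta>"

lemma quot_coeff_bound:
  fixes c :: "nat \<Rightarrow> nat \<Rightarrow> 'a::nonarchimedean_field"
  assumes c: "\<And>m n. absv (c m n) \<le> C * R ^ (m + n)" and \<theta>: "absv \<theta> \<le> 1"
  shows "absv (quot_coeff c \<theta> m n) \<le> C * R * R ^ (m + n)"
proof (induction n arbitrary: m)
  case 0
  then show ?case using c[of "Suc m" 0] by (simp add: ac_simps)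
next
  case (Suc n)
  have "absv (c (Suc m) (Suc n)) \<le> C * R * R ^ (m + Suc n)"
    using c[of "Suc m" "Suc n"] by (simp add: ac_simps)
  moreover have "absv (\<theta> * quot_coeff c \<theta> (Suc m) n) \<le> C * R * R ^ (m + Suc n)"
    using absv_mult_le1'[OF \<theta> Suc[of "Suc m"]] by simp
  ultimately show ?case unfolding quot_coeff.simps by (rule absv_add_le)
qed

lemma unit_quot_coeff_eq:
  "unit_quot_coeff c \<delta> \<theta> m n
    = (c m n - shift1 (unit_quot_coeff c \<delta> \<theta>) m n + \<theta> * shift2 (unit_quot_coeff c \<delta> \<theta>) m n) / \<delta>"
  by (cases m; cases n) simp_all

lemma unit_quot_coeff_bound:
  fixes c :: "nat \<Rightarrow> nat \<Rightarrow> 'a::nonarchimedean_field"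
  assumes c: "\<And>m n. absv (c m n) \<le> C * R ^ (m + n)" and \<theta>: "absv \<theta> \<le> 1"
    and \<delta>: "\<delta> \<noteq> 0" and R: "1 / absv \<delta> \<le> R" and C: "0 \<le> C"
  shows "absv (unit_quot_coeff c \<delta> \<theta> m n) \<le> C / absv \<delta> * R ^ (m + n)"
proof -
  have R0: "0 \<le> R" using R \<delta> by (meson absv_nonneg divide_nonneg_nonneg order_trans zero_le_one)
  have step: "C / absv \<delta> * R ^ k \<le> C * R ^ Suc k" for k
  proof -
    have "C * R ^ k * (1 / absv \<delta>) \<le> C * R ^ k * R" using R R0 C by (intro mult_left_mono) auto
    then show ?thesis by (simp add: ac_simps)
  qed
  have div: "absv (u / \<delta>) \<le> C / absv \<delta> * R ^ k" if "absv u \<le> C * R ^ k" for u k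
    using divide_right_mono[OF that, of "absv \<delta>"] by (simp add: absv_divide)
  have prev: "absv u \<le> C * R ^ Suc k" if "absv u \<le> C / absv \<delta> * R ^ k" for u :: 'a and k
    using that step[of k] by linarith
  let ?u = "unit_quot_coeff c \<delta> \<theta>"
  show ?thesis
  proof (induction "m + n" arbitrary: m n rule: less_induct)
    case less
    have "absv (shift1 ?u m n) \<le> C * R ^ (m + n)"
    proof (cases m)
      case (Suc k)
      then show ?thesis using prev[OF less[of k n]] by simp
    qed (use R0 C in simp)
    moreover have "absv (\<theta> * shift2 ?u m n) \<le> C * R ^ (m + n)"
    proof (cases n)
      case (Suc k)
      then show ?thesis using absv_mult_le1'[OF \<theta> prev[OF less[of m k]]] by simp
    qed (use R0 C in simp)
    ultimately have "absv (c m n - shift1 ?u m n + \<theta> * shift2 ?u m n) \<le> C * R ^ (m + n)"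
      by (intro absv_add_le absv_diff_le c)
    then show ?case unfolding unit_quot_coeff_eq[of c \<delta> \<theta> m n] by (rule div)
  qed
qed

text \<open>Division with remainder by \<open>x - \<theta> y\<close> as in the Weierstrass division theorem. The remainder
  depends on \<open>y\<close> only, so it can be computed on the line \<open>x = \<theta> y\<close>, where it vanishes. Away
  from the line the form is a unit.\<close>

lemma analytic_at_divide_linear:
  fixes a :: "'a::nonarchimedean_field^2"
  assumes F: "analytic_at F a" and \<theta>: "absv \<theta> \<le> 1" and r: "0 < r"
    and vanish: "\<And>x. x \<in> polydisc a r \<Longrightarrow> x$1 = \<theta> * x$2 \<Longrightarrow> F x = 0"
  obtains Q e where "analytic_at Q a" "0 < e" "\<And>x. x \<in> polydisc a e \<Longrightarrow> (x$1 - \<theta> * x$2) * Q x = F x"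
proof -
  obtain C R e c where *: "0 \<le> C" "0 < R" "0 < e" "R * e < 1"
    "\<And>m n. absv (c m n) \<le> C * R ^ (m + n)"
    "\<And>x. x \<in> polydisc a e \<Longrightarrow> ps_sums c (x$1 - a$1) (x$2 - a$2) (F x)"
    using F by (rule analytic_atE) blast
  define \<delta> where "\<delta> = a$1 - \<theta> * a$2"
  show ?thesis
  proof (cases "\<delta> = 0")
    case True
    obtain Q where Q: "analytic_at Q a"
      "\<And>x. x \<in> polydisc a e \<Longrightarrow> ps_sums (quot_coeff c \<theta>) (x$1 - a$1) (x$2 - a$2) (Q x)"
      using analytic_at_of_coeffs[OF quot_coeff_bound[OF *(5) \<theta>] *(2-4), of a] by blast
    define rest where "rest = (\<lambda>(m::nat) n. if m = 0 then c 0 n + \<theta> * shift2 (quot_coeff c \<theta>) 0 n else 0)"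
    have rest: "ps_sums rest (x$1 - a$1) (x$2 - a$2) (F x - (x$1 - \<theta> * x$2) * Q x)"
      if x: "x \<in> polydisc a e" for x
    proof -
      let ?q = "quot_coeff c \<theta>" and ?X = "x$1 - a$1" and ?Y = "x$2 - a$2"
      have "ps_sums (\<lambda>m n. c m n + ((- 1) * shift1 ?q m n + \<theta> * shift2 ?q m n)) ?X ?Y
          (F x + ((- 1) * (?X * Q x) + \<theta> * (?Y * Q x)))"
        by (intro ps_sums_add ps_sums_cmult ps_sums_shift1 ps_sums_shift2 Q(2) *(6) x)
      moreover have "(\<lambda>m n. c m n + ((- 1) * shift1 ?q m n + \<theta> * shift2 ?q m n)) = rest"
      proof (intro ext)
        fix m n show "c m n + ((- 1) * shift1 ?q m n + \<theta> * shift2 ?q m n) = rest m n"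
          by (cases m; cases n) (simp_all add: rest_def)
      qed
      moreover have "F x + ((- 1) * (?X * Q x) + \<theta> * (?Y * Q x)) = F x - (x$1 - \<theta> * x$2) * Q x"
        using True by (simp add: \<delta>_def algebra_simps)
      ultimately show ?thesis by simp
    qed
    show ?thesis
    proof (rule that[OF Q(1)])
      show "0 < min e r" using *(3) r by simp
      fix x assume x: "x \<in> polydisc a (min e r)"
      \<comment> \<open>the point on the line with the same second coordinate as \<open>x\<close>\<close>
      define x' :: "'a^2" where "x' = (\<chi> i. if i = 1 then \<theta> * x$2 else x$2)"
      have x'_nth: "x'$1 = \<theta> * x$2" "x'$2 = x$2" by (simp_all add: x'_def)
      have "x'$1 - a$1 = \<theta> * (x$2 - a$2)" using True by (simp add: x'_nth \<delta>_def algebra_simps)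
      moreover have "absv (\<theta> * (x$2 - a$2)) \<le> absv (x$2 - a$2)"
        by (rule absv_mult_le1'[OF \<theta> order_refl])
      ultimately have x': "x' \<in> polydisc a e" "x' \<in> polydisc a r"
        using x by (auto simp: polydisc_iff x'_nth)
      have xe: "x \<in> polydisc a e" using x by (auto simp: polydisc_iff)
      have "F x' - (x'$1 - \<theta> * x'$2) * Q x' = 0"
        using vanish[OF x'(2)] by (simp add: x'_nth)
      with rest[OF x'(1)] have "ps_sums rest (x'$1 - a$1) (x'$2 - a$2) 0" by simp
      moreover have "ps_sums rest (x'$1 - a$1) (x'$2 - a$2) (F x - (x$1 - \<theta> * x$2) * Q x)"
      proof -
        have "(\<lambda>(m, n). rest m n * (x'$1 - a$1) ^ m * (x'$2 - a$2) ^ n)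
            = (\<lambda>(m, n). rest m n * (x$1 - a$1) ^ m * (x$2 - a$2) ^ n)"
          by (auto simp: fun_eq_iff rest_def x'_nth)
        then show ?thesis using rest[OF xe] by (simp add: ps_sums_def)
      qed
      ultimately show "(x$1 - \<theta> * x$2) * Q x = F x"
        using ps_sums_unique by fastforce
    qed
  next
    case False
    let ?u = "unit_quot_coeff c \<delta> \<theta>"
    define R' where "R' = max R (1 / absv \<delta>)"
    define e' where "e' = min e (1 / (2 * R'))"
    have R': "0 < R'" "R \<le> R'" "1 / absv \<delta> \<le> R'" using *(2) by (auto simp: R'_def)
    have e': "0 < e'" "e' \<le> e" using *(3) R'(1) by (auto simp: e'_def)
    have "R' * e' \<le> R' * (1 / (2 * R'))" using R'(1) by (intro mult_left_mono) (auto simp: e'_def)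
    then have Re': "R' * e' < 1" using R'(1) by simp
    have c: "absv (c m n) \<le> C * R' ^ (m + n)" for m n
      by (rule order_trans[OF *(5)]) (use *(1,2) R'(2) in \<open>auto intro!: mult_left_mono power_mono\<close>)
    obtain Q where Q: "analytic_at Q a"
      "\<And>x. x \<in> polydisc a e' \<Longrightarrow> ps_sums ?u (x$1 - a$1) (x$2 - a$2) (Q x)"
      using analytic_at_of_coeffs[OF unit_quot_coeff_bound[OF c \<theta> False R'(3) *(1)] R'(1) e'(1) Re', of a]
      by blast
    show ?thesis
    proof (rule that[OF Q(1) e'(1)])
      fix x assume x: "x \<in> polydisc a e'"
      then have xe: "x \<in> polydisc a e" using polydisc_mono[OF e'(2)] by blast
      let ?X = "x$1 - a$1" and ?Y = "x$2 - a$2"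
      have "ps_sums (\<lambda>m n. \<delta> * ?u m n + (shift1 ?u m n + (- \<theta>) * shift2 ?u m n)) ?X ?Y
          (\<delta> * Q x + (?X * Q x + (- \<theta>) * (?Y * Q x)))"
        by (intro ps_sums_add ps_sums_cmult ps_sums_shift1 ps_sums_shift2 Q(2) x)
      moreover have "(\<lambda>m n. \<delta> * ?u m n + (shift1 ?u m n + (- \<theta>) * shift2 ?u m n)) = c"
      proof (intro ext)
        fix m n
        show "\<delta> * ?u m n + (shift1 ?u m n + (- \<theta>) * shift2 ?u m n) = c m n"
          unfolding unit_quot_coeff_eq[of c \<delta> \<theta> m n] using False by simp
      qed
      ultimately have "ps_sums c ?X ?Y (\<delta> * Q x + (?X * Q x + (- \<theta>) * (?Y * Q x)))" by simp
      from ps_sums_unique[OF this *(6)[OF xe]]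
      show "(x$1 - \<theta> * x$2) * Q x = F x"
        by (simp add: \<delta>_def algebra_simps)
    qed
  qed
qed

section \<open>Analytic functions on open sets\<close>

lemma analytic_fun_onI:
  assumes "\<And>a. a \<in> U \<Longrightarrow> analytic_at f a"
  shows "analytic_fun_on f U"
  unfolding analytic_fun_on_def
proof
  fix a assume "a \<in> U"
  then obtain e c where e: "0 < e"
    "\<And>x. x \<in> polydisc a e \<Longrightarrow> ps_sums c (x$1 - a$1) (x$2 - a$2) (f x)"
    using assms[of a] unfolding analytic_at_def by blast
  show "\<exists>e>0. \<exists>c. \<forall>x\<in>U. (\<forall>i. absv (x$i - a$i) < e) \<longrightarrow>
      ((\<lambda>n. c n * (x$1 - a$1) ^ fst n * (x$2 - a$2) ^ snd n) has_sum f x) UNIV"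
    using e by (intro exI[of _ e] conjI exI[of _ "\<lambda>n. c (fst n) (snd n)"])
      (auto simp: polydisc_def ps_sums_def case_prod_unfold)
qed

context residue_char
begin

lemma ex_small:
  assumes "0 < e"
  obtains h :: 'k where "h \<noteq> 0" "absv h < e"
proof -
  obtain S where "\<pi> ^ S < e" using ex_pi_power_less[OF assms] by blast
  then show ?thesis
    by (intro that[of "of_nat p ^ S"]) (auto simp: absv_power \<pi>_def)
qed

lemma at_zero_neq_bot: "at (0::'k) \<noteq> bot"
proof
  assume "at (0::'k) = bot"
  then have "eventually (\<lambda>_. False) (at (0::'k))" by simp
  then obtain d where d: "0 < d" "\<And>x::'k. x \<noteq> 0 \<Longrightarrow> dist x 0 < d \<Longrightarrow> False"
    by (auto simp: eventually_at)
  obtain h :: 'k where "h \<noteq> 0" "absv h < d" using ex_small[OF d(1)] .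
  then show False using d(2) by (simp add: dist_eq_absv)
qed

text \<open>Convergence at the single point \<open>a + (h, h)\<close> bounds the terms there, which is a geometric
  bound on the coefficients.\<close>

lemma analytic_fun_onD:
  fixes f :: "'k^2 \<Rightarrow> 'k"
  assumes f: "analytic_fun_on f U" and U: "open U" and a: "a \<in> U"
  shows "analytic_at f a"
proof -
  obtain e and c :: "nat \<times> nat \<Rightarrow> 'k" where e: "0 < e" and c: "\<And>x. x \<in> U \<Longrightarrow> (\<forall>i. absv (x$i - a$i) < e) \<Longrightarrow>
      ((\<lambda>n. c n * (x$1 - a$1) ^ fst n * (x$2 - a$2) ^ snd n) has_sum f x) UNIV"
    using f a unfolding analytic_fun_on_def by blast
  obtain e1 where e1: "0 < e1" "polydisc a e1 \<subseteq> U" using open_contains_polydisc[OF U a] .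
  obtain h :: 'k where h: "h \<noteq> 0" "absv h < min e e1" using ex_small[of "min e e1"] e e1 by auto
  define b where "b = a + axis 1 h + axis 2 h"
  have b: "b $ 1 - a $ 1 = h" "b $ 2 - a $ 2 = h" by (simp_all add: b_def axis_def)
  then have "b \<in> U" using e1 h by (auto simp: polydisc_iff)
  moreover have "\<forall>i. absv (b $ i - a $ i) < e" using b h by (simp add: forall_2)
  ultimately have "((\<lambda>n. c n * h ^ fst n * h ^ snd n) has_sum f b) UNIV"
    using c[of b] b by simp
  then obtain B where B: "\<And>n. absv (c n * h ^ fst n * h ^ snd n) \<le> B"
    using has_sum_imp_terms_bounded by blast
  show ?thesis
  proof (rule analytic_atI[of "min e e1" "1 / absv h" "\<lambda>m n. c (m, n)" B])
    fix m n
    have "absv (c (m, n)) * absv h ^ (m + n) \<le> B"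
      using B[of "(m, n)"] by (simp add: absv_mult absv_power power_add mult.assoc)
    then show "absv (c (m, n)) \<le> B * (1 / absv h) ^ (m + n)"
      using h(1) by (simp add: power_one_over pos_le_divide_eq field_simps)
  next
    fix x assume x: "x \<in> polydisc a (min e e1)"
    then have "x \<in> U" using e1 by (auto simp: polydisc_iff)
    then show "ps_sums (\<lambda>m n. c (m, n)) (x$1 - a$1) (x$2 - a$2) (f x)"
      using c[of x] x by (simp add: ps_sums_def case_prod_unfold polydisc_def)
  qed (use e e1 in auto)
qed

lemma tendsto_of_quadratic_bound:
  fixes f :: "'k \<Rightarrow> 'k"
  assumes e: "0 < e" and f: "\<And>h. absv h < e \<Longrightarrow> absv (f h - f 0 - h * g) \<le> B * absv (h\<^sup>2)" and B: "0 \<le> B"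
  shows "((\<lambda>h. (f h - f 0) / h) \<longlongrightarrow> g) (at 0)"
  unfolding tendsto_absv_iff
proof (intro allI impI)
  fix \<epsilon> :: real assume "0 < \<epsilon>"
  define d where "d = min e (\<epsilon> / (B + 1))"
  have d: "0 < d" "d \<le> e" "d * (B + 1) \<le> \<epsilon>"
  proof -
    have "d \<le> \<epsilon> / (B + 1)" by (simp add: d_def)
    then show "d * (B + 1) \<le> \<epsilon>" using B by (simp add: pos_le_divide_eq)
  qed (use e B \<open>0 < \<epsilon>\<close> in \<open>auto simp: d_def\<close>)
  have "absv ((f h - f 0) / h - g) < \<epsilon>" if h: "h \<noteq> 0" "absv h < d" for h
  proof -
    have "(f h - f 0) / h - g = (f h - f 0 - h * g) / h" using h by (simp add: field_simps)
    then have "absv ((f h - f 0) / h - g) = absv (f h - f 0 - h * g) / absv h"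
      by (simp add: absv_divide)
    also have "\<dots> \<le> B * absv (h\<^sup>2) / absv h"
      using f[of h] h d by (intro divide_right_mono) auto
    also have "\<dots> = B * absv h" using h by (simp add: absv_mult power2_eq_square)
    also have "\<dots> \<le> B * d" using B h by (intro mult_left_mono) auto
    also have "\<dots> < \<epsilon>" using d by (simp add: algebra_simps)
    finally show ?thesis .
  qed
  then show "\<forall>\<^sub>F h in at 0. absv ((f h - f 0) / h - g) < \<epsilon>"
    unfolding eventually_at using d(1) by (intro exI[of _ d]) (auto simp: dist_eq_absv)
qed

lemma analytic_at_has_partial1:
  fixes f :: "'k^2 \<Rightarrow> 'k"
  assumes "analytic_at f a"
  obtains g e where "analytic_at g a" "0 < e"
    "\<And>x. x \<in> polydisc a e \<Longrightarrow> ((\<lambda>h. (f (x + axis 1 h) - f x) / h) \<longlongrightarrow> g x) (at 0)"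
    "\<And>x. x \<in> polydisc a e \<Longrightarrow> ((\<lambda>h. f (x + axis 1 h)) \<longlongrightarrow> f x) (at 0)"
proof -
  obtain g B e where g: "analytic_at g a" "0 < e" "0 \<le> B"
    "\<And>x h. x \<in> polydisc a e \<Longrightarrow> absv h < e \<Longrightarrow>
      absv (f (x + axis 1 h) - f x - h * g x) \<le> B * absv (h\<^sup>2)"
    by (fact analytic_at_partial1[OF assms])
  have ax0: "axis i 0 = (0 :: 'k^2)" for i by (simp add: vec_eq_iff axis_def)
  have d: "((\<lambda>h. (f (x + axis 1 h) - f x) / h) \<longlongrightarrow> g x) (at 0)" if "x \<in> polydisc a e" for x
    using tendsto_of_quadratic_bound[of e "\<lambda>h. f (x + axis 1 h)" "g x" B] g(2,3) g(4)[OF that]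
    by (simp add: ax0)
  moreover have "((\<lambda>h. f (x + axis 1 h)) \<longlongrightarrow> f x) (at 0)" if x: "x \<in> polydisc a e" for x
  proof -
    have id: "((\<lambda>h::'k. h) \<longlongrightarrow> 0) (at 0)" by (rule tendsto_ident_at)
    have "((\<lambda>h. h * ((f (x + axis 1 h) - f x) / h) + f x) \<longlongrightarrow> 0 * g x + f x) (at 0)"
      by (intro tendsto_add tendsto_mult id d[OF x] tendsto_const)
    then have "((\<lambda>h. h * ((f (x + axis 1 h) - f x) / h) + f x) \<longlongrightarrow> f x) (at 0)" by simp
    moreover have "\<forall>\<^sub>F h in at 0. h * ((f (x + axis 1 h) - f x) / h) + f x = f (x + axis 1 h)"
      unfolding eventually_at by (intro exI[of _ 1]) auto
    ultimately show ?thesis using tendsto_cong by force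
  qed
  ultimately show ?thesis using that[OF g(1,2)] by blast
qed

lemma analytic_at_has_partial:
  fixes f :: "'k^2 \<Rightarrow> 'k"
  assumes "analytic_at f a"
  obtains g e where "analytic_at g a" "0 < e"
    "\<And>x. x \<in> polydisc a e \<Longrightarrow> ((\<lambda>h. (f (x + axis i h) - f x) / h) \<longlongrightarrow> g x) (at 0)"
proof -
  consider "i = 1" | "i = 2" using exhaust_2[of i] by blast
  then show ?thesis
  proof cases
    assume i: "i = 1"
    obtain g e where g: "analytic_at g a" "0 < e"
      "\<And>x. x \<in> polydisc a e \<Longrightarrow> ((\<lambda>h. (f (x + axis 1 h) - f x) / h) \<longlongrightarrow> g x) (at 0)"
      "\<And>x. x \<in> polydisc a e \<Longrightarrow> ((\<lambda>h. f (x + axis 1 h)) \<longlongrightarrow> f x) (at 0)"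
      by (fact analytic_at_has_partial1[OF assms])
    show ?thesis by (rule that[of g e]) (use g i in simp_all)
  next
    assume i: "i = 2"
    obtain g e where g: "analytic_at g (swapv a)" "0 < e"
      "\<And>x. x \<in> polydisc (swapv a) e \<Longrightarrow>
        ((\<lambda>h. (f (swapv (x + axis 1 h)) - f (swapv x)) / h) \<longlongrightarrow> g x) (at 0)"
      "\<And>x. x \<in> polydisc (swapv a) e \<Longrightarrow> ((\<lambda>h. f (swapv (x + axis 1 h))) \<longlongrightarrow> f (swapv x)) (at 0)"
      by (fact analytic_at_has_partial1[OF analytic_at_swap[OF assms]])
    show ?thesis
    proof (rule that[of "\<lambda>x. g (swapv x)" e])
      show "analytic_at (\<lambda>x. g (swapv x)) a" using analytic_at_swap[OF g(1)] by simp
      show "((\<lambda>h. (f (x + axis i h) - f x) / h) \<longlongrightarrow> g (swapv x)) (at 0)" if "x \<in> polydisc a e" for x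
        using g(3)[of "swapv x"] that by (simp add: swapv_in_polydisc swapv_add_axis i)
    qed (rule g(2))
  qed
qed

lemma analytic_fun_on_partial:
  fixes s :: "'k^2 \<Rightarrow> 'k^2"
  assumes U: "open U" and s: "\<And>j. analytic_fun_on (\<lambda>a. s a $ j) U"
  shows "analytic_fun_on (\<lambda>a. partial i s a $ j) U"
    and "a \<in> U \<Longrightarrow> ((\<lambda>h. (s (a + axis i h) $ j - s a $ j) / h) \<longlongrightarrow> partial i s a $ j) (at 0)"
proof -
  have ex: "\<exists>g e. analytic_at g a \<and> 0 < e \<and> (\<forall>x\<in>polydisc a e. g x = partial i s x $ j \<and>
      ((\<lambda>h. (s (x + axis i h) $ j - s x $ j) / h) \<longlongrightarrow> g x) (at 0))" if a: "a \<in> U" for a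
  proof -
    obtain g e where g: "analytic_at g a" "0 < e"
      "\<And>x. x \<in> polydisc a e \<Longrightarrow> ((\<lambda>h. (s (x + axis i h) $ j - s x $ j) / h) \<longlongrightarrow> g x) (at 0)"
      by (fact analytic_at_has_partial[OF analytic_fun_onD[OF s U a]])
    have "partial i s x $ j = g x" if "x \<in> polydisc a e" for x
      using tendsto_Lim[OF at_zero_neq_bot g(3)[OF that]] by (simp add: partial_def)
    then show ?thesis using g by (intro exI[of _ g] exI[of _ e]) auto
  qed
  show "analytic_fun_on (\<lambda>a. partial i s a $ j) U"
  proof (rule analytic_fun_onI)
    fix a assume "a \<in> U"
    from ex[OF this] obtain g e where g: "analytic_at g a" "0 < e"
      "\<forall>x\<in>polydisc a e. g x = partial i s x $ j" by blast
    then show "analytic_at (\<lambda>a. partial i s a $ j) a" by (intro analytic_at_cong[OF g(1,2)]) simp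
  qed
  show "((\<lambda>h. (s (a + axis i h) $ j - s a $ j) / h) \<longlongrightarrow> partial i s a $ j) (at 0)" if "a \<in> U"
  proof -
    from ex[OF that] obtain g e where g: "0 < e" "\<forall>x\<in>polydisc a e. g x = partial i s x $ j \<and>
      ((\<lambda>h. (s (x + axis i h) $ j - s x $ j) / h) \<longlongrightarrow> g x) (at 0)" by blast
    from g(2)[rule_format, OF center_in_polydisc[OF g(1)]] show ?thesis
      by (elim conjE) (simp only:)
  qed
qed

text \<open>The local quotients agree where the linear form does not vanish, and on its zero locus they
  are the partial derivative of \<open>F\<close> in the direction \<open>z\<^sub>1\<close>. So they are restrictions of one
  function.\<close>

lemma analytic_fun_on_divide_linear:
  fixes F :: "'k^2 \<Rightarrow> 'k"
  assumes U: "open U" and F: "analytic_fun_on F U" and \<theta>: "absv \<theta> \<le> 1"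
    and vanish: "\<And>x. x \<in> U \<Longrightarrow> x$1 = \<theta> * x$2 \<Longrightarrow> F x = 0"
  obtains Q where "analytic_fun_on Q U" "\<And>x. x \<in> U \<Longrightarrow> (x$1 - \<theta> * x$2) * Q x = F x"
proof -
  define Q where "Q = (\<lambda>x. if x$1 - \<theta> * x$2 = 0 then Lim (at 0) (\<lambda>h. F (x + axis 1 h) / h)
    else F x / (x$1 - \<theta> * x$2))"
  have "analytic_at Q a" if a: "a \<in> U" for a
  proof -
    obtain r where r: "0 < r" "polydisc a r \<subseteq> U" using open_contains_polydisc[OF U a] .
    obtain q e where q: "analytic_at q a" "0 < e"
      "\<And>x. x \<in> polydisc a e \<Longrightarrow> (x$1 - \<theta> * x$2) * q x = F x"
      using analytic_at_divide_linear[OF analytic_fun_onD[OF F U a] \<theta> r(1)] vanish r(2) by blast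
    obtain g e' where "analytic_at g a" and e': "0 < e'"
      "\<And>x. x \<in> polydisc a e' \<Longrightarrow> ((\<lambda>h. (q (x + axis 1 h) - q x) / h) \<longlongrightarrow> g x) (at 0)"
      "\<And>x. x \<in> polydisc a e' \<Longrightarrow> ((\<lambda>h. q (x + axis 1 h)) \<longlongrightarrow> q x) (at 0)"
      by (fact analytic_at_has_partial1[OF q(1)])
    show ?thesis
    proof (rule analytic_at_cong[OF q(1)])
      show "0 < min e e'" using q e' by simp
      fix x assume x: "x \<in> polydisc a (min e e')"
      then have xe: "x \<in> polydisc a e" "x \<in> polydisc a e'" by (auto simp: polydisc_iff)
      show "q x = Q x"
      proof (cases "x$1 - \<theta> * x$2 = 0")
        case True
        have "\<forall>\<^sub>F h in at 0. q (x + axis 1 h) = F (x + axis 1 h) / h"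
          unfolding eventually_at
        proof (intro exI[of _ e] conjI ballI impI q(2))
          fix h :: 'k assume h: "h \<noteq> 0 \<and> dist h 0 < e"
          then have "x + axis 1 h \<in> polydisc a e"
            by (intro polydisc_add_axis xe) (simp add: dist_eq_absv)
          from q(3)[OF this] have "h * q (x + axis 1 h) = F (x + axis 1 h)"
            using True by (simp add: axis_def algebra_simps)
          then show "q (x + axis 1 h) = F (x + axis 1 h) / h"
            using h by (simp add: field_simps)
        qed
        from tendsto_cong[OF this] e'(3)[OF xe(2)]
        have "((\<lambda>h. F (x + axis 1 h) / h) \<longlongrightarrow> q x) (at 0)" by blast
        from tendsto_Lim[OF at_zero_neq_bot this] show ?thesis using True by (simp add: Q_def)
      next
        case False
        then show ?thesis using q(3)[OF xe(1)] by (simp add: Q_def field_simps)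
      qed
    qed
  qed
  then have "analytic_fun_on Q U" by (rule analytic_fun_onI)
  moreover have "(x$1 - \<theta> * x$2) * Q x = F x" if "x \<in> U" for x
    using vanish[OF that] by (auto simp: Q_def)
  ultimately show ?thesis by (rule that)
qed

end

section \<open>Invariance of the line at single points\<close>

context residue_char
begin

lemma vec_bound:
  fixes v :: "'k^2"
  obtains B where "1 \<le> B" "\<And>j. absv (v $ j) \<le> B"
proof (rule that[of "max (max (absv (v$1)) (absv (v$2))) 1"])
  show "absv (v $ j) \<le> max (max (absv (v$1)) (absv (v$2))) 1" for j
    using exhaust_2[of j] by auto
qed simp

text \<open>Here \<open>u\<close> is the partial derivative of the section and \<open>q\<close> the quotient of the difference
  of its components by that of the coordinates, so \<open>v\<close> is the value of the dynamical operator.\<close>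

lemma dynamics_pointwise:
  fixes a u v :: "'k^2" and s :: "'k^2 \<Rightarrow> 'k^2"
  assumes l: "odd l" and a: "a \<in> Dom_star p l" and r: "0 < r"
    and sec: "\<And>h. absv h < r \<Longrightarrow> a + axis i h \<in> Dom_star p l \<and> s (a + axis i h) \<in> fiber p (a + axis i h, l)"
    and u: "\<And>j. ((\<lambda>h. (s (a + axis i h) $ j - s a $ j) / h) \<longlongrightarrow> u $ j) (at 0)"
    and neq: "a $ i \<noteq> a $ other i"
    and q: "(a $ i - a $ other i) * q = s a $ i - s a $ other i"
    and v1: "v $ i = 2 * a $ i * u $ i + (of_int l + 1) * s a $ i + s a $ other i + a $ i * q"
    and v2: "v $ other i = 2 * a $ i * u $ other i - a $ i * q"
  shows "v \<in> fiber p (a, l)"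
proof (rule fiberI_wedge_Ivec[where i = i, OF l a])
  fix e :: real assume e: "0 < e"
  have aD: "a \<in> Dom p l" using a Dom_star_subset by blast
  note ai = Dom_integral[OF aD]
  have ai1: "absv (a $ i) \<le> 1" using ai by (simp add: integral_points_def)
  have ax0: "axis i 0 = (0 :: 'k^2)" by (simp add: vec_eq_iff axis_def)
  have sa: "s a \<in> fiber p (a, l)" using sec[of 0] r by (simp add: ax0)
  obtain B1 where B1: "1 \<le> B1" "\<And>j. absv (s a $ j) \<le> B1" using vec_bound[of "s a"] by blast
  obtain B2 where B2: "1 \<le> B2" "\<And>j. absv (u $ j) \<le> B2" using vec_bound[of u] by blast
  define B where "B = max B1 B2"
  have B: "1 \<le> B" "absv (s a $ j) \<le> B" "absv (u $ j) \<le> B" for j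
    using B1(1) B1(2)[of j] B2(2)[of j] by (auto simp: B_def)
  let ?quot = "\<lambda>h j. (s (a + axis i h) $ j - s a $ j) / h"
  have "\<forall>\<^sub>F h in at 0. absv (?quot h i - u $ i) < e \<and> absv (?quot h (other i) - u $ other i) < e"
    using u[unfolded tendsto_absv_iff] e by (intro eventually_conj) blast+
  then obtain d where d: "0 < d" "\<And>h. h \<noteq> 0 \<Longrightarrow> absv h < d \<Longrightarrow>
      absv (?quot h i - u $ i) < e \<and> absv (?quot h (other i) - u $ other i) < e"
    by (auto simp: eventually_at dist_eq_absv)
  have "0 < min (min d r) (min 1 (e / B))" using d(1) r e B(1) by simp
  then obtain h :: 'k where h: "h \<noteq> 0" "absv h < min (min d r) (min 1 (e / B))"
    using ex_small by blast
  have h_lt: "absv h < d" "absv h < r" "absv h \<le> 1" "B * absv h \<le> e"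
    using h(2) B(1) by (auto simp: field_simps)
  define a' where "a' = a + axis i h"
  have a': "a' \<in> Dom_star p l" "s a' \<in> fiber p (a', l)" using sec[OF h_lt(2)] by (simp_all add: a'_def)
  then have a'D: "a' \<in> Dom p l" using Dom_star_subset by blast
  obtain B' where B': "1 \<le> B'" "\<And>j. absv (s a' $ j) \<le> B'" using vec_bound[of "s a'"] by blast
  define \<eta> where "\<eta> = inverse h *s (s a' - s a) - u"
  have \<eta>: "absv (\<eta> $ j) \<le> e" for j
    using d(2)[OF h(1) h_lt(1)] eq_or_other[of j i]
    by (auto simp: \<eta>_def a'_def field_class.field_divide_inverse mult.commute right_diff_distrib)
  have s': "s a' = s a + h *s u + h *s \<eta>"
    using h(1) by (simp add: \<eta>_def vec_eq_iff algebra_simps)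
  define \<delta> where "\<delta> = a $ i - a $ other i"
  have \<delta>: "\<delta> \<noteq> 0" using neq by (simp add: \<delta>_def)
  \<comment> \<open>The step \<open>h\<close> has been fixed before \<open>n\<close>; now \<open>n\<close> is chosen large in terms of \<open>h\<close>.\<close>
  define M where "M = max B B' * (1 + 1 / absv h + 1 / absv \<delta>)"
  have M0: "0 < M" using B(1) h(1) \<delta> by (auto simp: M_def intro!: mult_pos_pos add_pos_pos)
  obtain S where S: "\<And>n. n \<ge> S \<Longrightarrow> \<pi> ^ n < e / M" using ex_pi_power_less[of "e / M"] e M0 by auto
  show "\<exists>S. \<forall>n\<ge>S. 2 \<le> n \<longrightarrow> \<bar>l\<bar> < int p ^ n \<longrightarrow> \<bar>l - 2\<bar> < int p ^ n \<longrightarrow>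
      absv (wedge i v (Ivec p n l a)) \<le> e"
  proof (intro exI[of _ S] allI impI)
    fix n assume n: "S \<le> n" "2 \<le> n" "\<bar>l\<bar> < int p ^ n"
    then have n1: "1 \<le> n" by simp
    let ?I = "Ivec p n l a" and ?I' = "Ivec p n l a'"
    have Mn: "M * \<pi> ^ n \<le> e" using S[OF n(1)] M0 by (simp add: field_simps)
    have small: "max B B' * \<pi> ^ n \<le> e" "max B B' * \<pi> ^ n / absv h \<le> e" "max B B' * \<pi> ^ n / absv \<delta> \<le> e"
    proof -
      have "0 \<le> max B B' * \<pi> ^ n" using B(1) by simp
      then have pos: "0 \<le> max B B' * \<pi> ^ n / absv h" "0 \<le> max B B' * \<pi> ^ n / absv \<delta>" "0 \<le> max B B' * \<pi> ^ n"
        by simp_all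
      have "M * \<pi> ^ n = max B B' * \<pi> ^ n + max B B' * \<pi> ^ n / absv h + max B B' * \<pi> ^ n / absv \<delta>"
        by (simp add: M_def algebra_simps)
      with Mn pos show "max B B' * \<pi> ^ n \<le> e" "max B B' * \<pi> ^ n / absv h \<le> e" "max B B' * \<pi> ^ n / absv \<delta> \<le> e"
        by linarith+
    qed
    have small1: "B * \<pi> ^ n \<le> e" "B * \<pi> ^ n / absv h \<le> e" "B * \<pi> ^ n / absv \<delta> \<le> e"
      "B' * \<pi> ^ n / absv h \<le> e"
    proof -
      have le: "B * \<pi> ^ n \<le> max B B' * \<pi> ^ n" "B' * \<pi> ^ n \<le> max B B' * \<pi> ^ n"
        by (intro mult_right_mono; simp)+
      show "B * \<pi> ^ n \<le> e" using le small by linarith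
      show "B * \<pi> ^ n / absv h \<le> e" using divide_right_mono[OF le(1) absv_nonneg[of h]] small by linarith
      show "B * \<pi> ^ n / absv \<delta> \<le> e" using divide_right_mono[OF le(1) absv_nonneg[of \<delta>]] small by linarith
      show "B' * \<pi> ^ n / absv h \<le> e" using divide_right_mono[OF le(2) absv_nonneg[of h]] small by linarith
    qed
    obtain E and J :: "'k^2" where EJ: "absv E \<le> 1" "\<And>j. absv (J $ j) \<le> 1"
      "(a$i - a$other i) * E = ?I $ i - ?I $ other i"
      "absv (2 * a$i * J$i + (of_int l + 1) * ?I $ i + ?I $ other i + a$i * E) \<le> \<pi> ^ n"
      "absv (2 * a$i * J$other i - a$i * E) \<le> \<pi> ^ n"
      "\<And>h j. absv h \<le> 1 \<Longrightarrow>
        absv (Ivec p n l (a + axis i h) $ j - ?I $ j - h * J $ j) \<le> absv (h\<^sup>2)"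
      by (fact Ivec_dynamics[OF l n(3,2) ai, of i])
    have w: "absv (wedge i (s a) ?I) \<le> B * \<pi> ^ n"
      by (rule wedge_Ivec_le[OF l n(3) n1 a sa B(2)])
    have w': "absv (wedge i (s a') ?I') \<le> B' * \<pi> ^ n"
      by (rule wedge_Ivec_le[OF l n(3) n1 a' B'(2)])
    define J' where "J' = inverse h *s (?I' - ?I)"
    have I': "?I' = ?I + h *s J'" using h(1) by (simp add: J'_def vec_eq_iff)
    have J': "absv ((J' - J) $ j) \<le> absv h" for j
    proof -
      have "h * (J' - J) $ j = ?I' $ j - ?I $ j - h * J $ j" by (simp add: I' algebra_simps)
      then have "absv h * absv ((J' - J) $ j) \<le> absv h * absv h"
        using EJ(6)[OF h_lt(3), of j] by (simp add: a'_def power2_eq_square flip: absv_mult)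
      then show ?thesis using h(1) by simp
    qed
    have diff: "absv ((?I' - ?I) $ j) \<le> absv h" for j
    proof -
      have "J' $ j = (J' - J) $ j + J $ j" by simp
      also have "absv \<dots> \<le> 1" using J'[of j] h_lt(3) by (intro absv_add_le EJ(2)) linarith
      finally show ?thesis by (simp add: I' absv_mult_le1)
    qed
    \<comment> \<open>The derivative of the wedge product of \<open>s\<close> and \<open>I\<^sub>s\<close> is small: compare it with the
      difference quotient for the step \<open>h\<close>.\<close>
    have X: "absv (wedge i u ?I + wedge i (s a) J) \<le> e"
    proof -
      have "h * (wedge i u ?I + wedge i (s a) J) = h * (wedge i (s a') ?I' / h - wedge i (s a) ?I / h
          - wedge i u (?I' - ?I) - wedge i \<eta> ?I' - wedge i (s a) (J' - J))"
        using h(1) unfolding s' I'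
        by (simp add: wedge_add_left wedge_add_right wedge_diff_right wedge_scale_left
            wedge_scale_right field_simps)
      then have "wedge i u ?I + wedge i (s a) J = wedge i (s a') ?I' / h - wedge i (s a) ?I / h
          - wedge i u (?I' - ?I) - wedge i \<eta> ?I' - wedge i (s a) (J' - J)"
        using h(1) by simp
      also have "absv \<dots> \<le> e"
      proof (intro absv_diff_le)
        show "absv (wedge i (s a') ?I' / h) \<le> e"
          using divide_right_mono[OF w' absv_nonneg[of h]] small1 by (simp add: absv_divide)
        show "absv (wedge i (s a) ?I / h) \<le> e"
          using divide_right_mono[OF w absv_nonneg[of h]] small1 by (simp add: absv_divide)
        show "absv (wedge i u (?I' - ?I)) \<le> e"
          using wedge_le[of u B "?I' - ?I" "absv h" i] B(3) diff h_lt(4) by fastforce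
        show "absv (wedge i \<eta> ?I') \<le> e"
          using wedge_le[of \<eta> e ?I' 1 i] \<eta> Ivec_integral[OF l n(3) n1 Dom_integral[OF a'D]] by simp
        show "absv (wedge i (s a) (J' - J)) \<le> e"
          using wedge_le[of "s a" B "J' - J" "absv h" i] B(2) J' h_lt(4) by fastforce
      qed
      finally show ?thesis .
    qed
    let ?\<epsilon>1 = "2 * a$i * J$i + (of_int l + 1) * ?I $ i + ?I $ other i + a$i * E"
    let ?\<epsilon>2 = "2 * a$i * J$other i - a$i * E"
    let ?W = "wedge i (s a) ?I"
    have "\<delta> * (q * (?I $ other i + ?I $ i) - E * (s a $ i + s a $ other i)) = 2 * ?W"
    proof -
      have "\<delta> * (q * (?I $ other i + ?I $ i) - E * (s a $ i + s a $ other i))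
          = (\<delta> * q) * (?I $ other i + ?I $ i) - (\<delta> * E) * (s a $ i + s a $ other i)"
        by (simp add: algebra_simps)
      also have "\<dots> = 2 * ?W"
        unfolding \<delta>_def q EJ(3) by (simp add: wedge_def algebra_simps)
      finally show ?thesis .
    qed
    then have qE: "q * (?I $ other i + ?I $ i) - E * (s a $ i + s a $ other i) = 2 * ?W / \<delta>"
      using \<delta> by (simp add: field_simps)
    \<comment> \<open>The product rule, with the modular equations for \<open>J\<close> inserted; \<open>?\<epsilon>1\<close> and \<open>?\<epsilon>2\<close> are their errors.\<close>
    have "wedge i v ?I = 2 * a$i * (wedge i u ?I + wedge i (s a) J)
        - s a $ i * ?\<epsilon>2 + s a $ other i * ?\<epsilon>1 + (of_int l + 1) * ?W
        + a$i * (q * (?I $ other i + ?I $ i) - E * (s a $ i + s a $ other i))"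
      by (simp add: wedge_def v1 v2 algebra_simps)
    also have "absv \<dots> \<le> e"
      unfolding qE
    proof (intro absv_add_le absv_diff_le)
      have "absv (2 * a $ i) \<le> 1" by (intro absv_mult_le1 ai1) simp
      then show "absv (2 * a$i * (wedge i u ?I + wedge i (s a) J)) \<le> e"
        using X by (rule absv_mult_le1')
      show "absv (s a $ i * ?\<epsilon>2) \<le> e"
        by (rule order_trans[OF absv_mult_le[OF B(2) EJ(5)] small1(1)])
      show "absv (s a $ other i * ?\<epsilon>1) \<le> e"
        by (rule order_trans[OF absv_mult_le[OF B(2) EJ(4)] small1(1)])
      have "absv (of_int l + 1 :: 'k) \<le> 1" by (intro absv_add_le absv_of_int_le_1) simp
      then show "absv ((of_int l + 1) * ?W) \<le> e"
        by (rule absv_mult_le1'[OF _ order_trans[OF w small1(1)]])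
      have "absv (2 * ?W) \<le> B * \<pi> ^ n" by (rule absv_mult_le1'[OF absv_two_le_1 w])
      from divide_right_mono[OF this absv_nonneg[of \<delta>]]
      have "absv (2 * ?W / \<delta>) \<le> e" using small1(3) by (simp add: absv_divide)
      then show "absv (a$i * (2 * ?W / \<delta>)) \<le> e" by (rule absv_mult_le1'[OF ai1])
    qed
    finally show "absv (wedge i v ?I) \<le> e" .
  qed
qed

text \<open>The shifted vector is the qKZ matrix applied to \<open>I\<^sub>s\<close>, modulo \<open>p^s\<close>, so the wedge product is
  the determinant of that matrix times the old one. All denominators are collected in \<open>D\<close>.\<close>

lemma qKZ_pointwise:
  fixes a u v :: "'k^2"
  assumes l: "odd l" and a: "a \<in> Dom_star p l" "a \<in> Dom_star p (l + 2)"
    and v: "v \<in> fiber p (a, l)" and nz: "a $ 1 \<noteq> 0" "a $ 2 \<noteq> 0"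
    and u: "\<And>j. a $ j * of_int l * u $ j = (of_int l + 1) * v $ j + v $ other j"
  shows "u \<in> fiber p (a, l + 2)"
proof (rule fiberI_wedge_Ivec[where i = 1, OF _ a(2)])
  show "odd (l + 2)" using l by simp
  fix e :: real assume e: "0 < e"
  have ai: "a \<in> integral_points" using a(1) Dom_star_subset Dom_integral by blast
  obtain B where B: "1 \<le> B" "\<And>j. absv (v $ j) \<le> B" using vec_bound[of v] by blast
  define D where "D = (a $ 1 * of_int l) * (a $ 2 * of_int l :: 'k)"
  have l0: "of_int l \<noteq> (0 :: 'k)" using l by auto
  have D: "D \<noteq> 0" using nz l0 by (simp add: D_def)
  obtain S where S: "\<And>n. n \<ge> S \<Longrightarrow> \<pi> ^ n < e * absv D / B"
    using ex_pi_power_less[of "e * absv D / B"] e D B(1) by auto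
  show "\<exists>S. \<forall>n\<ge>S. 2 \<le> n \<longrightarrow> \<bar>l + 2\<bar> < int p ^ n \<longrightarrow> \<bar>l + 2 - 2\<bar> < int p ^ n \<longrightarrow>
      absv (wedge 1 u (Ivec p n (l + 2) a)) \<le> e"
  proof (intro exI[of _ S] allI impI)
    fix n assume n: "S \<le> n" "2 \<le> n" "\<bar>l + 2 - 2\<bar> < int p ^ n"
    then have n3: "\<bar>l\<bar> < int p ^ n" and n1: "1 \<le> n" by simp_all
    let ?I = "Ivec p n l a" and ?I' = "Ivec p n (l + 2) a" and ?T' = "Tpol p n (l + 2) a"
    let ?\<epsilon> = "of_int l * ?T' + (?I $ 1 + ?I $ 2)"
    have \<epsilon>: "absv ?\<epsilon> \<le> \<pi> ^ n" by (rule Tpol_shift[OF l n3 n(2) ai])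
    have w: "absv (wedge 1 v ?I) \<le> B * \<pi> ^ n"
      by (rule wedge_Ivec_le[OF l n3 n1 a(1) v B(2)])
    have I': "a $ 1 * ?I' $ 1 = ?I $ 1 - ?T'" "a $ 2 * ?I' $ 2 = ?I $ 2 - ?T'"
      by (rule Ivec_shift[OF l n3 n(2)])+
    have "D * wedge 1 u ?I' = (a $ 1 * of_int l * u $ 1) * (of_int l * (a $ 2 * ?I' $ 2))
        - (a $ 2 * of_int l * u $ 2) * (of_int l * (a $ 1 * ?I' $ 1))"
      by (simp add: D_def wedge_def algebra_simps)
    also have "\<dots> = (of_int l + 2) * of_int l * wedge 1 v ?I - (of_int l * (v $ 1 - v $ 2)) * ?\<epsilon>"
      unfolding u I' by (simp add: wedge_def algebra_simps)
    also have "absv \<dots> \<le> B * \<pi> ^ n"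
    proof (intro absv_diff_le)
      have "absv (of_int l + 2 :: 'k) \<le> 1" by (intro absv_add_le absv_of_int_le_1) simp
      then have "absv ((of_int l + 2) * of_int l :: 'k) \<le> 1" by (intro absv_mult_le1 absv_of_int_le_1)
      then show "absv ((of_int l + 2) * of_int l * wedge 1 v ?I) \<le> B * \<pi> ^ n"
        using w by (rule absv_mult_le1')
      have "absv (of_int l * (v $ 1 - v $ 2)) \<le> B"
        by (intro absv_mult_le1' absv_of_int_le_1 absv_diff_le B(2))
      then show "absv ((of_int l * (v $ 1 - v $ 2)) * ?\<epsilon>) \<le> B * \<pi> ^ n"
        using \<epsilon> by (rule absv_mult_le)
    qed
    also have "B * \<pi> ^ n \<le> e * absv D" using S[OF n(1)] B(1) by (simp add: field_simps)
    finally show "absv (wedge 1 u ?I') \<le> e" using D by (simp add: absv_mult mult.commute)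
  qed
qed

text \<open>On the axis \<open>z\<^sub>j = 0\<close> the \<open>j\<close>-th component of \<open>I\<^sub>s\<close> equals \<open>T\<^sub>s(\<lambda> + 2)\<close>. This
  relation makes the qKZ operator regular there.\<close>

lemma calI_on_axis:
  fixes a :: "'k^2"
  assumes l: "odd l" and a: "a \<in> Dom p l" and zero: "a $ j = 0"
  shows "(of_int l + 1) * calI p l a $ j + calI p l a $ other j = 0"
proof (rule le_all_powers_imp_0[of l _ 1])
  fix n :: nat assume n: "2 \<le> n" "\<bar>l\<bar> < int p ^ n"
  then have n1: "1 \<le> n" by simp
  let ?I = "Ivec p n l a" and ?T = "Tpol p n l a" and ?T' = "Tpol p n (l + 2) a"
  have T: "absv ?T = 1" by (rule Tpol_unit[OF l n(2) a])
  have "?I $ j = ?T'" using Ivec_shift[OF l n(2,1), of a j] zero by simp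
  then have "(of_int l + 1) * ?I $ j + ?I $ other j = of_int l * ?T' + (?I $ 1 + ?I $ 2)"
    using exhaust_2[of j] by (auto simp: algebra_simps)
  then have "absv ((of_int l + 1) * ?I $ j + ?I $ other j) \<le> \<pi> ^ n"
    using Tpol_shift[OF l n(2,1) Dom_integral[OF a]] by simp
  then have 1: "absv (((of_int l + 1) * ?I $ j + ?I $ other j) / ?T) \<le> \<pi> ^ n"
    using T by (simp add: absv_divide)
  have close: "absv (calI p l a $ k - ?I $ k / ?T) \<le> \<pi> ^ n" for k
    by (rule calI_close[OF l n(2) a n1])
  have l1: "absv (of_int l + 1 :: 'k) \<le> 1" by (intro absv_add_le absv_of_int_le_1) simp
  have "absv ((of_int l + 1) * (calI p l a $ j - ?I $ j / ?T)
      + (calI p l a $ other j - ?I $ other j / ?T)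
      + ((of_int l + 1) * ?I $ j + ?I $ other j) / ?T) \<le> \<pi> ^ n"
    by (intro absv_add_le absv_mult_le1'[OF l1 close] close 1)
  then show "absv ((of_int l + 1) * calI p l a $ j + calI p l a $ other j) \<le> 1 * \<pi> ^ n"
    by (simp add: algebra_simps add_divide_distrib)
qed

text \<open>The two components of \<open>I\<^sub>s\<close> are the same coefficient when \<open>z\<^sub>1 = z\<^sub>2\<close>.\<close>

lemma calI_on_diagonal:
  fixes a :: "'k^2"
  assumes l: "odd l" and a: "a \<in> Dom p l" and eq: "a $ 1 = a $ 2"
  shows "calI p l a $ 1 = calI p l a $ 2"
proof -
  have "calI p l a $ 1 - calI p l a $ 2 = 0"
  proof (rule le_all_powers_imp_0[of l _ 1])
    fix n :: nat assume n: "2 \<le> n" "\<bar>l\<bar> < int p ^ n"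
    then have n1: "1 \<le> n" by simp
    have "Ivec p n l a $ 1 = Ivec p n l a $ 2" using eq by (simp add: Ivec_def)
    then have "absv (Ivec p n l a $ 1 / Tpol p n l a - calI p l a $ 2) \<le> \<pi> ^ n"
      using calI_close[OF l n(2) a n1, of 2] by (simp add: absv_minus_commute)
    with calI_close[OF l n(2) a n1, of 1]
    show "absv (calI p l a $ 1 - calI p l a $ 2) \<le> 1 * \<pi> ^ n"
      using absv_trans_le by auto
  qed
  then show ?thesis by simp
qed

lemma fiber_linear_relation:
  fixes a v :: "'k^2"
  assumes "v \<in> fiber p (a, l)" "x * calI p l a $ j + y * calI p l a $ k = 0"
  shows "x * v $ j + y * v $ k = 0"
proof -
  obtain c where c: "v = c *s calI p l a"
    using assms(1) by (auto simp: fiber_def vec.span_singleton)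
  have "x * v $ j + y * v $ k = c * (x * calI p l a $ j + y * calI p l a $ k)"
    by (simp add: c algebra_simps)
  then show ?thesis using assms(2) by simp
qed

text \<open>Both \<open>r\<close> and the limit vector are continuous, so membership extends from a dense
  subset.\<close>

lemma fiber_closed:
  fixes r :: "'k^2 \<Rightarrow> 'k^2"
  assumes l: "odd l" and U: "open U" "U \<subseteq> Dom_star p l"
    and an: "\<And>j. analytic_fun_on (\<lambda>a. r a $ j) U"
    and dense: "\<And>a e. a \<in> U \<Longrightarrow> 0 < e \<Longrightarrow> \<exists>x\<in>polydisc a e. P x"
    and fib: "\<And>x. x \<in> U \<Longrightarrow> P x \<Longrightarrow> r x \<in> fiber p (x, l)"
    and a: "a \<in> U"
  shows "r a \<in> fiber p (a, l)"
proof -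
  have aD: "a \<in> Dom_star p l" using U a by blast
  obtain B1 where B1: "1 \<le> B1" "\<And>j. absv (r a $ j) \<le> B1" using vec_bound[of "r a"] by blast
  obtain B2 where B2: "1 \<le> B2" "\<And>j. absv (calI p l a $ j) \<le> B2" using vec_bound[of "calI p l a"] by blast
  define B where "B = max B1 B2"
  have B: "1 \<le> B" "absv (r a $ j) \<le> B" "absv (calI p l a $ j) \<le> B" for j
    using B1(1) B1(2)[of j] B2(2)[of j] by (auto simp: B_def)
  have "absv (wedge 1 (r a) (calI p l a)) \<le> B * e" if e: "0 < e" "e \<le> 1" for e
  proof -
    obtain e0 where e0: "0 < e0" "polydisc a e0 \<subseteq> U" using open_contains_polydisc[OF U(1) a] .
    obtain d1 where d1: "0 < d1" "\<And>x. x \<in> polydisc a d1 \<Longrightarrow> absv (r x $ 1 - r a $ 1) < e"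
      by (rule analytic_at_continuous[OF analytic_fun_onD[OF an[of 1] U(1) a] e(1)]) blast
    obtain d2 where d2: "0 < d2" "\<And>x. x \<in> polydisc a d2 \<Longrightarrow> absv (r x $ 2 - r a $ 2) < e"
      by (rule analytic_at_continuous[OF analytic_fun_onD[OF an[of 2] U(1) a] e(1)]) blast
    have "0 < min (min e0 e) (min d1 d2)" using e0 d1 d2 e by simp
    then obtain x where x: "x \<in> polydisc a (min (min e0 e) (min d1 d2))" "P x" using dense[OF a] by blast
    then have x': "x \<in> polydisc a e0" "x \<in> polydisc a e" "x \<in> polydisc a d1" "x \<in> polydisc a d2"
      by (auto simp: polydisc_iff)
    then have xU: "x \<in> U" using e0 by blast
    have rx: "absv ((r a - r x) $ j) \<le> e" for j
      using d1(2)[OF x'(3)] d2(2)[OF x'(4)] exhaust_2[of j] by (auto simp: absv_minus_commute)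
    have rB: "absv (r x $ j) \<le> B" for j
      using absv_diff_le[of "r a $ j" B "(r a - r x) $ j"] rx[of j] B(1) B(2)[of j] e(2) by simp
    have dom: "a \<in> Dom p l" "x \<in> Dom p l" using a xU U(2) Dom_star_subset by blast+
    have cx: "absv ((calI p l a - calI p l x) $ j) \<le> e" for j
      using calI_lipschitz[OF l dom e(1), of j] x'(2)
      by (auto simp: polydisc_def absv_minus_commute less_imp_le)
    have "wedge 1 (r x) (calI p l x) = 0"
      using fib[OF xU x(2)] fiber_iff_wedge[OF l, of x "r x" 1] U(2) xU by blast
    then have "wedge 1 (r a) (calI p l a)
        = wedge 1 (r a - r x) (calI p l a) + wedge 1 (r x) (calI p l a - calI p l x)"
      by (simp add: wedge_diff_left wedge_diff_right)
    also have "absv \<dots> \<le> B * e"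
      using wedge_le[of "r a - r x" e "calI p l a" B 1, OF rx B(3)]
        wedge_le[of "r x" B "calI p l a - calI p l x" e 1, OF rB cx]
      by (intro absv_add_le) (simp_all add: mult.commute)
    finally show ?thesis .
  qed
  note le = this
  have "wedge 1 (r a) (calI p l a) = 0"
  proof (rule ccontr)
    assume nz: "wedge 1 (r a) (calI p l a) \<noteq> 0"
    define e where "e = min 1 (absv (wedge 1 (r a) (calI p l a)) / (2 * B))"
    have e: "0 < e" "e \<le> 1" "e \<le> absv (wedge 1 (r a) (calI p l a)) / (2 * B)"
      using nz B(1) by (auto simp: e_def)
    have "2 * (B * e) \<le> absv (wedge 1 (r a) (calI p l a))"
      using e(3) B(1) by (simp add: pos_le_divide_eq ac_simps)
    moreover have "0 < B * e" using B(1) e by simp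
    ultimately show False using le[OF e(1,2)] by linarith
  qed
  then show ?thesis using fiber_iff_wedge[OF l aD] by blast
qed

end

section \<open>Invariance of the line bundle\<close>

lemma swapv_open:
  fixes U :: "('a::nonarchimedean_field^2) set"
  assumes U: "open U"
  shows "open {x. swapv x \<in> U}"
  unfolding open_dist
proof
  fix a :: "'a^2" assume "a \<in> {x. swapv x \<in> U}"
  then have "swapv a \<in> U" by simp
  then obtain e where e: "0 < e" "polydisc (swapv a) e \<subseteq> U" using open_contains_polydisc[OF U] by blast
  have "swapv y \<in> U" if "dist y a < e" for y
  proof -
    have "y \<in> polydisc a e"
      using dist_vec_nth_le[of y _ a] that by (auto simp: polydisc_def dist_eq_absv intro: order_le_less_trans)
    then show ?thesis using e(2) swapv_in_polydisc by blast
  qed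
  then show "\<exists>e>0. \<forall>y. dist y a < e \<longrightarrow> y \<in> {x. swapv x \<in> U}" using e(1) by auto
qed

context residue_char
begin

lemma analytic_fun_on_divide_coord:
  fixes F :: "'k^2 \<Rightarrow> 'k"
  assumes U: "open U" and F: "analytic_fun_on F U"
    and vanish: "\<And>x. x \<in> U \<Longrightarrow> x$j = 0 \<Longrightarrow> F x = 0"
  obtains Q where "analytic_fun_on Q U" "\<And>x. x \<in> U \<Longrightarrow> x$j * Q x = F x"
proof -
  consider "j = 1" | "j = 2" using exhaust_2[of j] by blast
  then show ?thesis
  proof cases
    assume j: "j = 1"
    obtain Q where "analytic_fun_on Q U" "\<And>x. x \<in> U \<Longrightarrow> (x$1 - 0 * x$2) * Q x = F x"
      using analytic_fun_on_divide_linear[OF U F, of 0] vanish j by auto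
    then show ?thesis using j by (intro that[of Q]) simp_all
  next
    assume j: "j = 2"
    let ?V = "{x. swapv x \<in> U}"
    have "analytic_fun_on (\<lambda>x. F (swapv x)) ?V"
    proof (rule analytic_fun_onI)
      fix a assume "a \<in> ?V"
      then have "analytic_at F (swapv a)" using analytic_fun_onD[OF F U] by simp
      from analytic_at_swap[OF this] show "analytic_at (\<lambda>x. F (swapv x)) a" by simp
    qed
    moreover have "F (swapv x) = 0" if "x \<in> ?V" "x$1 = 0 * x$2" for x
      using vanish[of "swapv x"] that j by simp
    ultimately obtain Q where Q: "analytic_fun_on Q ?V"
      "\<And>x. x \<in> ?V \<Longrightarrow> (x$1 - 0 * x$2) * Q x = F (swapv x)"
      using analytic_fun_on_divide_linear[OF swapv_open[OF U], of "\<lambda>x. F (swapv x)" 0] by auto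
    show ?thesis
    proof (rule that[of "\<lambda>x. Q (swapv x)"])
      show "analytic_fun_on (\<lambda>x. Q (swapv x)) U"
      proof (rule analytic_fun_onI)
        fix a assume "a \<in> U"
        then have "analytic_at Q (swapv a)" using analytic_fun_onD[OF Q(1) swapv_open[OF U]] by simp
        from analytic_at_swap[OF this] show "analytic_at (\<lambda>x. Q (swapv x)) a" by simp
      qed
      show "x$j * Q (swapv x) = F x" if "x \<in> U" for x
        using Q(2)[of "swapv x"] that j by simp
    qed
  qed
qed

lemma Dom_Lambda_iff: "U \<times> {l} \<subseteq> Dom_Lambda p \<longleftrightarrow> U = {} \<or> odd l \<and> U \<subseteq> Dom_star p l"
  by (auto simp: Dom_Lambda_def)

text \<open>The singular part of the matrix acts through the difference of the two components, with the
  pole in the factor \<open>c\<close>.\<close>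

lemma Hmat_components:
  fixes z v :: "'k^2" and i :: 2
  defines "c \<equiv> z $ i / (z $ i - z $ other i)"
  shows "(Hmat i z l *v v) $ i = - (of_int l + 1) * v $ i - v $ other i - c * (v $ i - v $ other i)"
    and "(Hmat i z l *v v) $ other i = c * (v $ i - v $ other i)"
proof -
  have neq21: "((2::2) = 1) = False" by simp
  have "i = 1 \<or> i = 2" using exhaust_2[of i] .
  then have "(Hmat i z l *v v) $ i = - (of_int l + 1) * v $ i - v $ other i - c * (v $ i - v $ other i)
    \<and> (Hmat i z l *v v) $ other i = c * (v $ i - v $ other i)"
  proof
    assume i: "i = 1"
    have c: "c = z $ 1 / (z $ 1 - z $ 2)" by (simp add: c_def i)
    have H: "Hmat i z l = vector [vector [- of_int l - 1, - 1], vector [0, 0]]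
        + map_matrix (\<lambda>x. c * x) (vector [vector [- 1, 1], vector [1, - 1]])"
      by (simp only: Hmat_def i c if_True refl)
    show ?thesis
      unfolding H unfolding i by (simp add: matrix_vector_mult_def sum_2 vector_2 map_matrix_def algebra_simps)
  next
    assume i: "i = 2"
    have c: "c = z $ 2 / (z $ 2 - z $ 1)" by (simp add: c_def i)
    have H: "Hmat i z l = vector [vector [0, 0], vector [- 1, - of_int l - 1]]
        + map_matrix (\<lambda>x. c * x) (vector [vector [- 1, 1], vector [1, - 1]])"
      using neq21 by (simp only: Hmat_def i c if_False)
    show ?thesis
      unfolding H unfolding i by (simp add: matrix_vector_mult_def sum_2 vector_2 map_matrix_def algebra_simps)
  qed
  then show "(Hmat i z l *v v) $ i = - (of_int l + 1) * v $ i - v $ other i - c * (v $ i - v $ other i)"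
    and "(Hmat i z l *v v) $ other i = c * (v $ i - v $ other i)" by blast+
qed

lemma dynamical_components:
  fixes a :: "'k^2"
  assumes neq: "a $ i \<noteq> a $ other i"
    and q: "(a $ i - a $ other i) * q = s a $ i - s a $ other i"
  shows "dynamical i l s a $ i
      = 2 * a $ i * partial i s a $ i + (of_int l + 1) * s a $ i + s a $ other i + a $ i * q"
    and "dynamical i l s a $ other i = 2 * a $ i * partial i s a $ other i - a $ i * q"
proof -
  have "a $ i / (a $ i - a $ other i) * (s a $ i - s a $ other i) = a $ i * q"
    unfolding q[symmetric] using neq by simp
  then show "dynamical i l s a $ i
      = 2 * a $ i * partial i s a $ i + (of_int l + 1) * s a $ i + s a $ other i + a $ i * q"
    and "dynamical i l s a $ other i = 2 * a $ i * partial i s a $ other i - a $ i * q"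
    unfolding dynamical_def vector_minus_component vector_smult_component Hmat_components
    by (simp_all add: algebra_simps)
qed

lemma qKZ_components:
  fixes a :: "'k^2"
  assumes "odd l" "a $ j \<noteq> 0"
  shows "a $ j * of_int l * qKZ l s a $ j = (of_int l + 1) * s a $ j + s a $ other j"
proof -
  have "of_int l \<noteq> (0 :: 'k)" using assms(1) by auto
  then show ?thesis using assms(2) exhaust_2[of j]
    by (auto simp: qKZ_def Kmat_def matrix_vector_mult_def sum_2 vector_2 field_simps)
qed

text \<open>The function \<open>Q\<close> is the analytic quotient of the difference of components by
  \<open>z\<^sub>1 - z\<^sub>2\<close>; with it the dynamical operator makes sense on the diagonal.\<close>

lemma dynamical_invariance:
  fixes U :: "('k^2) set"
  assumes l: "odd l" and U: "U \<subseteq> Dom_star p l" and s: "local_section p l U s"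
  shows "\<exists>r. local_section p l U r \<and> (\<forall>a\<in>U. a $ 1 \<noteq> a $ 2 \<longrightarrow> r a = dynamical i l s a)"
proof -
  have oU: "open U" and an: "\<And>j. analytic_fun_on (\<lambda>a. s a $ j) U"
    and fib: "\<And>a. a \<in> U \<Longrightarrow> s a \<in> fiber p (a, l)"
    using s by (auto simp: local_section_def)
  have at: "\<And>a j. a \<in> U \<Longrightarrow> analytic_at (\<lambda>a. s a $ j) a"
    using analytic_fun_onD[OF an oU] by blast
  have "analytic_fun_on (\<lambda>a. s a $ 1 - s a $ 2) U"
    by (intro analytic_fun_onI analytic_at_diff at)
  moreover have "s a $ 1 - s a $ 2 = 0" if "a \<in> U" "a $ 1 = 1 * a $ 2" for a
  proof -
    have "a \<in> Dom p l" using that(1) U Dom_star_subset by blast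
    then have "1 * calI p l a $ 1 + (- 1) * calI p l a $ 2 = 0"
      using calI_on_diagonal[OF l] that(2) by simp
    from fiber_linear_relation[OF fib[OF that(1)] this] show ?thesis by simp
  qed
  ultimately obtain Q where Q: "analytic_fun_on Q U"
    "\<And>a. a \<in> U \<Longrightarrow> (a $ 1 - 1 * a $ 2) * Q a = s a $ 1 - s a $ 2"
    using analytic_fun_on_divide_linear[OF oU, of "\<lambda>a. s a $ 1 - s a $ 2" 1] by auto
  have Qat: "\<And>a. a \<in> U \<Longrightarrow> analytic_at Q a" using analytic_fun_onD[OF Q(1) oU] by blast
  have Pat: "\<And>a j. a \<in> U \<Longrightarrow> analytic_at (\<lambda>a. partial i s a $ j) a"
    using analytic_fun_onD[OF analytic_fun_on_partial(1)[OF oU an] oU] by blast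
  define r where "r = (\<lambda>a. \<chi> j. if j = i
    then 2 * (a $ i * partial i s a $ i) + (of_int l + 1) * s a $ i + s a $ other i + a $ i * Q a
    else 2 * (a $ i * partial i s a $ other i) - a $ i * Q a)"
  have r: "r a $ i = 2 * (a $ i * partial i s a $ i) + (of_int l + 1) * s a $ i + s a $ other i + a $ i * Q a"
    "r a $ other i = 2 * (a $ i * partial i s a $ other i) - a $ i * Q a" for a
    by (simp_all add: r_def)
  have r_an: "analytic_fun_on (\<lambda>a. r a $ j) U" for j
  proof -
    have "analytic_fun_on (\<lambda>a. r a $ i) U" "analytic_fun_on (\<lambda>a. r a $ other i) U"
      unfolding r by (intro analytic_fun_onI analytic_at_add analytic_at_diff analytic_at_cmult
          analytic_at_mult_coord at Pat Qat; assumption)+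
    then show ?thesis using eq_or_other[of j i] by auto
  qed
  have r_dyn: "r a = dynamical i l s a" if "a \<in> U" "a $ 1 \<noteq> a $ 2" for a
  proof -
    have neq: "a $ i \<noteq> a $ other i" using that(2) exhaust_2[of i] by auto
    have "(a $ 1 - a $ 2) * Q a = s a $ 1 - s a $ 2" using Q(2)[OF that(1)] by simp
    then have q: "(a $ i - a $ other i) * Q a = s a $ i - s a $ other i"
      using exhaust_2[of i] by (auto simp: algebra_simps)
    have "r a $ j = dynamical i l s a $ j" for j
      using eq_or_other[of j i] dynamical_components[where s = s and l = l, OF neq q]
      by (auto simp: r mult.assoc)
    then show ?thesis by (simp add: vec_eq_iff)
  qed
  have "r a \<in> fiber p (a, l)" if a: "a \<in> U" for a
  proof (rule fiber_closed[OF l oU U r_an _ _ a, where P = "\<lambda>x. x $ 1 \<noteq> x $ 2"])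
    fix b :: "'k^2" and e :: real assume "0 < e"
    show "\<exists>x\<in>polydisc b e. x $ 1 \<noteq> x $ 2"
    proof (cases "b $ 1 = b $ 2")
      case True
      obtain h :: 'k where h: "h \<noteq> 0" "absv h < e" using ex_small[OF \<open>0 < e\<close>] .
      have "b + axis 1 h \<in> polydisc b e"
        by (intro polydisc_add_axis center_in_polydisc h \<open>0 < e\<close>)
      moreover have "(b + axis 1 h) $ 1 \<noteq> (b + axis 1 h) $ 2"
        using True h(1) by (simp add: axis_def)
      ultimately show ?thesis by blast
    qed (use center_in_polydisc[OF \<open>0 < e\<close>] in blast)
  next
    fix x assume x: "x \<in> U" "x $ 1 \<noteq> x $ 2"
    obtain e where e: "0 < e" "polydisc x e \<subseteq> U" using open_contains_polydisc[OF oU x(1)] .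
    show "r x \<in> fiber p (x, l)"
    proof (rule dynamics_pointwise[OF l _ e(1)])
      show "x \<in> Dom_star p l" using U x by blast
      show "x + axis i h \<in> Dom_star p l \<and> s (x + axis i h) \<in> fiber p (x + axis i h, l)"
        if "absv h < e" for h
        using polydisc_add_axis[OF center_in_polydisc[OF e(1)] that, of x i] e(2) U fib by blast
      show "((\<lambda>h. (s (x + axis i h) $ j - s x $ j) / h) \<longlongrightarrow> partial i s x $ j) (at 0)" for j
        by (rule analytic_fun_on_partial(2)[OF oU an x(1)])
      show "x $ i \<noteq> x $ other i" using x(2) exhaust_2[of i] by auto
      have "(x $ 1 - x $ 2) * Q x = s x $ 1 - s x $ 2" using Q(2)[OF x(1)] by simp
      then show "(x $ i - x $ other i) * Q x = s x $ i - s x $ other i"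
        using exhaust_2[of i] by (auto simp: algebra_simps)
      show "r x $ i = 2 * x $ i * partial i s x $ i + (of_int l + 1) * s x $ i + s x $ other i + x $ i * Q x"
        "r x $ other i = 2 * x $ i * partial i s x $ other i - x $ i * Q x"
        by (simp_all add: r mult.assoc)
    qed
  qed
  then have "local_section p l U r"
    using oU U l r_an by (auto simp: local_section_def Dom_Lambda_iff)
  then show ?thesis using r_dyn by blast
qed

lemma qKZ_invariance:
  fixes U :: "('k^2) set"
  assumes l: "odd l" and U: "U \<subseteq> Dom_star p l \<inter> Dom_star p (l + 2)" and s: "local_section p l U s"
  shows "\<exists>r. local_section p (l + 2) U r \<and> (\<forall>a\<in>U. a $ 1 * a $ 2 \<noteq> 0 \<longrightarrow> r a = qKZ l s a)"
proof -
  have oU: "open U" and an: "\<And>j. analytic_fun_on (\<lambda>a. s a $ j) U"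
    and fib: "\<And>a. a \<in> U \<Longrightarrow> s a \<in> fiber p (a, l)"
    using s by (auto simp: local_section_def)
  have l2: "odd (l + 2)" using l by simp
  have U2: "U \<subseteq> Dom_star p (l + 2)" using U by blast
  have l0: "of_int l \<noteq> (0 :: 'k)" using l by auto
  have at: "\<And>a j. a \<in> U \<Longrightarrow> analytic_at (\<lambda>a. s a $ j) a"
    using analytic_fun_onD[OF an oU] by blast
  have "\<exists>Q. analytic_fun_on Q U \<and> (\<forall>a\<in>U. a $ j * Q a = (of_int l + 1) * s a $ j + s a $ other j)" for j
  proof -
    have "analytic_fun_on (\<lambda>a. (of_int l + 1) * s a $ j + s a $ other j) U"
      by (intro analytic_fun_onI analytic_at_add analytic_at_cmult at)
    moreover have "(of_int l + 1) * s a $ j + s a $ other j = 0" if "a \<in> U" "a $ j = 0" for a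
    proof -
      have "a \<in> Dom p l" using that(1) U Dom_star_subset by blast
      then have "(of_int l + 1) * calI p l a $ j + 1 * calI p l a $ other j = 0"
        using calI_on_axis[OF l] that(2) by simp
      from fiber_linear_relation[OF fib[OF that(1)] this] show ?thesis by simp
    qed
    ultimately obtain Q where "analytic_fun_on Q U"
      "\<And>a. a \<in> U \<Longrightarrow> a $ j * Q a = (of_int l + 1) * s a $ j + s a $ other j"
      using analytic_fun_on_divide_coord[OF oU, of "\<lambda>a. (of_int l + 1) * s a $ j + s a $ other j" j] by auto
    then show ?thesis by blast
  qed
  then obtain Q where Q: "\<And>j. analytic_fun_on (Q j) U"
    "\<And>j a. a \<in> U \<Longrightarrow> a $ j * Q j a = (of_int l + 1) * s a $ j + s a $ other j" by metis
  define r where "r = (\<lambda>a. \<chi> j. inverse (of_int l) * Q j a)"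
  have r_an: "analytic_fun_on (\<lambda>a. r a $ j) U" for j
  proof -
    have "analytic_fun_on (\<lambda>a. inverse (of_int l) * Q j a) U"
      using analytic_fun_onD[OF Q(1) oU] by (intro analytic_fun_onI analytic_at_cmult)
    then show ?thesis by (simp add: r_def)
  qed
  have r: "a $ j * of_int l * r a $ j = (of_int l + 1) * s a $ j + s a $ other j" if "a \<in> U" for a j
    using Q(2)[OF that, of j] l0 by (simp add: r_def field_simps)
  have r_qKZ: "r a = qKZ l s a" if a: "a \<in> U" "a $ 1 * a $ 2 \<noteq> 0" for a
  proof -
    have "r a $ j = qKZ l s a $ j" for j
    proof -
      have nz: "a $ j \<noteq> 0" using a(2) exhaust_2[of j] by auto
      have "(a $ j * of_int l) * r a $ j = (a $ j * of_int l) * qKZ l s a $ j"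
        using r[OF a(1), of j] qKZ_components[OF l nz, of s] by simp
      then show ?thesis using nz l0 by simp
    qed
    then show ?thesis by (simp add: vec_eq_iff)
  qed
  have "r a \<in> fiber p (a, l + 2)" if a: "a \<in> U" for a
  proof (rule fiber_closed[OF l2 oU U2 r_an _ _ a, where P = "\<lambda>x. x $ 1 \<noteq> 0 \<and> x $ 2 \<noteq> 0"])
    fix b :: "'k^2" and e :: real assume e: "0 < e"
    \<comment> \<open>Moving both coordinates by the same small \<open>h\<close> leaves the axes, provided that \<open>h\<close> is smaller than the nonzero coordinates of \<open>b\<close>.\<close>
    define d where "d = min e (min (if b $ 1 = 0 then 1 else absv (b $ 1)) (if b $ 2 = 0 then 1 else absv (b $ 2)))"
    have "0 < d" using e by (auto simp: d_def)
    then obtain h :: 'k where h: "h \<noteq> 0" "absv h < d" using ex_small by blast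
    have he: "absv h < e" using h(2) by (simp add: d_def)
    have nz: "b $ j + h \<noteq> 0" for j
    proof
      assume "b $ j + h = 0"
      then have "b $ j = - h" by (simp add: eq_neg_iff_add_eq_0)
      then have "absv (b $ j) = absv h" "b $ j \<noteq> 0" using h(1) by auto
      then show False using h(2) exhaust_2[of j] by (auto simp: d_def split: if_splits)
    qed
    have "b + axis 1 h + axis 2 h \<in> polydisc b e"
      by (intro polydisc_add_axis center_in_polydisc he e)
    moreover have "(b + axis 1 h + axis 2 h) $ 1 \<noteq> 0 \<and> (b + axis 1 h + axis 2 h) $ 2 \<noteq> 0"
      using nz by (simp add: axis_def)
    ultimately show "\<exists>x\<in>polydisc b e. x $ 1 \<noteq> 0 \<and> x $ 2 \<noteq> 0" by blast
  next
    fix x assume x: "x \<in> U" "x $ 1 \<noteq> 0 \<and> x $ 2 \<noteq> 0"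
    have "x \<in> Dom_star p l" "x \<in> Dom_star p (l + 2)" using U x by auto
    then show "r x \<in> fiber p (x, l + 2)"
      using x fib[OF x(1)] r[OF x(1)] by (intro qKZ_pointwise[OF l]) auto
  qed
  then have "local_section p (l + 2) U r"
    using oU U2 l2 r_an by (auto simp: local_section_def Dom_Lambda_iff)
  then show ?thesis using r_qKZ by blast
qed

end

lemma padic_abs_self:
  assumes "prime p"
  shows "padic_abs p (of_nat p) = 1 / real p"
proof -
  have "quotient_of (of_nat p) = (int p, 1)"
    using quotient_of_int[of "int p"] by (simp add: of_int_of_nat_eq)
  moreover have "multiplicity (int p) (int p) = 1"
    using assms prime_gt_1_nat[OF assms] by (intro multiplicity_self) auto
  ultimately show ?thesis
    using prime_gt_0_nat[OF assms] by (simp add: padic_abs_def power_int_minus field_simps)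
qed

theorem theorem5p9:
  fixes p m :: nat and l :: int
  assumes "prime p" and "odd p" and "m > 0"
    and "unramified_padic_field TYPE('k::nonarchimedean_field) p m"
    and "odd l"
  shows "(\<forall>(U :: ('k::nonarchimedean_field^2) set) s i.
            U \<subseteq> Dom_star p l \<and> local_section p l U s \<longrightarrow>
            (\<exists>r. local_section p l U r \<and>
               (\<forall>a\<in>U. a$1 \<noteq> a$2 \<longrightarrow> r a = dynamical i l s a)))
       \<and> (\<forall>(U :: ('k::nonarchimedean_field^2) set) s.
            U \<subseteq> Dom_star p l \<inter> Dom_star p (l + 2) \<and> local_section p l U s \<longrightarrow>
            (\<exists>r. local_section p (l + 2) U r \<and>
               (\<forall>a\<in>U. a$1 * a$2 \<noteq> 0 \<longrightarrow> r a = qKZ l s a)))"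
proof -
  have "\<forall>q. absv (of_rat q :: 'k) = padic_abs p q"
    using assms(4) unfolding unramified_padic_field_def by (rule conjunct1)
  then have "absv (of_rat (of_nat p) :: 'k) = padic_abs p (of_nat p)" by (rule spec)
  then have "absv (of_nat p :: 'k) = 1 / real p"
    using padic_abs_self[OF assms(1)] by simp
  then have "absv (of_nat p :: 'k) < 1"
    using prime_gt_1_nat[OF assms(1)] by simp
  then interpret residue_char p "TYPE('k)"
    by (rule residue_char.intro[OF assms(1,2)])
  show ?thesis
  proof (intro conjI allI impI)
    show "\<exists>r. local_section p l U r \<and> (\<forall>a\<in>U. a$1 \<noteq> a$2 \<longrightarrow> r a = dynamical i l s a)"
      if "U \<subseteq> Dom_star p l \<and> local_section p l U s" for U :: "('k^2) set" and s i
      using dynamical_invariance[OF assms(5) conjunct1[OF that] conjunct2[OF that]] .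
    show "\<exists>r. local_section p (l + 2) U r \<and> (\<forall>a\<in>U. a$1 * a$2 \<noteq> 0 \<longrightarrow> r a = qKZ l s a)"
      if "U \<subseteq> Dom_star p l \<inter> Dom_star p (l + 2) \<and> local_section p l U s" for U :: "('k^2) set" and s
      using qKZ_invariance[OF assms(5) conjunct1[OF that] conjunct2[OF that]] .
  qed
qed

end
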